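(* Let $\mathcal A$ be a Banach algebra with a contractive approximate identity. Then the following are equivalent: (1) $M(\mathcal A)$ is a dual Banach algebra for some predual; (2) there exists a closed $\mathcal A$-submodule $Z$ of $\mathrm{WAP}(\mathcal A^* )$ such that $\theta_0:M(\mathcal A)\to Z^*$ is an isometric isomorphism, where $\theta_0$ is the composition of $\theta_w:M(\mathcal A)\to\mathrm{WAP}(\mathcal A^* )^*$ with the quotient (restriction) map $\mathrm{WAP}(\mathcal A^* )^*\to Z^*$. When (1) holds, we can choose $Z$ in (2) such that $\theta_0:M(\mathcal A)\to Z^*$ is weak$^*$-continuous (for the given predual of $M(\mathcal A)$). Thus all possible dual Banach algebra weak$^*$-topologies which can occur on $M(\mathcal A)$ arise by the construction of (2).
   Context: $M(\mathcal A)$ is the Banach algebra of multipliers: pairs $(L,R)$ of (automatically bounded linear) maps $\mathcal A\to\mathcal A$ with $aL(b)=R(a)b$ for all $a,b\in\mathcal A$, with norm $\max(\|L\|,\|R\|)$ and product $(L,R)(L',R')=(LL',R'R)$. A dual Banach algebra is a Banach algebra that is isometrically the dual of a Banach space (its predual) such that multiplication is separately weak$^*$-continuous. $\mathcal A^*$ is an $\mathcal A$-bimodule via $\langle a\cdot\mu,b\rangle=\langle\mu,ba\rangle$, $\langle\mu\cdot a,b\rangle=\langle\mu,ab\rangle$. $\mathrm{WAP}(\mathcal A^* )$ is the closed submodule of those $\mu\in\mathcal A^*$ such that the maps $\mathcal A\to\mathcal A^*$, $a\mapsto a\cdot\mu$ and $a\mapsto\mu\cdot a$, are weakly compact. Let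 $(e_\alpha)$ be the contractive approximate identity and $\Phi_0\in\mathcal A^{**}$ a weak$^*$-accumulation point of $(e_\alpha)$. Then $\theta_w(L,R)$ is the restriction of $L^{**}(\Phi_0)\in\mathcal A^{**}$ to $\mathrm{WAP}(\mathcal A^* )$. *)

theory Defs
  imports "HOL-Analysis.Analysis" "HOL-Library.Function_Algebras"
begin

section \<open>Complex vector spaces and complex Banach algebras\<close>

text \<open>
  All spaces are complex.  The ambient Banach algebra is a type; every other space (duals, submodules
  of duals, the multiplier algebra, preduals) is a subset \<open>X\<close> of a complex vector space type together
  with a norm \<open>N\<close> of which only the values on \<open>X\<close> matter.
\<close>

class complex_vector = ab_group_add +
  fixes scaleC :: "complex \<Rightarrow> 'a \<Rightarrow> 'a"  (infixr "*\<^sub>C" 75)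
  assumes scaleC_add_right: "c *\<^sub>C (x + y) = c *\<^sub>C x + c *\<^sub>C y"
    and scaleC_add_left: "(c + d) *\<^sub>C x = c *\<^sub>C x + d *\<^sub>C x"
    and scaleC_scaleC: "c *\<^sub>C (d *\<^sub>C x) = (c * d) *\<^sub>C x"
    and scaleC_one: "1 *\<^sub>C x = x"

global_interpretation complex_vector:
  vector_space "scaleC :: complex \<Rightarrow> 'a \<Rightarrow> 'a::complex_vector"
  by unfold_locales (rule scaleC_add_right scaleC_add_left scaleC_scaleC scaleC_one)+

class complex_banach_algebra = complex_vector + real_normed_algebra + banach +
  assumes scaleR_eq_scaleC: "r *\<^sub>R x = complex_of_real r *\<^sub>C x"
    and norm_scaleC: "norm (c *\<^sub>C x) = cmod c * norm x"
    and mult_scaleC_left: "(c *\<^sub>C x) * y = c *\<^sub>C (x * y)"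
    and mult_scaleC_right: "x * (c *\<^sub>C y) = c *\<^sub>C (x * y)"

instantiation complex :: complex_vector
begin
definition scaleC_complex :: "complex \<Rightarrow> complex \<Rightarrow> complex" where "scaleC_complex c z = c * z"
instance by standard (simp_all add: scaleC_complex_def algebra_simps)
end

instantiation "fun" :: (type, complex_vector) complex_vector
begin
definition scaleC_fun :: "complex \<Rightarrow> ('a \<Rightarrow> 'b) \<Rightarrow> 'a \<Rightarrow> 'b" where
  "scaleC_fun c f = (\<lambda>x. c *\<^sub>C f x)"
instance
  by standard (simp_all add: scaleC_fun_def plus_fun_def scaleC_add_right scaleC_add_left
      scaleC_scaleC scaleC_one)
end

instantiation prod :: (complex_vector, complex_vector) complex_vector
begin
definition scaleC_prod :: "complex \<Rightarrow> 'a \<times> 'b \<Rightarrow> 'a \<times> 'b" where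
  "scaleC_prod c p = (c *\<^sub>C fst p, c *\<^sub>C snd p)"
instance
  by standard (simp_all add: scaleC_prod_def prod_eq_iff scaleC_add_right scaleC_add_left
      scaleC_scaleC scaleC_one)
end

section \<open>Normed spaces on carrier sets\<close>

definition clinear_on :: "'v::complex_vector set \<Rightarrow> ('v \<Rightarrow> 'w::complex_vector) \<Rightarrow> bool" where
  "clinear_on X T \<longleftrightarrow>
     (\<forall>x\<in>X. \<forall>y\<in>X. T (x + y) = T x + T y) \<and> (\<forall>c. \<forall>x\<in>X. T (c *\<^sub>C x) = c *\<^sub>C T x)"

definition normed_space_on :: "'v::complex_vector set \<Rightarrow> ('v \<Rightarrow> real) \<Rightarrow> bool" where
  "normed_space_on X N \<longleftrightarrow>
     complex_vector.subspace X \<and>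
     (\<forall>x\<in>X. 0 \<le> N x \<and> (N x = 0 \<longleftrightarrow> x = 0)) \<and>
     (\<forall>c. \<forall>x\<in>X. N (c *\<^sub>C x) = cmod c * N x) \<and>
     (\<forall>x\<in>X. \<forall>y\<in>X. N (x + y) \<le> N x + N y)"

text \<open>
  The library locale \<open>Metric_space\<close> wants nonnegativity and symmetry on the whole type, hence the
  value \<open>0\<close> off the carrier.
\<close>

definition norm_dist :: "'v::complex_vector set \<Rightarrow> ('v \<Rightarrow> real) \<Rightarrow> 'v \<Rightarrow> 'v \<Rightarrow> real" where
  "norm_dist X N x y = (if x \<in> X \<and> y \<in> X then N (x - y) else 0)"

definition norm_topology :: "'v::complex_vector set \<Rightarrow> ('v \<Rightarrow> real) \<Rightarrow> 'v topology" where
  "norm_topology X N = Metric_space.mtopology X (norm_dist X N)"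

definition banach_space_on :: "'v::complex_vector set \<Rightarrow> ('v \<Rightarrow> real) \<Rightarrow> bool" where
  "banach_space_on X N \<longleftrightarrow>
     normed_space_on X N \<and> Metric_space.mcomplete X (norm_dist X N)"

definition banach_algebra_on ::
  "'v::complex_vector set \<Rightarrow> ('v \<Rightarrow> 'v \<Rightarrow> 'v) \<Rightarrow> ('v \<Rightarrow> real) \<Rightarrow> bool" where
  "banach_algebra_on X m N \<longleftrightarrow>
     banach_space_on X N \<and>
     (\<forall>x\<in>X. \<forall>y\<in>X. m x y \<in> X) \<and>
     (\<forall>x\<in>X. \<forall>y\<in>X. \<forall>z\<in>X. m (m x y) z = m x (m y z)) \<and>
     (\<forall>x\<in>X. clinear_on X (\<lambda>y. m x y) \<and> clinear_on X (\<lambda>y. m y x)) \<and>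
     (\<forall>x\<in>X. \<forall>y\<in>X. N (m x y) \<le> N x * N y)"

definition isometric_isomorphism ::
  "'v::complex_vector set \<Rightarrow> ('v \<Rightarrow> real) \<Rightarrow> 'w::complex_vector set \<Rightarrow> ('w \<Rightarrow> real) \<Rightarrow> ('v \<Rightarrow> 'w) \<Rightarrow> bool"
  where
  "isometric_isomorphism X N Y N' T \<longleftrightarrow>
     clinear_on X T \<and> bij_betw T X Y \<and> (\<forall>x\<in>X. N' (T x) = N x)"

lemma Metric_space_norm_dist:
  assumes "normed_space_on X N"
  shows "Metric_space X (norm_dist X N)"
proof -
  have sub: "complex_vector.subspace X" using assms by (simp add: normed_space_on_def)
  have diff: "x - y \<in> X" if "x \<in> X" "y \<in> X" for x y
    using that sub by (rule_tac complex_vector.subspace_diff)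
  have minus: "N (x - y) = N (y - x)" if "x \<in> X" "y \<in> X" for x y
  proof -
    have "y - x = (- 1) *\<^sub>C (x - y)" by (simp add: complex_vector.scale_minus_left scaleC_one)
    moreover have "N ((- 1) *\<^sub>C (x - y)) = cmod (- 1) * N (x - y)"
      using assms diff[OF that] unfolding normed_space_on_def by blast
    ultimately show ?thesis by simp
  qed
  have tri: "N (x - z) \<le> N (x - y) + N (y - z)" if "x \<in> X" "y \<in> X" "z \<in> X" for x y z
  proof -
    have "N ((x - y) + (y - z)) \<le> N (x - y) + N (y - z)"
      using assms diff[OF that(1,2)] diff[OF that(2,3)] unfolding normed_space_on_def by blast
    then show ?thesis by simp
  qed
  show ?thesis
    by unfold_locales
      (use assms diff minus tri in \<open>auto simp: norm_dist_def normed_space_on_def\<close>)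
qed

section \<open>Duals, weak and weak$^*$ topologies\<close>

text \<open>
  Functionals on \<open>X\<close> are functions on the whole type, extended by \<open>0\<close> outside \<open>X\<close>.  Thus equal
  functionals are equal functions and the pointwise operations of the function type are the right ones.
\<close>

definition restrict0 :: "'v set \<Rightarrow> ('v \<Rightarrow> complex) \<Rightarrow> 'v \<Rightarrow> complex" where
  "restrict0 X f = (\<lambda>x. if x \<in> X then f x else 0)"

definition dual :: "'v::complex_vector set \<Rightarrow> ('v \<Rightarrow> real) \<Rightarrow> ('v \<Rightarrow> complex) set" where
  "dual X N = {f. (\<forall>x. x \<notin> X \<longrightarrow> f x = 0) \<and> clinear_on X f \<and> (\<exists>B. \<forall>x\<in>X. cmod (f x) \<le> B * N x)}"

definition dual_norm :: "'v set \<Rightarrow> ('v \<Rightarrow> real) \<Rightarrow> ('v \<Rightarrow> complex) \<Rightarrow> real" where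
  "dual_norm X N f = Sup {cmod (f x) | x. x \<in> X \<and> N x \<le> 1}"

definition weak_topology :: "'v::complex_vector set \<Rightarrow> ('v \<Rightarrow> real) \<Rightarrow> 'v topology" where
  "weak_topology X N =
     pullback_topology X (\<lambda>x. \<lambda>f\<in>dual X N. f x) (product_topology (\<lambda>_. euclidean) (dual X N))"

definition weak_star_topology ::
  "'v::complex_vector set \<Rightarrow> ('v \<Rightarrow> real) \<Rightarrow> ('v \<Rightarrow> complex) topology" where
  "weak_star_topology X N =
     pullback_topology (dual X N) (\<lambda>f. \<lambda>x\<in>X. f x) (product_topology (\<lambda>_. euclidean) X)"

definition weakly_compact_map ::
  "'v::complex_vector set \<Rightarrow> ('v \<Rightarrow> real) \<Rightarrow> 'w::complex_vector set \<Rightarrow> ('w \<Rightarrow> real) \<Rightarrow> ('v \<Rightarrow> 'w) \<Rightarrow> bool"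
  where
  "weakly_compact_map X N Y N' T \<longleftrightarrow>
     clinear_on X T \<and> T ` X \<subseteq> Y \<and>
     compactin (weak_topology Y N') (weak_topology Y N' closure_of (T ` {x \<in> X. N x \<le> 1}))"

text \<open>
  \<open>J\<close> is the identification of the algebra \<open>(X, m, N)\<close> with the dual of the predual \<open>(E, NE)\<close>; the
  weak$^*$ topology on \<open>X\<close> is transported along it.
\<close>

definition predual_topology ::
  "'v::complex_vector set \<Rightarrow> 'e::complex_vector set \<Rightarrow> ('e \<Rightarrow> real) \<Rightarrow> ('v \<Rightarrow> 'e \<Rightarrow> complex) \<Rightarrow> 'v topology"
  where
  "predual_topology X E NE J = pullback_topology X J (weak_star_topology E NE)"

definition dual_banach_algebra ::
  "'v::complex_vector set \<Rightarrow> ('v \<Rightarrow> 'v \<Rightarrow> 'v) \<Rightarrow> ('v \<Rightarrow> real) \<Rightarrow>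
   'e::complex_vector set \<Rightarrow> ('e \<Rightarrow> real) \<Rightarrow> ('v \<Rightarrow> 'e \<Rightarrow> complex) \<Rightarrow> bool" where
  "dual_banach_algebra X m N E NE J \<longleftrightarrow>
     banach_algebra_on X m N \<and>
     banach_space_on E NE \<and>
     isometric_isomorphism X N (dual E NE) (dual_norm E NE) J \<and>
     (\<forall>x\<in>X. continuous_map (predual_topology X E NE J) (predual_topology X E NE J) (\<lambda>y. m x y) \<and>
             continuous_map (predual_topology X E NE J) (predual_topology X E NE J) (\<lambda>y. m y x))"

section \<open>Multipliers and weakly almost periodic functionals\<close>

definition multipliers :: "(('a::complex_banach_algebra \<Rightarrow> 'a) \<times> ('a \<Rightarrow> 'a)) set" where
  "multipliers = {(L, R). \<forall>a b. a * L b = R a * b}"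

definition mult_norm :: "('a::complex_banach_algebra \<Rightarrow> 'a) \<times> ('a \<Rightarrow> 'a) \<Rightarrow> real" where
  "mult_norm = (\<lambda>(L, R). max (onorm L) (onorm R))"

definition mult_prod ::
  "('a \<Rightarrow> 'a) \<times> ('a \<Rightarrow> 'a) \<Rightarrow> ('a \<Rightarrow> 'a) \<times> ('a \<Rightarrow> 'a) \<Rightarrow> ('a \<Rightarrow> 'a) \<times> ('a \<Rightarrow> 'a)" where
  "mult_prod = (\<lambda>(L, R) (L', R'). (L \<circ> L', R' \<circ> R))"

abbreviation alg_dual :: "('a::complex_banach_algebra \<Rightarrow> complex) set" where
  "alg_dual \<equiv> dual UNIV norm"

abbreviation alg_dual_norm :: "('a::complex_banach_algebra \<Rightarrow> complex) \<Rightarrow> real" where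
  "alg_dual_norm \<equiv> dual_norm UNIV norm"

definition left_act ::
  "'a::complex_banach_algebra \<Rightarrow> ('a \<Rightarrow> complex) \<Rightarrow> 'a \<Rightarrow> complex" where
  "left_act a \<mu> = (\<lambda>b. \<mu> (b * a))"

definition right_act ::
  "('a::complex_banach_algebra \<Rightarrow> complex) \<Rightarrow> 'a \<Rightarrow> 'a \<Rightarrow> complex" where
  "right_act \<mu> a = (\<lambda>b. \<mu> (a * b))"

definition WAP :: "('a::complex_banach_algebra \<Rightarrow> complex) set" where
  "WAP = {\<mu> \<in> alg_dual.
     weakly_compact_map UNIV norm alg_dual alg_dual_norm (\<lambda>a. left_act a \<mu>) \<and>
     weakly_compact_map UNIV norm alg_dual alg_dual_norm (\<lambda>a. right_act \<mu> a)}"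

definition closed_submodule_of_WAP :: "('a::complex_banach_algebra \<Rightarrow> complex) set \<Rightarrow> bool" where
  "closed_submodule_of_WAP Z \<longleftrightarrow>
     Z \<subseteq> WAP \<and> complex_vector.subspace Z \<and>
     (\<forall>a. \<forall>\<mu>\<in>Z. left_act a \<mu> \<in> Z \<and> right_act \<mu> a \<in> Z) \<and>
     closedin (norm_topology alg_dual alg_dual_norm) Z"

section \<open>Approximate identities and the map into the dual of a submodule\<close>

text \<open>
  A net is a family \<open>e\<close> together with a proper filter \<open>F\<close> on its index type; for a directed index set,
  \<open>F\<close> is the filter of its tails, and \<open>frequently\<close> then means \<open>cofinally often\<close>.
\<close>

definition contractive_approximate_identity ::
  "('i \<Rightarrow> 'a::complex_banach_algebra) \<Rightarrow> 'i filter \<Rightarrow> bool" where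
  "contractive_approximate_identity e F \<longleftrightarrow>
     F \<noteq> bot \<and> (\<forall>i. norm (e i) \<le> 1) \<and>
     (\<forall>a. ((\<lambda>i. e i * a) \<longlongrightarrow> a) F \<and> ((\<lambda>i. a * e i) \<longlongrightarrow> a) F)"

definition accumulation_point :: "'x topology \<Rightarrow> ('i \<Rightarrow> 'x) \<Rightarrow> 'i filter \<Rightarrow> 'x \<Rightarrow> bool" where
  "accumulation_point T x F p \<longleftrightarrow>
     p \<in> topspace T \<and> (\<forall>U. openin T U \<and> p \<in> U \<longrightarrow> (\<exists>\<^sub>F i in F. x i \<in> U))"

definition bidual_embedding ::
  "'a::complex_banach_algebra \<Rightarrow> ('a \<Rightarrow> complex) \<Rightarrow> complex" where
  "bidual_embedding a = restrict0 alg_dual (\<lambda>\<mu>. \<mu> a)"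

definition biadjoint ::
  "('a::complex_banach_algebra \<Rightarrow> 'a) \<Rightarrow> (('a \<Rightarrow> complex) \<Rightarrow> complex) \<Rightarrow> ('a \<Rightarrow> complex) \<Rightarrow> complex" where
  "biadjoint L \<Phi> = restrict0 alg_dual (\<lambda>\<mu>. \<Phi> (\<mu> \<circ> L))"

definition theta_w ::
  "(('a::complex_banach_algebra \<Rightarrow> complex) \<Rightarrow> complex) \<Rightarrow> ('a \<Rightarrow> 'a) \<times> ('a \<Rightarrow> 'a) \<Rightarrow>
   ('a \<Rightarrow> complex) \<Rightarrow> complex" where
  "theta_w \<Phi>\<^sub>0 = (\<lambda>(L, R). restrict0 WAP (biadjoint L \<Phi>\<^sub>0))"

definition theta_0 ::
  "(('a::complex_banach_algebra \<Rightarrow> complex) \<Rightarrow> complex) \<Rightarrow> ('a \<Rightarrow> complex) set \<Rightarrow>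
   ('a \<Rightarrow> 'a) \<times> ('a \<Rightarrow> 'a) \<Rightarrow> ('a \<Rightarrow> complex) \<Rightarrow> complex" where
  "theta_0 \<Phi>\<^sub>0 Z = restrict0 Z \<circ> theta_w \<Phi>\<^sub>0"

text \<open>
  HOL cannot quantify existentially over types.  Every predual of the multiplier algebra embeds
  isometrically into the dual of the multiplier algebra, so it has a copy inside the type below; it is
  therefore enough to ask for a predual there.
\<close>

type_synonym 'a predual_host = "('a \<Rightarrow> 'a) \<times> ('a \<Rightarrow> 'a) \<Rightarrow> complex"

end

theory Submission
  imports Defs
begin

text \<open>
  Let \<open>M\<close> be the multiplier algebra and write \<open>\<iota> a\<close> for the multiplier given by \<open>a\<close>.

  If \<open>M\<close> is the dual of \<open>E\<close>, each \<open>\<xi>\<close> in \<open>E\<close> yields the functional \<open>a \<mapsto> \<langle>\<iota> a, \<xi>\<rangle>\<close> on the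
  algebra.  By Banach-Alaoglu and separate weak$^*$-continuity \<open>\<iota> (e i)\<close> tends weak$^*$ to the
  identity, hence \<open>\<iota> (L (e i))\<close> to \<open>(L, R)\<close>.  So the unit ball of the algebra is weak$^*$-dense in
  that of \<open>M\<close>, the map from \<open>E\<close> to functionals is isometric, and its image is the submodule \<open>Z\<close>;
  under \<open>E \<cong> Z\<close> the map \<open>\<theta>\<^sub>0\<close> is the given identification of \<open>M\<close> with the dual of \<open>E\<close>.  The
  functionals are weakly almost periodic because \<open>n \<mapsto> n \<cdot> \<xi>\<close> is weak$^*$-weakly continuous on the
  compact unit ball of \<open>M\<close>.

  Conversely, for \<open>\<mu>\<close> in \<open>Z\<close> the functionals \<open>\<mu> \<circ> L\<close> and \<open>\<mu> \<circ> R\<close> are weak limits of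
  \<open>\<mu> \<cdot> R (e i)\<close> and \<open>L (e i) \<cdot> \<mu>\<close>, so they lie in \<open>Z\<close>; and \<open>\<Phi>\<^sub>0 (\<mu> \<circ> L) = \<Phi>\<^sub>0 (\<mu> \<circ> R)\<close> by
  interchanging limits.  Multiplication by \<open>(L, R)\<close> on \<open>M\<close> is therefore adjoint to
  \<open>\<mu> \<mapsto> \<mu> \<circ> L\<close>, respectively \<open>\<mu> \<mapsto> \<mu> \<circ> R\<close>, on \<open>Z\<close>.
\<close>

section \<open>The Hahn-Banach theorem on carrier sets\<close>

text \<open>Both directions rest on one compactness principle,
  \<open>tendsto_initial_compact\<close>: on a compact set, convergence to a point in every
  coordinate follows from convergence in a subfamily of coordinates that singles out this point. In
  the unit ball of M the subfamily consists of the elements of E obtained by letting some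
  \<open>\<iota> a\<close> act; there the convergence of \<open>\<iota> (e i)\<close> is norm
  convergence of \<open>a * e i\<close> to \<open>a\<close>. In the weakly compact orbits of a
  weakly almost periodic functional it consists of evaluations at points of the algebra, so
  pointwise limits become weak limits, and Hahn-Banach keeps them inside a closed submodule.

  Orbit maps are weak*-weakly continuous for this reason: an element of the bidual, restricted to E,
  lies in the dual of E, hence is pairing with some multiplier k, and multiplication by k is
  weak*-continuous.

  In the converse, completeness of M is read off from the dual of Z. As Z does not have the type in
  which a predual is sought, it is replaced by the functionals on M that its elements induce through
  \<open>\<theta>\<^sub>0\<close>.\<close>

definition sublinear_on :: "'v::complex_vector set \<Rightarrow> ('v \<Rightarrow> real) \<Rightarrow> bool" where
  "sublinear_on X p \<longleftrightarrow>
     (\<forall>x\<in>X. \<forall>y\<in>X. p (x + y) \<le> p x + p y) \<and>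
     (\<forall>x\<in>X. \<forall>t>0. p (complex_of_real t *\<^sub>C x) \<le> t * p x)"

lemma sublinear_on_add: "sublinear_on X p \<Longrightarrow> x \<in> X \<Longrightarrow> y \<in> X \<Longrightarrow> p (x + y) \<le> p x + p y"
  by (simp add: sublinear_on_def)

text \<open>The assumed inequality with factor \<open>inverse t\<close>, taken at the scaled point,
  is the reverse inequality.\<close>

lemma sublinear_on_scale:
  assumes "sublinear_on X p" "complex_vector.subspace X" "x \<in> X" "t > 0"
  shows "p (complex_of_real t *\<^sub>C x) = t * p x"
proof (rule antisym)
  show "p (complex_of_real t *\<^sub>C x) \<le> t * p x"
    using assms by (simp add: sublinear_on_def)
  have "complex_of_real t *\<^sub>C x \<in> X"
    using assms by (simp add: complex_vector.subspace_scale)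
  then have "p (complex_of_real (inverse t) *\<^sub>C complex_of_real t *\<^sub>C x)
      \<le> inverse t * p (complex_of_real t *\<^sub>C x)"
    using assms unfolding sublinear_on_def by (metis positive_imp_inverse_positive)
  moreover have "complex_of_real (inverse t) *\<^sub>C complex_of_real t *\<^sub>C x = x"
    using \<open>t > 0\<close> by (simp add: scaleC_one)
  ultimately show "t * p x \<le> p (complex_of_real t *\<^sub>C x)"
    using \<open>t > 0\<close> by (simp add: field_simps)
qed

lemma sublinear_on_0:
  assumes "sublinear_on X p" "complex_vector.subspace X"
  shows "p 0 = 0"
  using sublinear_on_scale[OF assms complex_vector.subspace_0[OF assms(2)], of 2] by simp

lemma sublinear_on_lower:
  assumes "sublinear_on X p" "complex_vector.subspace X" "x \<in> X"
  shows "- p (- x) \<le> p x"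
  using sublinear_on_add[OF assms(1,3), of "- x"] sublinear_on_0[OF assms(1,2)] assms
  by (simp add: complex_vector.subspace_neg)

text \<open>
  The largest sublinear minorant of \<open>p\<close> that is additive in the direction \<open>x\<^sub>0\<close>: it serves both to
  prescribe the value at \<open>x\<^sub>0\<close> and to show that minimal sublinear functionals are additive.
\<close>

definition shift_inf :: "('v::complex_vector \<Rightarrow> real) \<Rightarrow> 'v \<Rightarrow> 'v \<Rightarrow> real" where
  "shift_inf p x\<^sub>0 y = (INF t\<in>{0..}. p (y + complex_of_real t *\<^sub>C x\<^sub>0) - t * p x\<^sub>0)"

context
  fixes X :: "'v::complex_vector set" and p x\<^sub>0
  assumes p: "sublinear_on X p" and sub: "complex_vector.subspace X" and x0: "x\<^sub>0 \<in> X"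
begin

lemma shift_in: "y \<in> X \<Longrightarrow> y + complex_of_real t *\<^sub>C x\<^sub>0 \<in> X"
  using sub x0 by (simp add: complex_vector.subspace_add complex_vector.subspace_scale)

text \<open>The lower bound does not depend on \<open>t\<close>, so the infimum defining
  \<open>shift_inf\<close> is finite.\<close>

lemma shift_lower:
  assumes "y \<in> X" "t \<ge> 0"
  shows "- p (- y) \<le> p (y + complex_of_real t *\<^sub>C x\<^sub>0) - t * p x\<^sub>0"
proof -
  have "t * p x\<^sub>0 = p (complex_of_real t *\<^sub>C x\<^sub>0)"
    using sublinear_on_scale[OF p sub x0, of t] sublinear_on_0[OF p sub] assms(2)
    by (cases "t = 0") auto
  also have "\<dots> = p ((y + complex_of_real t *\<^sub>C x\<^sub>0) + (- y))" by simp
  also have "\<dots> \<le> p (y + complex_of_real t *\<^sub>C x\<^sub>0) + p (- y)"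
    by (rule sublinear_on_add[OF p shift_in]) (use assms sub in \<open>auto simp: complex_vector.subspace_neg\<close>)
  finally show ?thesis by simp
qed

lemma shift_inf_le:
  assumes "y \<in> X" "t \<ge> 0"
  shows "shift_inf p x\<^sub>0 y \<le> p (y + complex_of_real t *\<^sub>C x\<^sub>0) - t * p x\<^sub>0"
  unfolding shift_inf_def
  by (rule cINF_lower) (use shift_lower[OF assms(1)] assms in \<open>auto intro!: bdd_belowI2\<close>)

lemma shift_inf_greatest:
  assumes "\<And>t. t \<ge> 0 \<Longrightarrow> c \<le> p (y + complex_of_real t *\<^sub>C x\<^sub>0) - t * p x\<^sub>0"
  shows "c \<le> shift_inf p x\<^sub>0 y"
  unfolding shift_inf_def by (rule cINF_greatest) (use assms in auto)

text \<open>Shift parameters \<open>s\<close> for \<open>x\<close> and \<open>t\<close> for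
  \<open>y\<close> combine to \<open>s + t\<close> for \<open>x + y\<close>, and scaling by
  \<open>r\<close> turns the parameter \<open>t\<close> into \<open>r * t\<close>.\<close>

lemma sublinear_shift_inf: "sublinear_on X (shift_inf p x\<^sub>0)"
  unfolding sublinear_on_def
proof (intro conjI ballI allI impI)
  fix x y assume x: "x \<in> X" and y: "y \<in> X"
  have xy: "x + y \<in> X" using sub x y by (rule complex_vector.subspace_add)
  have key: "shift_inf p x\<^sub>0 (x + y) \<le>
      (p (x + complex_of_real s *\<^sub>C x\<^sub>0) - s * p x\<^sub>0) + (p (y + complex_of_real t *\<^sub>C x\<^sub>0) - t * p x\<^sub>0)"
    if "s \<ge> 0" "t \<ge> 0" for s t
  proof -
    have "shift_inf p x\<^sub>0 (x + y) \<le> p (x + y + complex_of_real (s + t) *\<^sub>C x\<^sub>0) - (s + t) * p x\<^sub>0"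
      by (rule shift_inf_le) (use xy that in auto)
    also have "x + y + complex_of_real (s + t) *\<^sub>C x\<^sub>0
        = (x + complex_of_real s *\<^sub>C x\<^sub>0) + (y + complex_of_real t *\<^sub>C x\<^sub>0)"
      by (simp add: scaleC_add_left algebra_simps)
    finally show ?thesis
      using sublinear_on_add[OF p shift_in[OF x, of s] shift_in[OF y, of t]] by (simp add: algebra_simps)
  qed
  \<comment> \<open>The infimum over \<open>s\<close> is taken with \<open>t\<close> fixed, and then
    the infimum over \<open>t\<close>.\<close>
  have "shift_inf p x\<^sub>0 (x + y) - (p (y + complex_of_real t *\<^sub>C x\<^sub>0) - t * p x\<^sub>0) \<le> shift_inf p x\<^sub>0 x"
    if "t \<ge> 0" for t
    by (rule shift_inf_greatest) (use key that in \<open>simp add: algebra_simps\<close>)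
  then have "shift_inf p x\<^sub>0 (x + y) - shift_inf p x\<^sub>0 x \<le> shift_inf p x\<^sub>0 y"
    by (intro shift_inf_greatest) (simp add: algebra_simps)
  then show "shift_inf p x\<^sub>0 (x + y) \<le> shift_inf p x\<^sub>0 x + shift_inf p x\<^sub>0 y" by simp
next
  fix x and r :: real assume x: "x \<in> X" and r: "0 < r"
  have "shift_inf p x\<^sub>0 (complex_of_real r *\<^sub>C x) / r \<le> shift_inf p x\<^sub>0 x"
  proof (rule shift_inf_greatest)
    fix t :: real assume t: "t \<ge> 0"
    have "shift_inf p x\<^sub>0 (complex_of_real r *\<^sub>C x)
        \<le> p (complex_of_real r *\<^sub>C x + complex_of_real (r * t) *\<^sub>C x\<^sub>0) - (r * t) * p x\<^sub>0"
      by (rule shift_inf_le) (use x r t sub in \<open>auto simp: complex_vector.subspace_scale\<close>)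
    also have "complex_of_real r *\<^sub>C x + complex_of_real (r * t) *\<^sub>C x\<^sub>0
        = complex_of_real r *\<^sub>C (x + complex_of_real t *\<^sub>C x\<^sub>0)"
      by (simp add: scaleC_add_right scaleC_scaleC)
    also have "p \<dots> = r * p (x + complex_of_real t *\<^sub>C x\<^sub>0)"
      by (rule sublinear_on_scale[OF p sub shift_in[OF x] r])
    finally show "shift_inf p x\<^sub>0 (complex_of_real r *\<^sub>C x) / r
        \<le> p (x + complex_of_real t *\<^sub>C x\<^sub>0) - t * p x\<^sub>0"
      using r by (simp add: field_simps)
  qed
  then show "shift_inf p x\<^sub>0 (complex_of_real r *\<^sub>C x) \<le> r * shift_inf p x\<^sub>0 x"
    using r by (simp add: field_simps)
qed

end

text \<open>Zorn's lemma for the reversed pointwise order; an upper bound of a chain is its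
  pointwise infimum.\<close>

lemma minimal_sublinear_on:
  fixes X :: "'v::complex_vector set"
  assumes p: "sublinear_on X p" and sub: "complex_vector.subspace X"
  obtains g where "sublinear_on X g" "\<And>x. x \<in> X \<Longrightarrow> g x \<le> p x"
    "\<And>h x. sublinear_on X h \<Longrightarrow> (\<And>y. y \<in> X \<Longrightarrow> h y \<le> g y) \<Longrightarrow> x \<in> X \<Longrightarrow> h x = g x"
proof -
  \<comment> \<open>Prescribing the value 0 off \<open>X\<close> makes functions that agree on
    \<open>X\<close> equal, so that \<open>P\<close> is antisymmetric on \<open>A\<close>.\<close>
  define A where "A = {g. sublinear_on X g \<and> (\<forall>x\<in>X. g x \<le> p x) \<and> (\<forall>x. x \<notin> X \<longrightarrow> g x = 0)}"
  define P where "P = (\<lambda>g h :: 'v \<Rightarrow> real. \<forall>x\<in>X. h x \<le> g x)"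
  define cut where "cut = (\<lambda>(h :: 'v \<Rightarrow> real) x. if x \<in> X then h x else 0)"
  have cut_sub: "sublinear_on X (cut h)" if "sublinear_on X h" for h
    using that sub unfolding sublinear_on_def cut_def
    by (auto simp: complex_vector.subspace_add complex_vector.subspace_scale)
  have "\<exists>m\<in>A. \<forall>a\<in>A. P m a \<longrightarrow> a = m"
  proof (rule predicate_Zorn)
    show "partial_order_on A (relation_of P A)"
      unfolding partial_order_on_def preorder_on_def refl_on_def trans_def antisym_def relation_of_def P_def
    proof (intro conjI allI impI ballI)
      fix f h
      assume "(f, h) \<in> {(a, b) \<in> A \<times> A. \<forall>x\<in>X. b x \<le> a x}" "(h, f) \<in> {(a, b) \<in> A \<times> A. \<forall>x\<in>X. b x \<le> a x}"
      then have "f x = h x" for x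
        by (cases "x \<in> X") (auto simp: A_def intro: antisym)
      then show "f = h" by (rule ext)
    qed (auto intro: order_trans)
  next
    fix C assume C: "C \<in> Chains (relation_of P A)"
    have CA: "C \<subseteq> A" using C by (auto simp: Chains_def relation_of_def)
    show "\<exists>u\<in>A. \<forall>a\<in>C. P a u"
    proof (cases "C = {}")
      case True
      have "cut p \<in> A" using cut_sub[OF p] by (auto simp: A_def cut_def)
      then show ?thesis using True by auto
    next
      case False
      define u where "u = cut (\<lambda>x. INF g\<in>C. g x)"
      \<comment> \<open>Every member lies below \<open>p\<close>, so \<open>g x\<close> is at least
        \<open>- g (- x)\<close> and hence at least \<open>- p (- x)\<close>, uniformly over the
        chain.\<close>
      have bdd: "bdd_below ((\<lambda>g. g x) ` C)" if "x \<in> X" for x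
      proof (rule bdd_belowI2)
        fix g assume "g \<in> C"
        then have g: "sublinear_on X g" "\<forall>x\<in>X. g x \<le> p x" using CA by (auto simp: A_def)
        have "- g (- x) \<le> g x" by (rule sublinear_on_lower[OF g(1) sub that])
        moreover have "g (- x) \<le> p (- x)" using g(2) that sub by (simp add: complex_vector.subspace_neg)
        ultimately show "- p (- x) \<le> g x" by simp
      qed
      have u_le: "u x \<le> g x" if "x \<in> X" "g \<in> C" for x g
        using that bdd by (auto simp: u_def cut_def intro: cINF_lower)
      have u_ge: "c \<le> u x" if "x \<in> X" "\<And>g. g \<in> C \<Longrightarrow> c \<le> g x" for c x
        using that False by (auto simp: u_def cut_def intro: cINF_greatest)
      have gC: "sublinear_on X g" if "g \<in> C" for g using that CA by (auto simp: A_def)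
      have "sublinear_on X u"
        unfolding sublinear_on_def
      proof (intro conjI ballI allI impI)
        fix x y assume x: "x \<in> X" and y: "y \<in> X"
        have xy: "x + y \<in> X" using sub x y by (rule complex_vector.subspace_add)
        \<comment> \<open>Of two members of a chain the smaller one bounds both summands from below
          and is itself subadditive.\<close>
        have key: "u (x + y) \<le> g x + h y" if "g \<in> C" "h \<in> C" for g h
        proof -
          have "P g h \<or> P h g" using C that unfolding Chains_def relation_of_def by blast
          then consider "P g h" | "P h g" by blast
          then show ?thesis
          proof cases
            case 1
            then show ?thesis
              using u_le[OF xy \<open>h \<in> C\<close>] sublinear_on_add[OF gC[OF \<open>h \<in> C\<close>] x y] x unfolding P_def by fastforce
          next
            case 2
            then show ?thesis
              using u_le[OF xy \<open>g \<in> C\<close>] sublinear_on_add[OF gC[OF \<open>g \<in> C\<close>] x y] y unfolding P_def by fastforce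
          qed
        qed
        have "u (x + y) - g x \<le> u y" if "g \<in> C" for g
        proof (rule u_ge[OF y])
          fix h assume "h \<in> C"
          then show "u (x + y) - g x \<le> h y" using key[OF that] by fastforce
        qed
        then have "u (x + y) - u y \<le> u x"
          by (intro u_ge[OF x]) fastforce
        then show "u (x + y) \<le> u x + u y" by simp
      next
        fix x and t :: real assume x: "x \<in> X" and t: "t > 0"
        have tx: "complex_of_real t *\<^sub>C x \<in> X" using x sub by (simp add: complex_vector.subspace_scale)
        have "u (complex_of_real t *\<^sub>C x) / t \<le> u x"
        proof (rule u_ge[OF x])
          fix g assume "g \<in> C"
          then show "u (complex_of_real t *\<^sub>C x) / t \<le> g x"
            using u_le[OF tx \<open>g \<in> C\<close>] sublinear_on_scale[OF gC sub x t] t by (simp add: field_simps)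
        qed
        then show "u (complex_of_real t *\<^sub>C x) \<le> t * u x" using t by (simp add: field_simps)
      qed
      moreover have "u x \<le> p x" if "x \<in> X" for x
      proof -
        obtain g where "g \<in> C" using False by auto
        then show ?thesis using u_le[OF that, of g] CA that by (force simp: A_def)
      qed
      ultimately have "u \<in> A" by (auto simp: A_def u_def cut_def)
      then show ?thesis using u_le by (auto simp: P_def)
    qed
  qed
  then obtain g where g: "g \<in> A" "\<And>a. a \<in> A \<Longrightarrow> P g a \<Longrightarrow> a = g" by blast
  show thesis
  proof (rule that[of g])
    fix h x assume h: "sublinear_on X h" "\<And>y. y \<in> X \<Longrightarrow> h y \<le> g y" and x: "x \<in> X"
    have "cut h \<in> A" using cut_sub[OF h(1)] h(2) g(1) by (force simp: A_def cut_def)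
    moreover have "P g (cut h)" using h(2) by (simp add: P_def cut_def)
    ultimately have "cut h = g" by (rule g(2))
    then show "h x = g x" using x by (auto simp: cut_def)
  qed (use g(1) in \<open>auto simp: A_def\<close>)
qed

section \<open>Real and complex extension theorems\<close>

definition seminorm_on :: "'v::complex_vector set \<Rightarrow> ('v \<Rightarrow> real) \<Rightarrow> bool" where
  "seminorm_on X p \<longleftrightarrow>
     (\<forall>x\<in>X. \<forall>y\<in>X. p (x + y) \<le> p x + p y) \<and> (\<forall>c. \<forall>x\<in>X. p (c *\<^sub>C x) = cmod c * p x)"

text \<open>A minimal sublinear functional is additive because it must equal each of its own shifts.
  Starting below \<open>shift_inf p x\<^sub>0\<close>, and not merely below \<open>p\<close>, yields
  the lower bound at \<open>x\<^sub>0\<close>.\<close>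

lemma Hahn_Banach_real:
  fixes X :: "'v::complex_vector set"
  assumes p: "sublinear_on X p" and sub: "complex_vector.subspace X" and x0: "x\<^sub>0 \<in> X"
  obtains g where "\<And>x y. x \<in> X \<Longrightarrow> y \<in> X \<Longrightarrow> g (x + y) = g x + g y"
    "\<And>x t. x \<in> X \<Longrightarrow> g (complex_of_real t *\<^sub>C x) = t * g x"
    "\<And>x. x \<in> X \<Longrightarrow> g x \<le> p x" "p x\<^sub>0 \<le> g x\<^sub>0"
proof -
  obtain g where g: "sublinear_on X g" "\<And>x. x \<in> X \<Longrightarrow> g x \<le> shift_inf p x\<^sub>0 x"
    and min: "\<And>h x. sublinear_on X h \<Longrightarrow> (\<And>y. y \<in> X \<Longrightarrow> h y \<le> g y) \<Longrightarrow> x \<in> X \<Longrightarrow> h x = g x"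
    using minimal_sublinear_on[OF sublinear_shift_inf[OF p sub x0] sub] by metis
  have shift_le: "shift_inf q z y \<le> q y" if "sublinear_on X q" "z \<in> X" "y \<in> X" for q z y
    using shift_inf_le[OF that(1) sub that(2,3), of 0] by simp
  have add: "g (x + y) = g x + g y" if x: "x \<in> X" and y: "y \<in> X" for x y
  proof (rule antisym)
    show "g (x + y) \<le> g x + g y" by (rule sublinear_on_add[OF g(1) x y])
    \<comment> \<open>The shift of \<open>g\<close> in the direction \<open>y\<close> is sublinear
      and no larger than \<open>g\<close>, hence equal to it; its term at \<open>t = 1\<close> gives
      superadditivity.\<close>
    have "g x = shift_inf g y x"
      by (rule min[symmetric]) (use sublinear_shift_inf[OF g(1) sub y] shift_le[OF g(1) y] x in auto)
    also have "\<dots> \<le> g (x + y) - g y"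
      using shift_inf_le[OF g(1) sub y x, of 1] by (simp add: scaleC_one)
    finally show "g x + g y \<le> g (x + y)" by simp
  qed
  have neg: "g (- x) = - g x" if "x \<in> X" for x
    using add[OF that, of "- x"] sublinear_on_0[OF g(1) sub] that sub
    by (simp add: complex_vector.subspace_neg)
  have scale: "g (complex_of_real t *\<^sub>C x) = t * g x" if x: "x \<in> X" for x t
  proof -
    consider "t > 0" | "t = 0" | "t < 0" by linarith
    then show ?thesis
    proof cases
      case 3
      have "complex_of_real t *\<^sub>C x = - (complex_of_real (- t) *\<^sub>C x)" by simp
      then have "g (complex_of_real t *\<^sub>C x) = - g (complex_of_real (- t) *\<^sub>C x)"
        using neg[OF complex_vector.subspace_scale[OF sub x, of "complex_of_real (- t)"]] by simp
      then show ?thesis using sublinear_on_scale[OF g(1) sub x, of "- t"] 3 by simp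
    qed (use sublinear_on_scale[OF g(1) sub x] sublinear_on_0[OF g(1) sub] in auto)
  qed
  \<comment> \<open>The term \<open>t = 1\<close> of the infimum at \<open>- x\<^sub>0\<close> is
    \<open>p 0 - p x\<^sub>0\<close>; oddness of \<open>g\<close> turns this into a lower bound at
    \<open>x\<^sub>0\<close>.\<close>
  have "g (- x\<^sub>0) \<le> p (- x\<^sub>0 + x\<^sub>0) - p x\<^sub>0"
    using g(2)[of "- x\<^sub>0"] shift_inf_le[OF p sub x0, of "- x\<^sub>0" 1] x0 sub
    by (simp add: complex_vector.subspace_neg scaleC_one)
  then have "p x\<^sub>0 \<le> g x\<^sub>0" using neg[OF x0] sublinear_on_0[OF p sub] by simp
  moreover have "g x \<le> p x" if "x \<in> X" for x
    using g(2)[OF that] shift_le[OF p x0 that] by simp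
  ultimately show thesis using that add scale by blast
qed

theorem Hahn_Banach:
  fixes X :: "'v::complex_vector set"
  assumes p: "seminorm_on X p" and sub: "complex_vector.subspace X" and x0: "x\<^sub>0 \<in> X"
  obtains f where "clinear_on X f" "\<And>x. x \<in> X \<Longrightarrow> cmod (f x) \<le> p x" "f x\<^sub>0 = complex_of_real (p x\<^sub>0)"
proof -
  have slin: "sublinear_on X p"
    using p by (simp add: sublinear_on_def seminorm_on_def)
  obtain g where add: "\<And>x y. x \<in> X \<Longrightarrow> y \<in> X \<Longrightarrow> g (x + y) = g x + g y"
    and scale: "\<And>x t. x \<in> X \<Longrightarrow> g (complex_of_real t *\<^sub>C x) = t * g x"
    and le: "\<And>x. x \<in> X \<Longrightarrow> g x \<le> p x" and g0: "p x\<^sub>0 \<le> g x\<^sub>0"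
    using Hahn_Banach_real[OF slin sub x0] by metis
  \<comment> \<open>The complex-linear functional with real part \<open>g\<close>: complex linearity
    forces the imaginary part.\<close>
  define f where "f x = Complex (g x) (- g (\<i> *\<^sub>C x))" for x
  have cX: "c *\<^sub>C x \<in> X" if "x \<in> X" for c x
    using that sub by (rule_tac complex_vector.subspace_scale)
  have gc: "g (c *\<^sub>C x) = Re c * g x + Im c * g (\<i> *\<^sub>C x)" if "x \<in> X" for c x
  proof -
    have "c = complex_of_real (Re c) + complex_of_real (Im c) * \<i>"
      by (simp add: complex_eq_iff)
    then have "c *\<^sub>C x = complex_of_real (Re c) *\<^sub>C x + complex_of_real (Im c) *\<^sub>C \<i> *\<^sub>C x"
      by (metis scaleC_add_left scaleC_scaleC)
    then show ?thesis
      using add[OF cX[OF that] cX[OF cX[OF that]], of "complex_of_real (Re c)" "complex_of_real (Im c)" \<i>]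
        scale[OF cX[OF that, of \<i>], of "Im c"] scale[OF that, of "Re c"]
      by (simp del: complex_vector.scale_scale)
  qed
  have lin: "clinear_on X f"
    unfolding clinear_on_def
  proof (intro conjI ballI allI)
    fix x y assume "x \<in> X" "y \<in> X"
    then show "f (x + y) = f x + f y"
      using add cX by (simp add: f_def scaleC_add_right complex_eq_iff)
  next
    fix c x assume x: "x \<in> X"
    show "f (c *\<^sub>C x) = c *\<^sub>C f x"
      using gc[OF x, of c] gc[OF x, of "\<i> * c"]
      by (simp add: f_def scaleC_complex_def complex_eq_iff scaleC_scaleC)
  qed
  have bound: "cmod (f x) \<le> p x" if x: "x \<in> X" for x
  proof (cases "f x = 0")
    case True
    have "p x \<ge> 0" using sublinear_on_lower[OF slin sub x] p x
      by (auto simp: seminorm_on_def dest!: bspec[of _ _ x] spec[of _ "-1"])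
    then show ?thesis using True by simp
  next
    case False
    \<comment> \<open>A unimodular factor that rotates \<open>f x\<close> onto the positive axis,
      where the one-sided bound on the real part \<open>g\<close> bounds the modulus.\<close>
    define c where "c = cnj (f x) / complex_of_real (cmod (f x))"
    have "cnj (f x) * f x = complex_of_real (cmod (f x)) * complex_of_real (cmod (f x))"
      by (metis complex_norm_square mult.commute of_real_power power2_eq_square)
    then have c: "cmod c = 1" "c * f x = complex_of_real (cmod (f x))"
      using False by (auto simp: c_def norm_divide)
    have "f (c *\<^sub>C x) = complex_of_real (cmod (f x))"
      using lin x c(2) by (simp add: clinear_on_def scaleC_complex_def)
    then have "cmod (f x) = g (c *\<^sub>C x)" by (simp add: f_def complex_eq_iff)
    also have "\<dots> \<le> p (c *\<^sub>C x)" by (rule le[OF cX[OF x]])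
    also have "\<dots> = p x" using p x c(1) by (simp add: seminorm_on_def)
    finally show ?thesis .
  qed
  \<comment> \<open>The chain \<open>p x\<^sub>0\<close> \<le> \<open>Re (f x\<^sub>0)\<close> \<le>
    \<open>cmod (f x\<^sub>0)\<close> \<le> \<open>p x\<^sub>0\<close> collapses, so
    \<open>f x\<^sub>0\<close> has no imaginary part.\<close>
  have "Re (f x\<^sub>0) = cmod (f x\<^sub>0)" "cmod (f x\<^sub>0) = p x\<^sub>0"
    using bound[OF x0] g0 complex_Re_le_cmod[of "f x\<^sub>0"] by (auto simp: f_def)
  then have "f x\<^sub>0 = complex_of_real (p x\<^sub>0)"
    using cmod_power2[of "f x\<^sub>0"] by (auto simp: complex_eq_iff)
  then show thesis using that lin bound by blast
qed

section \<open>Dual spaces and initial topologies\<close>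

lemma normed_space_onD:
  assumes "normed_space_on X N"
  shows "complex_vector.subspace X" "x \<in> X \<Longrightarrow> 0 \<le> N x" "x \<in> X \<Longrightarrow> N x = 0 \<longleftrightarrow> x = 0"
    "x \<in> X \<Longrightarrow> N (c *\<^sub>C x) = cmod c * N x" "x \<in> X \<Longrightarrow> y \<in> X \<Longrightarrow> N (x + y) \<le> N x + N y"
    "N 0 = 0"
  using assms complex_vector.subspace_0 unfolding normed_space_on_def by blast+

lemma clinear_onD:
  assumes "clinear_on X T"
  shows "x \<in> X \<Longrightarrow> y \<in> X \<Longrightarrow> T (x + y) = T x + T y" "x \<in> X \<Longrightarrow> T (c *\<^sub>C x) = c *\<^sub>C T x"
  using assms by (auto simp: clinear_on_def)

lemma clinear_on_0:
  assumes "clinear_on X T" "complex_vector.subspace X"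
  shows "T 0 = 0"
  using clinear_onD(2)[OF assms(1) complex_vector.subspace_0[OF assms(2)], of 0] by simp

lemma clinear_on_diff:
  assumes "clinear_on X T" "complex_vector.subspace X" "x \<in> X" "y \<in> X"
  shows "T (x - y) = T x - T y"
proof -
  have "(-1) *\<^sub>C y \<in> X" using assms(2,4) by (rule complex_vector.subspace_scale)
  then have "T (x + (-1) *\<^sub>C y) = T x + (-1) *\<^sub>C T y"
    using clinear_onD(1)[OF assms(1,3)] clinear_onD(2)[OF assms(1,4), of "-1"] by (simp only:)
  then show ?thesis by simp
qed

lemma normed_space_on_minus:
  assumes "normed_space_on X N" "x \<in> X"
  shows "N (- x) = N x"
  using normed_space_onD(4)[OF assms, of "-1"] by simp

lemma dualD:
  assumes "f \<in> dual X N"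
  shows "clinear_on X f" "x \<notin> X \<Longrightarrow> f x = 0"
    "x \<in> X \<Longrightarrow> y \<in> X \<Longrightarrow> f (x + y) = f x + f y" "x \<in> X \<Longrightarrow> f (c *\<^sub>C x) = c * f x"
  using assms by (auto simp: dual_def clinear_on_def scaleC_complex_def)

lemma dualI:
  assumes "\<And>x. x \<notin> X \<Longrightarrow> f x = 0" "\<And>x y. x \<in> X \<Longrightarrow> y \<in> X \<Longrightarrow> f (x + y) = f x + f y"
    "\<And>c x. x \<in> X \<Longrightarrow> f (c *\<^sub>C x) = c * f x" "\<And>x. x \<in> X \<Longrightarrow> cmod (f x) \<le> B * N x"
  shows "f \<in> dual X N"
  unfolding dual_def clinear_on_def scaleC_complex_def using assms by blast

lemma subspace_dual:
  assumes "normed_space_on X N"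
  shows "complex_vector.subspace (dual X N)"
  unfolding complex_vector.subspace_def
proof (intro conjI ballI allI)
  show "0 \<in> dual X N" by (auto simp: dual_def clinear_on_def scaleC_complex_def intro!: exI[of _ 0])
next
  fix f g assume f: "f \<in> dual X N" and g: "g \<in> dual X N"
  obtain B C where BC: "\<forall>x\<in>X. cmod (f x) \<le> B * N x" "\<forall>x\<in>X. cmod (g x) \<le> C * N x"
    using f g unfolding dual_def by blast
  show "f + g \<in> dual X N"
  proof (rule dualI)
    show "cmod ((f + g) x) \<le> (B + C) * N x" if "x \<in> X" for x
      using BC that norm_triangle_ineq[of "f x" "g x"] by (fastforce simp: algebra_simps)
  qed (auto simp: dualD[OF f] dualD[OF g] algebra_simps)
next
  fix c f assume f: "f \<in> dual X N"
  obtain B where B: "\<forall>x\<in>X. cmod (f x) \<le> B * N x" using f unfolding dual_def by blast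
  show "c *\<^sub>C f \<in> dual X N"
  proof (rule dualI)
    show "cmod ((c *\<^sub>C f) x) \<le> (cmod c * B) * N x" if "x \<in> X" for x
      using B that by (simp add: scaleC_fun_def scaleC_complex_def norm_mult mult.assoc mult_left_mono)
  qed (auto simp: dualD[OF f] scaleC_fun_def scaleC_complex_def algebra_simps)
qed

context
  fixes X :: "'v::complex_vector set" and N
  assumes nX: "normed_space_on X N"
begin

lemma dual_norm_bdd:
  assumes "f \<in> dual X N"
  shows "bdd_above {cmod (f x) | x. x \<in> X \<and> N x \<le> 1}"
proof -
  obtain B where B: "\<forall>x\<in>X. cmod (f x) \<le> B * N x" using assms unfolding dual_def by blast
  have "cmod (f x) \<le> \<bar>B\<bar>" if "x \<in> X" "N x \<le> 1" for x
  proof -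
    have "cmod (f x) \<le> B * N x" using B that by blast
    also have "\<dots> \<le> \<bar>B\<bar> * N x" by (rule mult_right_mono) (use normed_space_onD(2)[OF nX] that in auto)
    also have "\<dots> \<le> \<bar>B\<bar> * 1" by (rule mult_left_mono) (use that in auto)
    finally show ?thesis by simp
  qed
  then show ?thesis by (intro bdd_aboveI[of _ "\<bar>B\<bar>"]) auto
qed

lemma dual_norm_ge:
  assumes "f \<in> dual X N" "x \<in> X" "N x \<le> 1"
  shows "cmod (f x) \<le> dual_norm X N f"
  unfolding dual_norm_def by (rule cSup_upper) (use dual_norm_bdd assms in auto)

lemma dual_norm_nonneg:
  assumes "f \<in> dual X N"
  shows "0 \<le> dual_norm X N f"
proof -
  have "0 \<in> X" using normed_space_onD(1)[OF nX] by (rule complex_vector.subspace_0)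
  then have "cmod (f 0) \<le> dual_norm X N f"
    using assms normed_space_onD(6)[OF nX] by (intro dual_norm_ge) auto
  then show ?thesis using norm_ge_zero order_trans by blast
qed

lemma dual_norm_bound:
  assumes f: "f \<in> dual X N" and x: "x \<in> X"
  shows "cmod (f x) \<le> dual_norm X N f * N x"
proof (cases "N x = 0")
  case True
  then have "f x = f (0 *\<^sub>C x)" using normed_space_onD(3)[OF nX x] by simp
  then show ?thesis using dualD(4)[OF f x, of 0] True by simp
next
  case False
  then have pos: "N x > 0" using normed_space_onD(2)[OF nX x] by simp
  define y where "y = complex_of_real (inverse (N x)) *\<^sub>C x"
  have "y \<in> X" unfolding y_def by (rule complex_vector.subspace_scale[OF normed_space_onD(1)[OF nX] x])
  moreover have "N y = 1"
    unfolding y_def using normed_space_onD(4)[OF nX x] pos by (simp add: norm_inverse)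
  ultimately have "cmod (f y) \<le> dual_norm X N f" by (intro dual_norm_ge[OF f]) auto
  moreover have "f y = complex_of_real (inverse (N x)) * f x"
    unfolding y_def by (rule dualD(4)[OF f x])
  ultimately show ?thesis using pos by (simp add: norm_mult norm_divide norm_inverse field_simps)
qed

lemma dual_norm_le:
  assumes "\<And>x. x \<in> X \<Longrightarrow> N x \<le> 1 \<Longrightarrow> cmod (f x) \<le> B"
  shows "dual_norm X N f \<le> B"
  unfolding dual_norm_def
proof (rule cSup_least)
  have "0 \<in> X" using normed_space_onD(1)[OF nX] by (rule complex_vector.subspace_0)
  then show "{cmod (f x) |x. x \<in> X \<and> N x \<le> 1} \<noteq> {}"
    using normed_space_onD(6)[OF nX] by force
qed (use assms in auto)

lemma normed_space_on_dual: "normed_space_on (dual X N) (dual_norm X N)"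
  unfolding normed_space_on_def
proof (intro conjI ballI allI)
  show "complex_vector.subspace (dual X N)" by (rule subspace_dual[OF nX])
  fix f assume f: "f \<in> dual X N"
  show "0 \<le> dual_norm X N f" by (rule dual_norm_nonneg[OF f])
  show "dual_norm X N f = 0 \<longleftrightarrow> f = 0"
  proof
    assume "dual_norm X N f = 0"
    then have "f x = 0" for x
      using dual_norm_bound[OF f, of x] dualD(2)[OF f, of x] by (cases "x \<in> X") auto
    then show "f = 0" by (simp add: fun_eq_iff)
  next
    assume "f = 0"
    then have "dual_norm X N f \<le> 0" by (intro dual_norm_le) auto
    then show "dual_norm X N f = 0" using dual_norm_nonneg[OF f] by simp
  qed
  have scale_le: "dual_norm X N (c *\<^sub>C g) \<le> cmod c * dual_norm X N g" if "g \<in> dual X N" for c g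
    by (rule dual_norm_le)
      (use dual_norm_ge[OF that] in \<open>auto simp: scaleC_fun_def scaleC_complex_def norm_mult intro: mult_left_mono\<close>)
  show "dual_norm X N (c *\<^sub>C f) = cmod c * dual_norm X N f" for c
  proof (cases "c = 0")
    case True
    have "c *\<^sub>C f = 0" using True by simp
    then have "dual_norm X N (c *\<^sub>C f) \<le> 0" by (intro dual_norm_le) auto
    moreover have "0 \<le> dual_norm X N (c *\<^sub>C f)"
      by (rule dual_norm_nonneg[OF complex_vector.subspace_scale[OF subspace_dual[OF nX] f]])
    ultimately show ?thesis using True by simp
  next
    case False
    have "dual_norm X N (inverse c *\<^sub>C c *\<^sub>C f) \<le> cmod (inverse c) * dual_norm X N (c *\<^sub>C f)"
      by (rule scale_le[OF complex_vector.subspace_scale[OF subspace_dual[OF nX] f]])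
    then have "cmod c * dual_norm X N f \<le> dual_norm X N (c *\<^sub>C f)"
      using False by (simp add: norm_divide norm_inverse field_simps)
    then show ?thesis using scale_le[OF f, of c] by simp
  qed
  fix g assume g: "g \<in> dual X N"
  show "dual_norm X N (f + g) \<le> dual_norm X N f + dual_norm X N g"
    by (rule dual_norm_le)
      (use dual_norm_ge[OF f] dual_norm_ge[OF g] in \<open>auto intro!: norm_triangle_le add_mono\<close>)
qed

end

text \<open>Common form of the weak, the weak* and the transported predual topology: the coarsest
  topology on \<open>X\<close> for which all coordinates \<open>\<lambda>x. g x i\<close> with
  \<open>i\<close> in \<open>I\<close> are continuous.\<close>

definition initial_topology ::
  "'v set \<Rightarrow> ('v \<Rightarrow> 'j \<Rightarrow> complex) \<Rightarrow> 'j set \<Rightarrow> 'v topology" where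
  "initial_topology X g I =
     pullback_topology X (\<lambda>x. restrict (g x) I) (product_topology (\<lambda>_. euclidean) I)"

lemma weak_topology_initial: "weak_topology X N = initial_topology X (\<lambda>x f. f x) (dual X N)"
  by (simp add: weak_topology_def initial_topology_def)

lemma weak_star_topology_initial: "weak_star_topology X N = initial_topology (dual X N) (\<lambda>f x. f x) X"
  by (simp add: weak_star_topology_def initial_topology_def)

text \<open>The two successive pullbacks collapse into one because \<open>J\<close> takes its values
  in the carrier of the dual.\<close>

lemma predual_topology_initial:
  assumes "J ` X \<subseteq> dual E NE"
  shows "predual_topology X E NE J = initial_topology X J E"
proof -
  have "J -` ((\<lambda>f. restrict f E) -` U \<inter> dual E NE) \<inter> X = (\<lambda>x. restrict (J x) E) -` U \<inter> X" for U
    using assms by auto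
  then have eq: "openin (predual_topology X E NE J) S \<longleftrightarrow> (\<exists>U. openin (product_topology (\<lambda>_. euclidean) E) U \<and>
      S = (\<lambda>x. restrict (J x) E) -` U \<inter> X)" for S
    unfolding predual_topology_def weak_star_topology_def openin_pullback_topology by metis
  show ?thesis
    unfolding topology_eq eq by (simp add: initial_topology_def openin_pullback_topology)
qed

lemma topspace_initial [simp]: "topspace (initial_topology X g I) = X"
  by (auto simp: initial_topology_def topspace_pullback_topology)

lemma continuous_map_initial_coordinate:
  assumes "i \<in> I"
  shows "continuous_map (initial_topology X g I) euclidean (\<lambda>x. g x i)"
proof -
  have "continuous_map (initial_topology X g I) euclidean ((\<lambda>h. h i) \<circ> (\<lambda>x. restrict (g x) I))"
    unfolding initial_topology_def
    using continuous_map_product_projection[OF assms, of "\<lambda>_. euclidean"]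
    by (intro continuous_map_pullback) simp
  then show ?thesis using assms by (simp add: o_def)
qed

text \<open>The universal property, by which continuity into a weak or weak* topology is checked on
  scalar coordinates.\<close>

lemma continuous_map_initial:
  "continuous_map T (initial_topology X g I) f \<longleftrightarrow>
     f \<in> topspace T \<rightarrow> X \<and> (\<forall>i\<in>I. continuous_map T euclidean (\<lambda>t. g (f t) i))"
proof (intro iffI conjI ballI)
  assume f: "continuous_map T (initial_topology X g I) f"
  then show "f \<in> topspace T \<rightarrow> X" by (auto simp: continuous_map_def)
  show "continuous_map T euclidean (\<lambda>t. g (f t) i)" if "i \<in> I" for i
    using continuous_map_compose[OF f continuous_map_initial_coordinate[OF that]] by (simp add: o_def)
next
  assume *: "f \<in> topspace T \<rightarrow> X \<and> (\<forall>i\<in>I. continuous_map T euclidean (\<lambda>t. g (f t) i))"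
  show "continuous_map T (initial_topology X g I) f"
    unfolding initial_topology_def
    by (rule continuous_map_pullback') (use * in \<open>auto simp: continuous_map_componentwise o_def\<close>)
qed

text \<open>Open sets are preimages of open sets of the product, so a cover of \<open>K\<close>
  comes from a cover of its image and a finite subcover lifts back.\<close>

lemma compactin_initial:
  fixes g :: "'v \<Rightarrow> 'j \<Rightarrow> complex"
  assumes K: "compactin (product_topology (\<lambda>_. euclidean) I) ((\<lambda>x. restrict (g x) I) ` K)" and "K \<subseteq> X"
  shows "compactin (initial_topology X g I) K"
  unfolding compactin_def
proof (intro conjI allI impI)
  show "K \<subseteq> topspace (initial_topology X g I)" using assms by simp
  let ?h = "\<lambda>x. restrict (g x) I" and ?P = "product_topology (\<lambda>_. euclidean) I :: ('j \<Rightarrow> complex) topology"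
  fix \<U> assume U: "(\<forall>U\<in>\<U>. openin (initial_topology X g I) U) \<and> K \<subseteq> \<Union> \<U>"
  then have "\<forall>U\<in>\<U>. \<exists>V. openin ?P V \<and> U = ?h -` V \<inter> X"
    by (simp add: initial_topology_def openin_pullback_topology)
  then obtain V where V: "\<And>U. U \<in> \<U> \<Longrightarrow> openin ?P (V U) \<and> U = ?h -` V U \<inter> X" by metis
  have "(\<forall>W\<in>V ` \<U>. openin ?P W) \<and> ?h ` K \<subseteq> \<Union> (V ` \<U>)" using V U by fastforce
  then obtain \<F> where F: "finite \<F>" "\<F> \<subseteq> V ` \<U>" "?h ` K \<subseteq> \<Union> \<F>"
    using K unfolding compactin_def by meson
  then obtain \<G> where G: "\<G> \<subseteq> \<U>" "finite \<G>" "\<F> = V ` \<G>" by (meson finite_subset_image)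
  have "K \<subseteq> \<Union> \<G>"
  proof
    fix x assume x: "x \<in> K"
    then obtain U where "U \<in> \<G>" "?h x \<in> V U" using F(3) G(3) by auto
    then show "x \<in> \<Union> \<G>" using V[of U] G(1) x assms(2) by blast
  qed
  then show "\<exists>\<F>. finite \<F> \<and> \<F> \<subseteq> \<U> \<and> K \<subseteq> \<Union> \<F>" using G by blast
qed

lemma Hausdorff_initial:
  assumes "\<And>x y. x \<in> X \<Longrightarrow> y \<in> X \<Longrightarrow> (\<And>i. i \<in> I \<Longrightarrow> g x i = g y i) \<Longrightarrow> x = y"
  shows "Hausdorff_space (initial_topology X g I)"
proof (rule Hausdorff_space_injective_preimage)
  show "continuous_map (initial_topology X g I) (product_topology (\<lambda>_. euclidean) I) (\<lambda>x. restrict (g x) I)"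
    by (auto simp: continuous_map_componentwise intro: continuous_map_initial_coordinate)
  show "inj_on (\<lambda>x. restrict (g x) I) (topspace (initial_topology X g I))"
    unfolding inj_on_def by (metis assms restrict_apply' topspace_initial)
qed (simp add: Hausdorff_space_product_topology)

text \<open>Otherwise each point of \<open>K\<close> has a neighbourhood that the net eventually
  avoids; finitely many of these cover \<open>K\<close>, so the net eventually avoids
  \<open>K\<close>.\<close>

lemma compactin_accumulation_point:
  assumes K: "compactin T K" and F: "F \<noteq> bot" and x: "\<forall>\<^sub>F t in F. x t \<in> K"
  obtains p where "p \<in> K" "accumulation_point T x F p"
proof (rule ccontr)
  assume "\<not> thesis"
  define \<U> where "\<U> = {U. openin T U \<and> (\<forall>\<^sub>F t in F. x t \<notin> U)}"
  have "\<exists>U\<in>\<U>. p \<in> U" if "p \<in> K" for p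
  proof -
    have "\<not> accumulation_point T x F p" using that \<open>\<not> thesis\<close> \<open>\<And>p. p \<in> K \<Longrightarrow> accumulation_point T x F p \<Longrightarrow> thesis\<close> by blast
    moreover have "p \<in> topspace T" using K that by (auto simp: compactin_def)
    ultimately show ?thesis
      by (auto simp: accumulation_point_def \<U>_def frequently_def)
  qed
  then obtain \<F> where fin: "finite \<F>" "\<F> \<subseteq> \<U>" and cov: "K \<subseteq> \<Union> \<F>"
    using K unfolding compactin_def by (metis (no_types, lifting) UnionI \<U>_def mem_Collect_eq subsetI)
  have "\<forall>\<^sub>F t in F. \<forall>U\<in>\<F>. x t \<notin> U"
    using fin by (intro eventually_ball_finite) (auto simp: \<U>_def)
  then have "\<forall>\<^sub>F t in F. False" using x by eventually_elim (use cov in blast)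
  then show False using F by (simp add: eventually_False)
qed

lemma accumulation_point_continuous:
  fixes \<phi> :: "'x \<Rightarrow> complex"
  assumes p: "accumulation_point T x F p" and \<phi>: "continuous_map T euclidean \<phi>" and "\<epsilon> > 0"
  shows "\<exists>\<^sub>F t in F. dist (\<phi> (x t)) (\<phi> p) < \<epsilon>"
proof -
  have "openin T {y \<in> topspace T. \<phi> y \<in> ball (\<phi> p) \<epsilon>}"
    by (rule openin_continuous_map_preimage[OF \<phi>]) simp
  moreover have "p \<in> {y \<in> topspace T. \<phi> y \<in> ball (\<phi> p) \<epsilon>}"
    using p \<open>\<epsilon> > 0\<close> by (simp add: accumulation_point_def)
  ultimately have "\<exists>\<^sub>F t in F. x t \<in> {y \<in> topspace T. \<phi> y \<in> ball (\<phi> p) \<epsilon>}"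
    using p unfolding accumulation_point_def by blast
  then show ?thesis by (rule frequently_elim1) (simp add: dist_commute)
qed

lemma accumulation_point_tendsto:
  fixes \<phi> :: "'x \<Rightarrow> complex"
  assumes p: "accumulation_point T x F p" and \<phi>: "continuous_map T euclidean \<phi>"
    and lim: "((\<lambda>t. \<phi> (x t)) \<longlongrightarrow> c) F"
  shows "\<phi> p = c"
proof (rule ccontr)
  assume ne: "\<phi> p \<noteq> c"
  \<comment> \<open>Half the distance, so that the balls around the two candidate values are
    disjoint.\<close>
  define \<epsilon> where "\<epsilon> = dist (\<phi> p) c / 2"
  have pos: "\<epsilon> > 0" using ne by (simp add: \<epsilon>_def)
  have "\<exists>\<^sub>F t in F. dist (\<phi> (x t)) (\<phi> p) < \<epsilon> \<and> dist (\<phi> (x t)) c < \<epsilon>"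
    using accumulation_point_continuous[OF p \<phi> pos]
    by (rule frequently_rev_mp) (use tendstoD[OF lim pos] in \<open>auto elim: eventually_mono\<close>)
  then obtain t where "dist (\<phi> (x t)) (\<phi> p) < \<epsilon>" "dist (\<phi> (x t)) c < \<epsilon>"
    using frequently_ex by blast
  then have "dist (\<phi> p) c < \<epsilon> + \<epsilon>" by (metis dist_commute dist_triangle_less_add)
  then show False by (simp add: \<epsilon>_def)
qed

text \<open>If coordinate \<open>i\<close> frequently stayed away from its limit, the net refined to
  those indices would still accumulate at a point of \<open>K\<close>. The coordinates in
  \<open>S\<close> identify this point as \<open>l\<close>, which contradicts the gap in coordinate
  \<open>i\<close>.\<close>

lemma tendsto_initial_compact:
  assumes K: "compactin (initial_topology X g I) K" and x: "\<forall>\<^sub>F t in F. x t \<in> K"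
    and lim: "\<And>s. s \<in> S \<Longrightarrow> ((\<lambda>t. g (x t) s) \<longlongrightarrow> g l s) F" and "S \<subseteq> I"
    and sep: "\<And>p. p \<in> K \<Longrightarrow> (\<And>s. s \<in> S \<Longrightarrow> g p s = g l s) \<Longrightarrow> p = l"
    and i: "i \<in> I"
  shows "((\<lambda>t. g (x t) i) \<longlongrightarrow> g l i) F"
proof (rule ccontr)
  assume "\<not> ?thesis"
  then obtain \<epsilon> where \<epsilon>: "\<epsilon> > 0" "\<exists>\<^sub>F t in F. dist (g (x t) i) (g l i) \<ge> \<epsilon>"
    by (auto simp: tendsto_iff frequently_def not_le)
  \<comment> \<open>The subnet of indices with a gap of at least \<epsilon>, expressed as a filter;
    it is proper because the gap occurs frequently.\<close>
  define F' where "F' = inf F (principal {t. dist (g (x t) i) (g l i) \<ge> \<epsilon>})"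
  have F': "F' \<noteq> bot" using \<epsilon>(2) by (simp add: F'_def trivial_limit_def eventually_inf_principal frequently_def)
  have le: "F' \<le> F" by (simp add: F'_def)
  obtain p where p: "p \<in> K" "accumulation_point (initial_topology X g I) x F' p"
    using compactin_accumulation_point[OF K F'] x le by (metis filter_leD)
  have "g p s = g l s" if "s \<in> S" for s
    by (rule accumulation_point_tendsto[OF p(2) continuous_map_initial_coordinate])
      (use that \<open>S \<subseteq> I\<close> lim le in \<open>auto intro: tendsto_mono\<close>)
  then have pl: "p = l" using sep p(1) by blast
  have "\<forall>\<^sub>F t in F'. \<not> dist (g (x t) i) (g l i) < \<epsilon>"
    by (simp add: F'_def eventually_inf_principal)
  moreover have "\<exists>\<^sub>F t in F'. dist (g (x t) i) (g l i) < \<epsilon>"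
    using accumulation_point_continuous[OF p(2) continuous_map_initial_coordinate[OF i] \<epsilon>(1)] pl by simp
  ultimately show False by (simp add: frequently_def)
qed

section \<open>The weak* topology given by a predual\<close>

lemma isometric_isomorphismD:
  assumes "isometric_isomorphism X N Y N' T"
  shows "clinear_on X T" "bij_betw T X Y" "x \<in> X \<Longrightarrow> N' (T x) = N x" "x \<in> X \<Longrightarrow> T x \<in> Y"
  using assms by (auto simp: isometric_isomorphism_def bij_betw_def)

lemma isometric_dualD:
  assumes "isometric_isomorphism X N (dual E NE) (dual_norm E NE) J"
  shows "x \<in> X \<Longrightarrow> y \<in> X \<Longrightarrow> J (x + y) \<xi> = J x \<xi> + J y \<xi>"
    "x \<in> X \<Longrightarrow> J (c *\<^sub>C x) \<xi> = c * J x \<xi>"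
    "f \<in> dual E NE \<Longrightarrow> \<exists>x\<in>X. J x = f"
    "x \<in> X \<Longrightarrow> y \<in> X \<Longrightarrow> (\<And>\<xi>. \<xi> \<in> E \<Longrightarrow> J x \<xi> = J y \<xi>) \<Longrightarrow> x = y"
    "normed_space_on E NE \<Longrightarrow> x \<in> X \<Longrightarrow> \<xi> \<in> E \<Longrightarrow> cmod (J x \<xi>) \<le> N x * NE \<xi>"
    "J ` X \<subseteq> dual E NE"
proof -
  note J = isometric_isomorphismD[OF assms]
  show "x \<in> X \<Longrightarrow> y \<in> X \<Longrightarrow> J (x + y) \<xi> = J x \<xi> + J y \<xi>"
    using clinear_onD(1)[OF J(1)] by simp
  show "x \<in> X \<Longrightarrow> J (c *\<^sub>C x) \<xi> = c * J x \<xi>"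
    using clinear_onD(2)[OF J(1)] by (simp add: scaleC_fun_def scaleC_complex_def)
  show "f \<in> dual E NE \<Longrightarrow> \<exists>x\<in>X. J x = f" by (metis J(2) bij_betw_imp_surj_on imageE)
  show "x = y" if "x \<in> X" "y \<in> X" "\<And>\<xi>. \<xi> \<in> E \<Longrightarrow> J x \<xi> = J y \<xi>"
  proof -
    have "J x = J y"
    proof
      fix \<xi> show "J x \<xi> = J y \<xi>"
        using that dualD(2)[OF J(4)[OF that(1)], of \<xi>] dualD(2)[OF J(4)[OF that(2)], of \<xi>] by (cases "\<xi> \<in> E") auto
    qed
    then show ?thesis using J(2) that by (auto simp: bij_betw_def inj_on_def)
  qed
  show "normed_space_on E NE \<Longrightarrow> x \<in> X \<Longrightarrow> \<xi> \<in> E \<Longrightarrow> cmod (J x \<xi>) \<le> N x * NE \<xi>"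
    using dual_norm_bound[of E NE "J x" \<xi>] J(3,4) by fastforce
  show "J ` X \<subseteq> dual E NE" using J(4) by auto
qed

text \<open>Tychonoff: the unit ball is mapped onto the linear elements of a product of closed
  discs, a closed subset of a compact space. That every such element is attained is the surjectivity
  of \<open>J\<close> onto the dual.\<close>

theorem Banach_Alaoglu:
  fixes J :: "'v::complex_vector \<Rightarrow> 'e::complex_vector \<Rightarrow> complex"
  assumes J: "isometric_isomorphism X N (dual E NE) (dual_norm E NE) J" and nE: "normed_space_on E NE"
  shows "compactin (predual_topology X E NE J) {x \<in> X. N x \<le> 1}"
proof -
  let ?P = "product_topology (\<lambda>_. euclidean) E :: ('e \<Rightarrow> complex) topology"
  let ?h = "\<lambda>x. restrict (J x) E"
  define K where "K = (\<Pi>\<^sub>E \<xi>\<in>E. cball (0::complex) (NE \<xi>))"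
  \<comment> \<open>Additivity, and homogeneity in \<open>S\<close>, are written as a difference
    lying in a closed set, so that they define closed subsets of the product.\<close>
  define A where "A = (\<lambda>\<xi> \<eta>. {g \<in> topspace ?P. g (\<xi> + \<eta>) - (g \<xi> + g \<eta>) \<in> {0}})"
  define S where "S = (\<lambda>c \<xi>. {g \<in> topspace ?P. g (c *\<^sub>C \<xi>) - c * g \<xi> \<in> {0}})"
  define C where "C = K \<inter> (\<Inter>\<xi>\<in>E. \<Inter>\<eta>\<in>E. A \<xi> \<eta>) \<inter> (\<Inter>c\<in>UNIV. \<Inter>\<xi>\<in>E. S c \<xi>)"
  note sub = normed_space_onD(1)[OF nE]
  have K: "compactin ?P K" unfolding K_def by (rule compactin_PiE[THEN iffD2]) auto
  have E0: "E \<noteq> {}" using complex_vector.subspace_0[OF sub] by auto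
  have coord: "continuous_map ?P euclidean (\<lambda>g. g \<xi>)" if "\<xi> \<in> E" for \<xi>
    using that by (rule continuous_map_product_projection)
  have cA: "closedin ?P (A \<xi> \<eta>)" if "\<xi> \<in> E" "\<eta> \<in> E" for \<xi> \<eta>
    unfolding A_def
    by (rule closedin_continuous_map_preimage[where Y = euclidean])
      (use that coord complex_vector.subspace_add[OF sub] in \<open>auto intro!: continuous_map_diff continuous_map_add\<close>)
  have cS: "closedin ?P (S c \<xi>)" if "\<xi> \<in> E" for c \<xi>
  proof -
    have "continuous_map ?P euclidean (\<lambda>g. c * g \<xi>)"
      using continuous_map_compose[OF coord[OF that], of euclidean "\<lambda>z. c * z"]
      by (simp add: o_def continuous_on_mult_left)
    then show ?thesis
      unfolding S_def
      by (intro closedin_continuous_map_preimage[where Y = euclidean] continuous_map_diff coord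
          complex_vector.subspace_scale[OF sub] that) auto
  qed
  have "closedin ?P C"
    unfolding C_def
    by (intro closedin_Int closedin_INT compactin_imp_closedin[OF _ K] Hausdorff_space_product_topology[THEN iffD2])
      (use E0 cA cS in auto)
  then have "compactin ?P C"
    by (rule closed_compactin[OF K, rotated]) (auto simp: C_def)
  moreover have "?h ` {x \<in> X. N x \<le> 1} = C"
  proof (intro equalityI subsetI)
    fix g assume "g \<in> ?h ` {x \<in> X. N x \<le> 1}"
    then obtain x where x: "x \<in> X" "N x \<le> 1" and g: "g = ?h x" by auto
    note Jx = dualD[OF isometric_isomorphismD(4)[OF J x(1)]]
    have "cmod (J x \<xi>) \<le> NE \<xi>" if "\<xi> \<in> E" for \<xi>
      using isometric_dualD(5)[OF J nE x(1) that] mult_right_mono[OF x(2) normed_space_onD(2)[OF nE that]]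
      by simp
    then show "g \<in> C"
      using Jx complex_vector.subspace_add[OF sub] complex_vector.subspace_scale[OF sub]
      unfolding g C_def K_def A_def S_def by auto
  next
    fix g assume g: "g \<in> C"
    \<comment> \<open>Elements of the product are \<open>undefined\<close> off \<open>E\<close>,
      whereas functionals vanish there.\<close>
    define f where "f = restrict0 E g"
    have f: "cmod (f \<xi>) \<le> 1 * NE \<xi>" if "\<xi> \<in> E" for \<xi>
      using g that by (auto simp: f_def restrict0_def C_def K_def PiE_def Pi_def)
    have "f \<in> dual E NE"
      by (rule dualI[OF _ _ _ f])
        (use g complex_vector.subspace_add[OF sub] complex_vector.subspace_scale[OF sub] in
          \<open>auto simp: f_def restrict0_def C_def A_def S_def\<close>)
    then obtain x where x: "x \<in> X" "J x = f" using isometric_dualD(3)[OF J] by blast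
    have "N x = dual_norm E NE f" using isometric_isomorphismD(3)[OF J x(1)] x(2) by simp
    also have "\<dots> \<le> 1" by (rule dual_norm_le[OF nE]) (use f in fastforce)
    finally have "N x \<le> 1" .
    moreover have "?h x = g"
      using g unfolding x(2) f_def by (auto simp: C_def K_def restrict0_def restrict_def fun_eq_iff PiE_def extensional_def)
    ultimately show "g \<in> ?h ` {x \<in> X. N x \<le> 1}" using x(1) by blast
  qed
  ultimately show ?thesis
    unfolding predual_topology_initial[OF isometric_dualD(6)[OF J]] by (intro compactin_initial) auto
qed

text \<open>Induction on \<open>S\<close> with \<open>V\<close> arbitrary: on the kernel
  \<open>W\<close> of the pairing with \<open>s\<close> the condition at \<open>s\<close> is
  automatic, so the induction hypothesis applies there. A multiple of \<open>s\<close> then corrects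
  the result off \<open>W\<close>.\<close>

lemma functional_vanishing_on_common_kernel:
  fixes B :: "'v::complex_vector \<Rightarrow> 'e::complex_vector \<Rightarrow> complex"
  assumes "finite S" "S \<subseteq> E" and subE: "complex_vector.subspace E" and "complex_vector.subspace V"
    and B: "\<And>\<xi>. \<xi> \<in> E \<Longrightarrow> clinear_on V (\<lambda>x. B x \<xi>)" "\<And>x. x \<in> V \<Longrightarrow> clinear_on E (B x)"
    and "clinear_on V \<phi>"
    and "\<And>x. x \<in> V \<Longrightarrow> (\<And>\<xi>. \<xi> \<in> S \<Longrightarrow> B x \<xi> = 0) \<Longrightarrow> \<phi> x = 0"
  shows "\<exists>\<xi>\<in>E. \<forall>x\<in>V. \<phi> x = B x \<xi>"
  using assms(1,2,4-)
proof (induction S arbitrary: V rule: finite_induct)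
  case empty
  have "B x 0 = 0" if "x \<in> V" for x
    by (rule clinear_on_0[OF empty.prems(4)[OF that] subE])
  then show ?case using empty.prems(6) complex_vector.subspace_0[OF subE] by (intro bexI[of _ 0]) auto
next
  case (insert s S)
  note subV = insert.prems(2) and lin = insert.prems(5)
  have s: "s \<in> E" using insert.prems by simp
  define W where "W = {x \<in> V. B x s = 0}"
  note Bs = clinear_onD[OF insert.prems(3)[OF s]]
  have subW: "complex_vector.subspace W"
    unfolding complex_vector.subspace_def W_def
    using subV Bs clinear_on_0[OF insert.prems(3)[OF s] subV]
    by (auto simp: complex_vector.subspace_0 complex_vector.subspace_add complex_vector.subspace_scale)
  have "\<exists>\<xi>\<in>E. \<forall>x\<in>W. \<phi> x = B x \<xi>"
  proof (rule insert.IH)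
    show "\<And>\<xi>. \<xi> \<in> E \<Longrightarrow> clinear_on W (\<lambda>x. B x \<xi>)" "clinear_on W \<phi>"
      using insert.prems(3) lin by (auto simp: W_def clinear_on_def)
    show "\<phi> x = 0" if "x \<in> W" "\<And>\<xi>. \<xi> \<in> S \<Longrightarrow> B x \<xi> = 0" for x
      by (rule insert.prems(6)) (use that in \<open>auto simp: W_def\<close>)
  qed (use insert.prems subW in \<open>auto simp: W_def\<close>)
  then obtain \<eta> where \<eta>: "\<eta> \<in> E" "\<And>x. x \<in> W \<Longrightarrow> \<phi> x = B x \<eta>" by blast
  show ?case
  proof (cases "W = V")
    case True
    then show ?thesis using \<eta> by auto
  next
    case False
    then obtain z where z: "z \<in> V" "B z s \<noteq> 0" by (auto simp: W_def)
    \<comment> \<open>Chosen so that both sides agree at \<open>z\<close>, which together with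
      \<open>W\<close> spans \<open>V\<close>.\<close>
    define d where "d = (\<phi> z - B z \<eta>) / B z s"
    have "\<phi> x = B x (\<eta> + d *\<^sub>C s)" if x: "x \<in> V" for x
    proof -
      \<comment> \<open>The coefficient that moves \<open>x\<close> along \<open>z\<close> into
        \<open>W\<close>.\<close>
      define k where "k = - (B x s / B z s)"
      define y where "y = x + k *\<^sub>C z"
      have yV: "y \<in> V" unfolding y_def using x z subV
        by (intro complex_vector.subspace_add complex_vector.subspace_scale)
      have kz: "k *\<^sub>C z \<in> V" using z subV by (simp add: complex_vector.subspace_scale)
      have lin_y: "\<psi> y = \<psi> x + k * \<psi> z" if "clinear_on V \<psi>" for \<psi> :: "'v \<Rightarrow> complex"
        using clinear_onD(1)[OF that x kz] clinear_onD(2)[OF that z(1)] by (simp add: y_def scaleC_complex_def)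
      have "B y s = 0" using lin_y[OF insert.prems(3)[OF s]] z by (simp add: k_def)
      then have "\<phi> y = B y \<eta>" using \<eta>(2) yV by (simp add: W_def)
      then have "\<phi> x = B x \<eta> - k * (\<phi> z - B z \<eta>)"
        using lin_y[OF lin] lin_y[OF insert.prems(3)[OF \<eta>(1)]] by (simp add: algebra_simps)
      also have "\<dots> = B x \<eta> + d * B x s" by (simp add: k_def d_def)
      also have "\<dots> = B x (\<eta> + d *\<^sub>C s)"
        using clinear_onD[OF insert.prems(4)[OF x]] \<eta>(1) s subE
        by (simp add: complex_vector.subspace_scale scaleC_complex_def)
      finally show ?thesis .
    qed
    moreover have "\<eta> + d *\<^sub>C s \<in> E"
      using \<eta>(1) s subE by (intro complex_vector.subspace_add complex_vector.subspace_scale)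
    ultimately show ?thesis by blast
  qed
qed

text \<open>A basic neighbourhood of 0 on which \<phi> has modulus below 1 constrains finitely many
  coordinates only. On their common kernel \<phi> is bounded, hence zero, so \<phi> is itself given
  by an element of \<open>E\<close>.\<close>

lemma weak_star_continuous_functional:
  fixes J :: "'v::complex_vector \<Rightarrow> 'e::complex_vector \<Rightarrow> complex"
  assumes J: "isometric_isomorphism X N (dual E NE) (dual_norm E NE) J"
    and nE: "normed_space_on E NE" and subX: "complex_vector.subspace X"
    and lin: "clinear_on X \<phi>" and cont: "continuous_map (predual_topology X E NE J) euclidean \<phi>"
  obtains \<xi> where "\<xi> \<in> E" "\<And>x. x \<in> X \<Longrightarrow> \<phi> x = J x \<xi>"
proof -
  let ?P = "product_topology (\<lambda>_. euclidean) E :: ('e \<Rightarrow> complex) topology"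
  let ?h = "\<lambda>x. restrict (J x) E"
  have "openin (initial_topology X J E) {x \<in> topspace (initial_topology X J E). \<phi> x \<in> ball 0 1}"
    by (rule openin_continuous_map_preimage[where Y = euclidean])
      (use cont predual_topology_initial[OF isometric_dualD(6)[OF J]] in auto)
  then obtain U where U: "openin ?P U" "{x \<in> X. \<phi> x \<in> ball 0 1} = ?h -` U \<inter> X"
    by (auto simp: initial_topology_def openin_pullback_topology topspace_pullback_topology)
  have 0: "0 \<in> X" using subX by (rule complex_vector.subspace_0)
  then have "?h 0 \<in> U" using U(2) clinear_on_0[OF lin subX] by auto
  moreover have "\<forall>x\<in>U. \<exists>V. finite {i \<in> E. V i \<noteq> UNIV} \<and> x \<in> Pi\<^sub>E E V \<and> Pi\<^sub>E E V \<subseteq> U"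
    using U(1) unfolding openin_product_topology_alt by simp blast
  ultimately obtain V where V: "finite {i \<in> E. V i \<noteq> UNIV}" "?h 0 \<in> Pi\<^sub>E E V" "Pi\<^sub>E E V \<subseteq> U"
    by blast
  define S where "S = {i \<in> E. V i \<noteq> UNIV}"
  have zero: "\<phi> x = 0" if x: "x \<in> X" and S: "\<And>\<xi>. \<xi> \<in> S \<Longrightarrow> J x \<xi> = 0" for x
  proof (rule ccontr)
    assume ne: "\<phi> x \<noteq> 0"
    \<comment> \<open>Rescaling keeps the constrained coordinates at 0 but makes the value of \<phi>
      equal to 1.\<close>
    define y where "y = inverse (\<phi> x) *\<^sub>C x"
    have y: "y \<in> X" unfolding y_def using subX x by (rule complex_vector.subspace_scale)
    have "J y \<xi> \<in> V \<xi>" if "\<xi> \<in> E" for \<xi>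
    proof (cases "\<xi> \<in> S")
      case True
      have "J y \<xi> = 0" using isometric_dualD(2)[OF J x] S[OF True] by (simp add: y_def)
      moreover have "J 0 \<xi> = 0" using isometric_dualD(2)[OF J 0, of 0 \<xi>] by simp
      ultimately show ?thesis using V(2) that by (auto simp: PiE_def Pi_def)
    qed (use that in \<open>auto simp: S_def\<close>)
    then have "?h y \<in> U" using V(3) by auto
    then have "cmod (\<phi> y) < 1" using U(2) y by auto
    moreover have "\<phi> y = 1" using clinear_onD(2)[OF lin x] ne by (simp add: y_def scaleC_complex_def)
    ultimately show False by simp
  qed
  have "\<exists>\<xi>\<in>E. \<forall>x\<in>X. \<phi> x = J x \<xi>"
  proof (rule functional_vanishing_on_common_kernel)
    show "finite S" "S \<subseteq> E" using V(1) by (auto simp: S_def)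
    show "clinear_on X (\<lambda>x. J x \<xi>)" for \<xi>
      using isometric_dualD(1,2)[OF J] by (simp add: clinear_on_def scaleC_complex_def)
    show "clinear_on E (J x)" if "x \<in> X" for x
      by (rule dualD(1)[OF isometric_isomorphismD(4)[OF J that]])
    show "\<phi> x = 0" if "x \<in> X" "\<And>\<xi>. \<xi> \<in> S \<Longrightarrow> J x \<xi> = 0" for x
      using zero that by blast
  qed (use normed_space_onD(1)[OF nE] subX lin in auto)
  then show thesis using that by blast
qed

section \<open>Completeness and isometries\<close>

lemma limitin_norm_topology:
  assumes nX: "normed_space_on X N" and \<sigma>: "range \<sigma> \<subseteq> X"
  shows "limitin (norm_topology X N) \<sigma> l sequentially \<longleftrightarrow> l \<in> X \<and> (\<lambda>n. N (\<sigma> n - l)) \<longlonglongrightarrow> 0"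
proof -
  interpret Metric_space X "norm_dist X N" by (rule Metric_space_norm_dist[OF nX])
  have \<sigma>': "\<sigma> n \<in> X" for n using \<sigma> by auto
  have "dist (N (\<sigma> n - l)) 0 = N (\<sigma> n - l)" if "l \<in> X" for n
    using normed_space_onD(2)[OF nX complex_vector.subspace_diff[OF normed_space_onD(1)[OF nX] \<sigma>' that]]
    by (simp add: dist_real_def)
  then show ?thesis
    unfolding norm_topology_def limitin_metric tendsto_iff using \<sigma>' by (auto simp: norm_dist_def)
qed

lemma banach_space_on_iff:
  "banach_space_on X N \<longleftrightarrow> normed_space_on X N \<and>
     (\<forall>\<sigma>. range \<sigma> \<subseteq> X \<longrightarrow> (\<forall>\<epsilon>>0. \<exists>k. \<forall>m n. k \<le> m \<longrightarrow> k \<le> n \<longrightarrow> N (\<sigma> m - \<sigma> n) < \<epsilon>) \<longrightarrow>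
       (\<exists>l\<in>X. (\<lambda>n. N (\<sigma> n - l)) \<longlonglongrightarrow> 0))"
proof (cases "normed_space_on X N")
  case True
  interpret Metric_space X "norm_dist X N" by (rule Metric_space_norm_dist[OF True])
  have "MCauchy \<sigma> \<longleftrightarrow> range \<sigma> \<subseteq> X \<and> (\<forall>\<epsilon>>0. \<exists>k. \<forall>m n. k \<le> m \<longrightarrow> k \<le> n \<longrightarrow> N (\<sigma> m - \<sigma> n) < \<epsilon>)" for \<sigma>
  proof (cases "range \<sigma> \<subseteq> X")
    case True
    then have "\<sigma> n \<in> X" for n by auto
    then show ?thesis by (simp add: MCauchy_def norm_dist_def)
  qed (simp add: MCauchy_def)
  moreover have "(\<exists>l. limitin mtopology \<sigma> l sequentially) \<longleftrightarrow> (\<exists>l\<in>X. (\<lambda>n. N (\<sigma> n - l)) \<longlonglongrightarrow> 0)"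
    if "range \<sigma> \<subseteq> X" for \<sigma>
    using limitin_norm_topology[OF True that] by (auto simp: norm_topology_def)
  ultimately show ?thesis
    unfolding banach_space_on_def mcomplete_def using True by metis
qed (simp add: banach_space_on_def)

lemma closedin_norm_topology:
  assumes nX: "normed_space_on X N" and "Z \<subseteq> X"
  shows "closedin (norm_topology X N) Z \<longleftrightarrow>
    (\<forall>\<sigma> l. range \<sigma> \<subseteq> Z \<and> l \<in> X \<and> (\<lambda>n. N (\<sigma> n - l)) \<longlonglongrightarrow> 0 \<longrightarrow> l \<in> Z)"
proof -
  interpret Metric_space X "norm_dist X N" by (rule Metric_space_norm_dist[OF nX])
  have "range \<sigma> \<subseteq> Z \<and> limitin mtopology \<sigma> l sequentially \<longleftrightarrow>
      range \<sigma> \<subseteq> Z \<and> l \<in> X \<and> (\<lambda>n. N (\<sigma> n - l)) \<longlonglongrightarrow> 0" for \<sigma> l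
    using limitin_norm_topology[OF nX, of \<sigma> l] assms(2) by (auto simp: norm_topology_def)
  then show ?thesis
    unfolding norm_topology_def metric_closedin_iff_sequentially_closed using assms(2) by auto
qed

lemma normed_space_on_subset:
  assumes "normed_space_on X N" "Z \<subseteq> X" "complex_vector.subspace Z"
  shows "normed_space_on Z N"
  using assms by (simp add: normed_space_on_def subset_iff)

lemma banach_space_on_closed_subspace:
  assumes "banach_space_on X N" "Z \<subseteq> X" "complex_vector.subspace Z" "closedin (norm_topology X N) Z"
  shows "banach_space_on Z N"
  unfolding banach_space_on_iff
proof (intro conjI allI impI)
  have nX: "normed_space_on X N" using assms(1) by (simp add: banach_space_on_def)
  show "normed_space_on Z N" by (rule normed_space_on_subset[OF nX assms(2,3)])
  fix \<sigma> :: "nat \<Rightarrow> _" assume \<sigma>: "range \<sigma> \<subseteq> Z" "\<forall>\<epsilon>>0. \<exists>k. \<forall>m n. k \<le> m \<longrightarrow> k \<le> n \<longrightarrow> N (\<sigma> m - \<sigma> n) < \<epsilon>"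
  have "range \<sigma> \<subseteq> X" using \<sigma>(1) assms(2) by blast
  then obtain l where l: "l \<in> X" "(\<lambda>n. N (\<sigma> n - l)) \<longlonglongrightarrow> 0"
    using assms(1) \<sigma>(2) unfolding banach_space_on_iff by blast
  then have "l \<in> Z" using assms(4) \<sigma>(1) unfolding closedin_norm_topology[OF nX assms(2)] by blast
  then show "\<exists>l\<in>Z. (\<lambda>n. N (\<sigma> n - l)) \<longlonglongrightarrow> 0" using l(2) by blast
qed

text \<open>A sequence in \<open>Z\<close> converging in \<open>X\<close> is Cauchy, so completeness
  supplies a limit in \<open>Z\<close>; limits are unique.\<close>

lemma closedin_banach_subspace:
  assumes nX: "normed_space_on X N" and "Z \<subseteq> X" and bZ: "banach_space_on Z N"
  shows "closedin (norm_topology X N) Z"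
  unfolding closedin_norm_topology[OF assms(1,2)]
proof (intro allI impI, elim conjE)
  fix \<sigma> l assume \<sigma>: "range \<sigma> \<subseteq> Z" and l: "l \<in> X" "(\<lambda>n. N (\<sigma> n - l)) \<longlonglongrightarrow> 0"
  have \<sigma>X: "\<sigma> n \<in> X" for n using \<sigma> assms(2) by auto
  note sub = normed_space_onD(1)[OF nX]
  have tri: "N (x - y) \<le> N (x - z) + N (y - z)" if "x \<in> X" "y \<in> X" "z \<in> X" for x y z
  proof -
    have "N ((x - z) + - (y - z)) \<le> N (x - z) + N (- (y - z))"
      using that sub by (intro normed_space_onD(5)[OF nX] complex_vector.subspace_neg complex_vector.subspace_diff)
    then show ?thesis
      using normed_space_on_minus[OF nX complex_vector.subspace_diff[OF sub that(2,3)]] by simp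
  qed
  have "\<exists>k. \<forall>m n. k \<le> m \<longrightarrow> k \<le> n \<longrightarrow> N (\<sigma> m - \<sigma> n) < \<epsilon>" if "\<epsilon> > 0" for \<epsilon>
  proof -
    obtain k where k: "\<And>n. n \<ge> k \<Longrightarrow> N (\<sigma> n - l) < \<epsilon> / 2"
      using order_tendstoD(2)[OF l(2), of "\<epsilon> / 2"] \<open>\<epsilon> > 0\<close> by (auto simp: eventually_sequentially)
    have "N (\<sigma> m - \<sigma> n) < \<epsilon>" if "k \<le> m" "k \<le> n" for m n
      using tri[OF \<sigma>X[of m] \<sigma>X[of n] l(1)] k[OF that(1)] k[OF that(2)] by linarith
    then show ?thesis by blast
  qed
  then obtain z where z: "z \<in> Z" "(\<lambda>n. N (\<sigma> n - z)) \<longlonglongrightarrow> 0"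
    using bZ \<sigma> unfolding banach_space_on_iff by blast
  have zX: "z \<in> X" using z assms(2) by auto
  have "N (l - z) \<le> N (\<sigma> n - l) + N (\<sigma> n - z)" for n
  proof -
    have "N (l - z) \<le> N (l - \<sigma> n) + N (z - \<sigma> n)" by (rule tri[OF l(1) zX \<sigma>X])
    then show ?thesis
      using normed_space_on_minus[OF nX complex_vector.subspace_diff[OF sub \<sigma>X l(1)], of n]
        normed_space_on_minus[OF nX complex_vector.subspace_diff[OF sub \<sigma>X zX], of n] by simp
  qed
  moreover have "(\<lambda>n. N (\<sigma> n - l) + N (\<sigma> n - z)) \<longlonglongrightarrow> 0"
    using tendsto_add[OF l(2) z(2)] by simp
  ultimately have "N (l - z) \<le> 0" using LIMSEQ_le_const by blast
  moreover have "l - z \<in> X" using sub l(1) zX by (rule complex_vector.subspace_diff)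
  ultimately show "l \<in> Z" using normed_space_onD(2,3)[OF nX, of "l - z"] z(1) by auto
qed

lemma banach_space_on_dual:
  assumes nX: "normed_space_on X N"
  shows "banach_space_on (dual X N) (dual_norm X N)"
  unfolding banach_space_on_iff
proof (intro conjI allI impI)
  show nD: "normed_space_on (dual X N) (dual_norm X N)" by (rule normed_space_on_dual[OF nX])
  fix \<sigma> :: "nat \<Rightarrow> 'a \<Rightarrow> complex"
  assume \<sigma>: "range \<sigma> \<subseteq> dual X N"
    and cauchy: "\<forall>\<epsilon>>0. \<exists>k. \<forall>m n. k \<le> m \<longrightarrow> k \<le> n \<longrightarrow> dual_norm X N (\<sigma> m - \<sigma> n) < \<epsilon>"
  have \<sigma>D: "\<sigma> n \<in> dual X N" for n using \<sigma> by auto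
  have diff: "cmod (\<sigma> m x - \<sigma> n x) \<le> dual_norm X N (\<sigma> m - \<sigma> n) * N x" if "x \<in> X" for m n x
    using dual_norm_bound[OF nX complex_vector.subspace_diff[OF subspace_dual[OF nX] \<sigma>D \<sigma>D] that, of m n] by simp
  define f where "f x = lim (\<lambda>n. \<sigma> n x)" for x
  have lim: "(\<lambda>n. \<sigma> n x) \<longlonglongrightarrow> f x" for x
  proof -
    have "Cauchy (\<lambda>n. \<sigma> n x)"
    proof (cases "x \<in> X")
      case True
      show ?thesis
      proof (rule CauchyI)
        fix \<epsilon> :: real assume \<epsilon>: "\<epsilon> > 0"
        have Nx: "N x \<ge> 0" by (rule normed_space_onD(2)[OF nX True])
        \<comment> \<open>The summand 1 covers \<open>N x = 0\<close>.\<close>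
        then have "\<epsilon> / (N x + 1) > 0" using \<epsilon> by simp
        then obtain k where k: "\<And>m n. k \<le> m \<Longrightarrow> k \<le> n \<Longrightarrow> dual_norm X N (\<sigma> m - \<sigma> n) < \<epsilon> / (N x + 1)"
          using cauchy by meson
        have "norm (\<sigma> m x - \<sigma> n x) < \<epsilon>" if "k \<le> m" "k \<le> n" for m n
        proof -
          have "norm (\<sigma> m x - \<sigma> n x) \<le> \<epsilon> / (N x + 1) * N x"
            using diff[OF True, of m n] mult_right_mono[OF less_imp_le[OF k[OF that]] Nx] by linarith
          also have "\<dots> < \<epsilon>" using \<epsilon> Nx by (simp add: field_simps)
          finally show ?thesis .
        qed
        then show "\<exists>M. \<forall>m\<ge>M. \<forall>n\<ge>M. norm (\<sigma> m x - \<sigma> n x) < \<epsilon>" by blast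
      qed
    next
      case False
      then show ?thesis using dualD(2)[OF \<sigma>D] by (simp add: Cauchy_def)
    qed
    then show ?thesis unfolding f_def by (simp add: Cauchy_convergent_iff convergent_LIMSEQ_iff)
  qed
  \<comment> \<open>One index is passed to the limit in the Cauchy estimate. The resulting bound is
    proportional to \<open>N x\<close>, which yields both boundedness of \<open>f\<close> and
    convergence in norm.\<close>
  have close: "\<exists>k. \<forall>n\<ge>k. \<forall>x\<in>X. cmod (\<sigma> n x - f x) \<le> \<epsilon> * N x" if "\<epsilon> > 0" for \<epsilon>
  proof -
    obtain k where k: "\<And>m n. k \<le> m \<Longrightarrow> k \<le> n \<Longrightarrow> dual_norm X N (\<sigma> m - \<sigma> n) < \<epsilon>"
      using cauchy \<open>\<epsilon> > 0\<close> by meson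
    have "cmod (\<sigma> n x - f x) \<le> \<epsilon> * N x" if "k \<le> n" "x \<in> X" for n x
    proof (rule LIMSEQ_le_const2)
      show "(\<lambda>m. cmod (\<sigma> n x - \<sigma> m x)) \<longlonglongrightarrow> cmod (\<sigma> n x - f x)"
        by (intro tendsto_intros lim)
      have "cmod (\<sigma> n x - \<sigma> m x) \<le> \<epsilon> * N x" if "k \<le> m" for m
        using diff[OF \<open>x \<in> X\<close>, of n m]
          mult_right_mono[OF less_imp_le[OF k[OF \<open>k \<le> n\<close> that]] normed_space_onD(2)[OF nX \<open>x \<in> X\<close>]]
        by linarith
      then show "\<exists>M. \<forall>m\<ge>M. cmod (\<sigma> n x - \<sigma> m x) \<le> \<epsilon> * N x" by blast
    qed
    then show ?thesis by blast
  qed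
  obtain k where k: "\<And>x. x \<in> X \<Longrightarrow> cmod (\<sigma> k x - f x) \<le> 1 * N x" using close[of 1] by auto
  have f: "f \<in> dual X N"
  proof (rule dualI)
    show "f x = 0" if "x \<notin> X" for x
      using lim[of x] dualD(2)[OF \<sigma>D that] by (simp add: LIMSEQ_const_iff)
    show "f (x + y) = f x + f y" if "x \<in> X" "y \<in> X" for x y
      using tendsto_add[OF lim[of x] lim[of y]] lim[of "x + y"] dualD(3)[OF \<sigma>D that] LIMSEQ_unique by simp blast
    show "f (c *\<^sub>C x) = c * f x" if "x \<in> X" for c x
      using tendsto_mult[OF tendsto_const[of c] lim[of x]] lim[of "c *\<^sub>C x"] dualD(4)[OF \<sigma>D that] LIMSEQ_unique
      by simp blast
    show "cmod (f x) \<le> (dual_norm X N (\<sigma> k) + 1) * N x" if "x \<in> X" for x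
      using k[OF that] dual_norm_bound[OF nX \<sigma>D[of k] that] norm_triangle_ineq4[of "\<sigma> k x" "\<sigma> k x - f x"]
      by (simp add: algebra_simps)
  qed
  have "(\<lambda>n. dual_norm X N (\<sigma> n - f)) \<longlonglongrightarrow> 0"
  proof (rule LIMSEQ_I)
    fix \<epsilon> :: real assume \<epsilon>: "\<epsilon> > 0"
    obtain j where j: "\<And>n x. n \<ge> j \<Longrightarrow> x \<in> X \<Longrightarrow> cmod (\<sigma> n x - f x) \<le> \<epsilon> / 2 * N x"
      using close[of "\<epsilon> / 2"] \<epsilon> by auto
    have "norm (dual_norm X N (\<sigma> n - f) - 0) < \<epsilon>" if "n \<ge> j" for n
    proof -
      have "dual_norm X N (\<sigma> n - f) \<le> \<epsilon> / 2"
      proof (rule dual_norm_le[OF nX])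
        fix x assume "x \<in> X" "N x \<le> 1"
        then show "cmod ((\<sigma> n - f) x) \<le> \<epsilon> / 2"
          unfolding minus_apply
          using j[OF that \<open>x \<in> X\<close>] mult_left_mono[OF \<open>N x \<le> 1\<close>, of "\<epsilon> / 2"] \<epsilon> by linarith
      qed
      moreover have "dual_norm X N (\<sigma> n - f) \<ge> 0"
        by (rule dual_norm_nonneg[OF nX complex_vector.subspace_diff[OF subspace_dual[OF nX] \<sigma>D f]])
      ultimately show ?thesis using \<epsilon> by simp
    qed
    then show "\<exists>no. \<forall>n\<ge>no. norm (dual_norm X N (\<sigma> n - f) - 0) < \<epsilon>" by blast
  qed
  then show "\<exists>l\<in>dual X N. (\<lambda>n. dual_norm X N (\<sigma> n - l)) \<longlonglongrightarrow> 0" using f by blast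
qed

section \<open>Transport along isometric isomorphisms\<close>

lemma isometric_isomorphism_inv:
  assumes T: "isometric_isomorphism X N Y N' T" and sub: "complex_vector.subspace X"
  shows "isometric_isomorphism Y N' X N (inv_into X T)"
  unfolding isometric_isomorphism_def clinear_on_def
proof (intro conjI ballI allI)
  note T' = isometric_isomorphismD[OF T]
  have inv: "inv_into X T y \<in> X" "T (inv_into X T y) = y" if "y \<in> Y" for y
    using T'(2) that by (auto simp: bij_betw_def intro: inv_into_into f_inv_into_f)
  have inj: "inv_into X T (T x) = x" if "x \<in> X" for x
    using T'(2) that by (auto simp: bij_betw_def)
  show "bij_betw (inv_into X T) Y X" by (rule bij_betw_inv_into[OF T'(2)])
  show "N (inv_into X T y) = N' y" if "y \<in> Y" for y using T'(3)[OF inv(1)[OF that]] inv(2)[OF that] by simp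
  show "inv_into X T (y + z) = inv_into X T y + inv_into X T z" if "y \<in> Y" "z \<in> Y" for y z
    using inj[OF complex_vector.subspace_add[OF sub inv(1)[OF that(1)] inv(1)[OF that(2)]]]
      clinear_onD(1)[OF T'(1) inv(1)[OF that(1)] inv(1)[OF that(2)]] inv(2) that by simp
  show "inv_into X T (c *\<^sub>C y) = c *\<^sub>C inv_into X T y" if "y \<in> Y" for c y
    using inj[OF complex_vector.subspace_scale[OF sub inv(1)[OF that]], of c]
      clinear_onD(2)[OF T'(1) inv(1)[OF that], of c] inv(2)[OF that] by simp
qed

lemma normed_space_on_isometric:
  assumes T: "isometric_isomorphism X N Y N' T" and nX: "normed_space_on X N"
  shows "normed_space_on Y N'"
proof -
  note T' = isometric_isomorphismD[OF T] and sub = normed_space_onD(1)[OF nX]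
  have Y: "\<exists>x\<in>X. y = T x" if "y \<in> Y" for y using T'(2) that by (auto simp: bij_betw_def)
  have T0: "T 0 = 0" by (rule clinear_on_0[OF T'(1) sub])
  note add = clinear_onD(1)[OF T'(1)] and scale = clinear_onD(2)[OF T'(1)]
  show ?thesis
    unfolding normed_space_on_def complex_vector.subspace_def
  proof (intro conjI ballI allI)
    show "0 \<in> Y" using T'(4)[OF complex_vector.subspace_0[OF sub]] T0 by simp
    fix y assume "y \<in> Y"
    then obtain x where x: "x \<in> X" "y = T x" using Y by blast
    show "0 \<le> N' y" using x T'(3) normed_space_onD(2)[OF nX] by simp
    show "N' y = 0 \<longleftrightarrow> y = 0"
    proof
      assume "N' y = 0" then show "y = 0" using x T'(3) normed_space_onD(3)[OF nX x(1)] T0 by simp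
    next
      assume "y = 0" then show "N' y = 0"
        using T'(3)[OF complex_vector.subspace_0[OF sub]] normed_space_onD(6)[OF nX] T0 by simp
    qed
    have cx: "c *\<^sub>C x \<in> X" for c by (rule complex_vector.subspace_scale[OF sub x(1)])
    show "c *\<^sub>C y \<in> Y" for c using T'(4)[OF cx, of c] scale[OF x(1), of c] x(2) by simp
    show "N' (c *\<^sub>C y) = cmod c * N' y" for c
      using T'(3)[OF cx, of c] scale[OF x(1), of c] x(2) T'(3)[OF x(1)] normed_space_onD(4)[OF nX x(1)] by simp
    fix z assume "z \<in> Y"
    then obtain w where w: "w \<in> X" "z = T w" using Y by blast
    have xw: "x + w \<in> X" by (rule complex_vector.subspace_add[OF sub x(1) w(1)])
    show "y + z \<in> Y" using T'(4)[OF xw] add[OF x(1) w(1)] x(2) w(2) by simp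
    show "N' (y + z) \<le> N' y + N' z"
      using T'(3)[OF xw] T'(3)[OF x(1)] T'(3)[OF w(1)] add[OF x(1) w(1)] x(2) w(2)
        normed_space_onD(5)[OF nX x(1) w(1)] by simp
  qed
qed

lemma banach_space_on_isometric:
  assumes T: "isometric_isomorphism X N Y N' T" and bX: "banach_space_on X N"
  shows "banach_space_on Y N'"
  unfolding banach_space_on_iff
proof (intro conjI allI impI)
  have nX: "normed_space_on X N" using bX by (simp add: banach_space_on_def)
  note T' = isometric_isomorphismD[OF T] and sub = normed_space_onD(1)[OF nX]
  show "normed_space_on Y N'" by (rule normed_space_on_isometric[OF T nX])
  fix \<sigma> :: "nat \<Rightarrow> _" assume \<sigma>: "range \<sigma> \<subseteq> Y" "\<forall>\<epsilon>>0. \<exists>k. \<forall>m n. k \<le> m \<longrightarrow> k \<le> n \<longrightarrow> N' (\<sigma> m - \<sigma> n) < \<epsilon>"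
  have "\<forall>n. \<exists>x\<in>X. \<sigma> n = T x" using T'(2) \<sigma>(1) by (auto simp: bij_betw_def)
  then obtain \<tau> where \<tau>: "\<And>n. \<tau> n \<in> X" "\<And>n. \<sigma> n = T (\<tau> n)" by metis
  have eq: "N' (T x - T y) = N (x - y)" if "x \<in> X" "y \<in> X" for x y
    using T'(3)[OF complex_vector.subspace_diff[OF sub that]] clinear_on_diff[OF T'(1) sub that] by simp
  have "\<forall>\<epsilon>>0. \<exists>k. \<forall>m n. k \<le> m \<longrightarrow> k \<le> n \<longrightarrow> N (\<tau> m - \<tau> n) < \<epsilon>"
    using \<sigma>(2) by (simp add: \<tau> eq)
  then obtain l where l: "l \<in> X" "(\<lambda>n. N (\<tau> n - l)) \<longlonglongrightarrow> 0"
    using bX \<tau>(1) unfolding banach_space_on_iff by blast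
  show "\<exists>l\<in>Y. (\<lambda>n. N' (\<sigma> n - l)) \<longlonglongrightarrow> 0"
    by (rule bexI[of _ "T l"]) (use l T'(4) in \<open>simp_all add: \<tau> eq\<close>)
qed

section \<open>Existence of functionals and change of predual\<close>

lemma restrict0_in_dual:
  assumes "normed_space_on X N" "clinear_on X f" "\<And>x. x \<in> X \<Longrightarrow> cmod (f x) \<le> B * N x"
  shows "restrict0 X f \<in> dual X N"
  using normed_space_onD(1)[OF assms(1)] clinear_onD[OF assms(2)] assms(3)
  by (intro dualI[where B = B])
    (auto simp: restrict0_def scaleC_complex_def complex_vector.subspace_add complex_vector.subspace_scale)

text \<open>Hahn-Banach with the norm itself as the dominating seminorm.\<close>

lemma norming_functional:
  assumes nX: "normed_space_on X N" and x: "x \<in> X"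
  obtains f where "f \<in> dual X N" "dual_norm X N f \<le> 1" "f x = complex_of_real (N x)"
proof -
  have "seminorm_on X N" using nX by (simp add: seminorm_on_def normed_space_on_def)
  then obtain g where g: "clinear_on X g" "\<And>y. y \<in> X \<Longrightarrow> cmod (g y) \<le> N y" "g x = complex_of_real (N x)"
    using Hahn_Banach[OF _ normed_space_onD(1)[OF nX] x] by metis
  have "restrict0 X g \<in> dual X N" by (rule restrict0_in_dual[OF nX g(1), of 1]) (use g(2) in simp)
  moreover have "dual_norm X N (restrict0 X g) \<le> 1"
    by (rule dual_norm_le[OF nX]) (use g(2) in \<open>force simp: restrict0_def\<close>)
  ultimately show thesis using that g(3) x by (simp add: restrict0_def)
qed

text \<open>Hahn-Banach with the distance to \<open>Z\<close> as the dominating seminorm: it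
  vanishes on \<open>Z\<close>, and it is positive at \<open>l\<close> because \<open>Z\<close> is
  closed.\<close>

lemma separating_functional:
  assumes nX: "normed_space_on X N" and ZX: "Z \<subseteq> X" and subZ: "complex_vector.subspace Z"
    and closed: "closedin (norm_topology X N) Z" and l: "l \<in> X" "l \<notin> Z"
  obtains f where "f \<in> dual X N" "\<And>z. z \<in> Z \<Longrightarrow> f z = 0" "f l \<noteq> 0"
proof -
  note sub = normed_space_onD(1)[OF nX]
  define p where "p x = (INF z\<in>Z. N (x - z))" for x
  have Z0: "0 \<in> Z" by (rule complex_vector.subspace_0[OF subZ])
  have dX: "x - z \<in> X" if "x \<in> X" "z \<in> Z" for x z
    using sub that ZX by (auto intro: complex_vector.subspace_diff)
  have p_le: "p x \<le> N (x - z)" if "x \<in> X" "z \<in> Z" for x z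
    unfolding p_def by (rule cINF_lower) (use that dX normed_space_onD(2)[OF nX] in \<open>auto intro!: bdd_belowI2\<close>)
  have p_ge: "c \<le> p x" if "\<And>z. z \<in> Z \<Longrightarrow> c \<le> N (x - z)" for c x
    unfolding p_def by (rule cINF_greatest) (use that Z0 in auto)
  have p_nonneg: "0 \<le> p x" if "x \<in> X" for x
    by (rule p_ge) (use dX[OF that] normed_space_onD(2)[OF nX] in auto)
  have p_N: "p x \<le> N x" if "x \<in> X" for x using p_le[OF that Z0] by simp
  have p_Z: "p z = 0" if "z \<in> Z" for z
    using p_le[of z z] p_nonneg[of z] that ZX normed_space_onD(6)[OF nX] by force
  have add: "p (x + y) \<le> p x + p y" if "x \<in> X" "y \<in> X" for x y
  proof -
    have "p (x + y) \<le> N (x - z) + N (y - w)" if "z \<in> Z" "w \<in> Z" for z w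
    proof -
      have "p (x + y) \<le> N (x + y - (z + w))"
        using \<open>x \<in> X\<close> \<open>y \<in> X\<close> that sub subZ by (intro p_le complex_vector.subspace_add)
      also have "x + y - (z + w) = (x - z) + (y - w)" by simp
      also have "N \<dots> \<le> N (x - z) + N (y - w)"
        using \<open>x \<in> X\<close> \<open>y \<in> X\<close> that by (intro normed_space_onD(5)[OF nX] dX)
      finally show ?thesis .
    qed
    then have "p (x + y) - N (y - w) \<le> p x" if "w \<in> Z" for w
      using that by (intro p_ge) fastforce
    then have "p (x + y) - p x \<le> p y" by (intro p_ge) fastforce
    then show ?thesis by simp
  qed
  have scale_le: "p (c *\<^sub>C x) \<le> cmod c * p x" if "x \<in> X" "c \<noteq> 0" for c x
  proof -
    have "p (c *\<^sub>C x) / cmod c \<le> p x"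
    proof (rule p_ge)
      fix z assume z: "z \<in> Z"
      have "p (c *\<^sub>C x) \<le> N (c *\<^sub>C x - c *\<^sub>C z)"
        using that z sub subZ by (intro p_le complex_vector.subspace_scale)
      also have "c *\<^sub>C x - c *\<^sub>C z = c *\<^sub>C (x - z)" by (simp add: complex_vector.scale_right_diff_distrib)
      also have "N \<dots> = cmod c * N (x - z)" by (rule normed_space_onD(4)[OF nX dX[OF that(1) z]])
      finally show "p (c *\<^sub>C x) / cmod c \<le> N (x - z)" using that(2) by (simp add: field_simps)
    qed
    then show ?thesis using that(2) by (simp add: field_simps)
  qed
  have scale: "p (c *\<^sub>C x) = cmod c * p x" if "x \<in> X" for c x
  proof (cases "c = 0")
    case True
    then show ?thesis using p_Z[OF Z0] by simp
  next
    case False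
    have "p (inverse c *\<^sub>C c *\<^sub>C x) \<le> cmod (inverse c) * p (c *\<^sub>C x)"
      using False that sub by (intro scale_le complex_vector.subspace_scale) auto
    then have "cmod c * p x \<le> p (c *\<^sub>C x)" using False by (simp add: norm_inverse norm_divide field_simps)
    then show ?thesis using scale_le[OF that False] by simp
  qed
  have "p l \<noteq> 0"
  proof
    assume p0: "p l = 0"
    have "\<exists>z\<in>Z. N (l - z) < inverse (real (Suc n))" for n
    proof (rule ccontr)
      assume "\<not> ?thesis"
      then have "inverse (real (Suc n)) \<le> p l" by (intro p_ge) force
      then show False using p0 by simp
    qed
    then obtain \<sigma> where \<sigma>: "\<And>n. \<sigma> n \<in> Z" "\<And>n. N (l - \<sigma> n) < inverse (real (Suc n))" by metis
    have "N (\<sigma> n - l) = N (l - \<sigma> n)" for n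
      using normed_space_on_minus[OF nX dX[OF l(1) \<sigma>(1)], of n] by simp
    then have "(\<lambda>n. N (\<sigma> n - l)) \<longlonglongrightarrow> 0"
      using \<sigma>(2) normed_space_onD(2)[OF nX dX[OF l(1) \<sigma>(1)]]
      by (intro tendsto_sandwich[OF _ _ tendsto_const LIMSEQ_inverse_real_of_nat] always_eventually allI)
        (auto intro: less_imp_le simp del: of_nat_Suc)
    then have "l \<in> Z" using closed \<sigma>(1) l(1) unfolding closedin_norm_topology[OF nX ZX] by blast
    then show False using l(2) by simp
  qed
  moreover obtain g where g: "clinear_on X g" "\<And>y. y \<in> X \<Longrightarrow> cmod (g y) \<le> p y" "g l = complex_of_real (p l)"
    using Hahn_Banach[OF _ sub l(1), of p] add scale unfolding seminorm_on_def by metis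
  moreover have "restrict0 X g \<in> dual X N"
    by (rule restrict0_in_dual[OF nX g(1), of 1]) (use g(2) p_N in force)
  moreover have "restrict0 X g z = 0" if "z \<in> Z" for z
    using g(2)[of z] p_Z[OF that] that ZX by (auto simp: restrict0_def)
  ultimately show thesis using that l(1) by (auto simp: restrict0_def)
qed

text \<open>The hypotheses say that \<open>\<theta> x\<close> is \<open>J x\<close> carried along
  \<open>T\<close>. Both directions use this: to replace an abstract predual by functionals on the
  algebra, and to copy a submodule into the host type.\<close>

lemma predual_transport:
  assumes J: "isometric_isomorphism X N (dual E NE) (dual_norm E NE) J" and nE: "normed_space_on E NE"
    and T: "isometric_isomorphism E NE Z NZ T"
    and \<theta>: "\<And>x \<xi>. x \<in> X \<Longrightarrow> \<xi> \<in> E \<Longrightarrow> \<theta> x (T \<xi>) = J x \<xi>" and \<theta>0: "\<And>x z. x \<in> X \<Longrightarrow> z \<notin> Z \<Longrightarrow> \<theta> x z = 0"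
    and subX: "complex_vector.subspace X"
  shows "isometric_isomorphism X N (dual Z NZ) (dual_norm Z NZ) \<theta>"
    and "predual_topology X E NE J = predual_topology X Z NZ \<theta>"
proof -
  note T' = isometric_isomorphismD[OF T] and J' = isometric_isomorphismD[OF J] and JD = isometric_dualD[OF J]
  have Z: "\<exists>\<xi>\<in>E. z = T \<xi>" if "z \<in> Z" for z using T'(2) that by (auto simp: bij_betw_def)
  have nZ: "normed_space_on Z NZ" by (rule normed_space_on_isometric[OF T nE])
  note subE = normed_space_onD(1)[OF nE]
  have \<theta>D: "\<theta> x \<in> dual Z NZ" if x: "x \<in> X" for x
  proof (rule dualI)
    note Jx = dualD[OF J'(4)[OF x]]
    show "\<theta> x z = 0" if "z \<notin> Z" for z using \<theta>0 x that .
    fix z assume "z \<in> Z"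
    then obtain \<xi> where \<xi>: "\<xi> \<in> E" "z = T \<xi>" using Z by blast
    show "cmod (\<theta> x z) \<le> dual_norm E NE (J x) * NZ z"
      using dual_norm_bound[OF nE J'(4)[OF x] \<xi>(1)] \<theta>[OF x \<xi>(1)] \<xi> T'(3) by simp
    show "\<theta> x (c *\<^sub>C z) = c * \<theta> x z" for c
      using \<theta>[OF x complex_vector.subspace_scale[OF subE \<xi>(1)], of c] \<theta>[OF x \<xi>(1)] clinear_onD(2)[OF T'(1) \<xi>(1)]
        \<xi>(2) Jx(4)[OF \<xi>(1)] by simp
    fix w assume "w \<in> Z"
    then obtain \<eta> where \<eta>: "\<eta> \<in> E" "w = T \<eta>" using Z by blast
    show "\<theta> x (z + w) = \<theta> x z + \<theta> x w"
      using \<theta>[OF x complex_vector.subspace_add[OF subE \<xi>(1) \<eta>(1)]] \<theta>[OF x \<xi>(1)] \<theta>[OF x \<eta>(1)]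
        clinear_onD(1)[OF T'(1) \<xi>(1) \<eta>(1)] \<xi>(2) \<eta>(2) Jx(3)[OF \<xi>(1) \<eta>(1)] by simp
  qed
  have eqI: "f = g" if "f \<in> dual Z NZ" "g \<in> dual Z NZ" "\<And>\<xi>. \<xi> \<in> E \<Longrightarrow> f (T \<xi>) = g (T \<xi>)" for f g
  proof
    fix z show "f z = g z"
      using that Z[of z] dualD(2)[OF that(1), of z] dualD(2)[OF that(2), of z] by (cases "z \<in> Z") auto
  qed
  have subD: "complex_vector.subspace (dual Z NZ)" by (rule subspace_dual[OF nZ])
  have lin: "clinear_on X \<theta>"
    unfolding clinear_on_def
  proof (intro conjI ballI allI)
    fix x y assume x: "x \<in> X" and y: "y \<in> X"
    have xy: "x + y \<in> X" by (rule complex_vector.subspace_add[OF subX x y])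
    show "\<theta> (x + y) = \<theta> x + \<theta> y"
      by (rule eqI) (use \<theta>D x y xy subD \<theta> JD(1) in \<open>auto intro: complex_vector.subspace_add\<close>)
  next
    fix c x assume x: "x \<in> X"
    have cx: "c *\<^sub>C x \<in> X" by (rule complex_vector.subspace_scale[OF subX x])
    show "\<theta> (c *\<^sub>C x) = c *\<^sub>C \<theta> x"
      by (rule eqI[OF \<theta>D[OF cx] complex_vector.subspace_scale[OF subD \<theta>D[OF x]]])
        (use x cx \<theta> JD(2) in \<open>auto simp: scaleC_fun_def scaleC_complex_def\<close>)
  qed
  have inj: "inj_on \<theta> X"
    by (rule inj_onI, rule JD(4)) (auto simp flip: \<theta>)
  have surj: "\<exists>x\<in>X. \<theta> x = f" if f: "f \<in> dual Z NZ" for f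
  proof -
    have "restrict0 E (f \<circ> T) \<in> dual E NE"
    proof (rule restrict0_in_dual[OF nE])
      show "clinear_on E (f \<circ> T)"
        using T'(1,4) dualD(3,4)[OF f] by (auto simp: clinear_on_def scaleC_complex_def)
      show "cmod ((f \<circ> T) \<xi>) \<le> dual_norm Z NZ f * NE \<xi>" if "\<xi> \<in> E" for \<xi>
        using dual_norm_bound[OF nZ f T'(4)[OF that]] T'(3)[OF that] by simp
    qed
    then obtain x where x: "x \<in> X" "J x = restrict0 E (f \<circ> T)" using JD(3) by blast
    have "\<theta> x = f"
      by (rule eqI[OF \<theta>D[OF x(1)] f]) (use \<theta>[OF x(1)] x(2) in \<open>simp add: restrict0_def\<close>)
    then show ?thesis using x(1) by blast
  qed
  have norm: "dual_norm Z NZ (\<theta> x) = N x" if x: "x \<in> X" for x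
  proof -
    have "{cmod (\<theta> x z) | z. z \<in> Z \<and> NZ z \<le> 1} = {cmod (J x \<xi>) | \<xi>. \<xi> \<in> E \<and> NE \<xi> \<le> 1}"
    proof (intro equalityI subsetI)
      fix r assume "r \<in> {cmod (\<theta> x z) | z. z \<in> Z \<and> NZ z \<le> 1}"
      then obtain z where "z \<in> Z" "NZ z \<le> 1" "r = cmod (\<theta> x z)" by blast
      moreover obtain \<xi> where "\<xi> \<in> E" "z = T \<xi>" using Z \<open>z \<in> Z\<close> by blast
      ultimately show "r \<in> {cmod (J x \<xi>) | \<xi>. \<xi> \<in> E \<and> NE \<xi> \<le> 1}" using \<theta>[OF x] T'(3) by auto
    next
      fix r assume "r \<in> {cmod (J x \<xi>) | \<xi>. \<xi> \<in> E \<and> NE \<xi> \<le> 1}"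
      then obtain \<xi> where "\<xi> \<in> E" "NE \<xi> \<le> 1" "r = cmod (J x \<xi>)" by blast
      then have "r = cmod (\<theta> x (T \<xi>))" "T \<xi> \<in> Z" "NZ (T \<xi>) \<le> 1" using \<theta>[OF x] T'(3,4) by auto
      then show "r \<in> {cmod (\<theta> x z) | z. z \<in> Z \<and> NZ z \<le> 1}" by blast
    qed
    then show ?thesis using J'(3)[OF x] by (simp add: dual_norm_def)
  qed
  show iso: "isometric_isomorphism X N (dual Z NZ) (dual_norm Z NZ) \<theta>"
    unfolding isometric_isomorphism_def bij_betw_def
    using lin inj surj \<theta>D norm by auto
  \<comment> \<open>The coordinate functions of the two topologies are the same up to the bijection
    \<open>T\<close>, so the identity is continuous both ways.\<close>
  have "topspace (initial_topology X J E) = topspace (initial_topology X \<theta> Z)" by simp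
  moreover have "continuous_map (initial_topology X J E) (initial_topology X \<theta> Z) id"
    unfolding continuous_map_initial
  proof (intro conjI ballI)
    fix z assume "z \<in> Z"
    then obtain \<xi> where \<xi>: "\<xi> \<in> E" "z = T \<xi>" using Z by blast
    show "continuous_map (initial_topology X J E) euclidean (\<lambda>x. \<theta> (id x) z)"
      by (rule continuous_map_eq[OF continuous_map_initial_coordinate[OF \<xi>(1)]]) (use \<theta> \<xi> in auto)
  qed auto
  moreover have "continuous_map (initial_topology X \<theta> Z) (initial_topology X J E) id"
    unfolding continuous_map_initial
  proof (intro conjI ballI)
    fix \<xi> assume \<xi>: "\<xi> \<in> E"
    show "continuous_map (initial_topology X \<theta> Z) euclidean (\<lambda>x. J (id x) \<xi>)"
      by (rule continuous_map_eq[OF continuous_map_initial_coordinate[OF T'(4)[OF \<xi>]]]) (use \<theta> \<xi> in auto)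
  qed auto
  ultimately have "initial_topology X J E = initial_topology X \<theta> Z"
    by (metis topology_eq topology_finer_continuous_id)
  then show "predual_topology X E NE J = predual_topology X Z NZ \<theta>"
    by (simp add: predual_topology_initial[OF JD(6)] predual_topology_initial[OF isometric_dualD(6)[OF iso]])
qed

section \<open>Multipliers\<close>

text \<open>Baire category: the closed sets \<open>G n\<close> cover the space, so one of them
  contains a ball.\<close>

theorem uniform_boundedness:
  fixes T :: "'i \<Rightarrow> 'a::banach \<Rightarrow> 'b::real_normed_vector"
  assumes lin: "\<And>i. i \<in> I \<Longrightarrow> bounded_linear (T i)"
    and bdd: "\<And>x. \<exists>B. \<forall>i\<in>I. norm (T i x) \<le> B"
  obtains C where "C \<ge> 0" "\<And>i x. i \<in> I \<Longrightarrow> norm (T i x) \<le> C * norm x"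
proof -
  define G where "G n = {x. \<forall>i\<in>I. norm (T i x) \<le> real n}" for n
  have "closed (G n)" for n
  proof -
    have "G n = (\<Inter>i\<in>I. {x. norm (T i x) \<le> real n})" by (auto simp: G_def)
    moreover have "closed {x. norm (T i x) \<le> real n}" if "i \<in> I" for i
      by (intro closed_Collect_le continuous_intros linear_continuous_on[OF lin[OF that]])
    ultimately show ?thesis by (simp add: closed_INT)
  qed
  moreover have "\<Union> (range G) = UNIV"
  proof -
    have "\<exists>n. x \<in> G n" for x
    proof -
      obtain B where B: "\<forall>i\<in>I. norm (T i x) \<le> B" using bdd by blast
      obtain n where "B \<le> real n" using real_arch_simple by blast
      then have "x \<in> G n" using B order_trans unfolding G_def by blast
      then show ?thesis ..
    qed
    then show ?thesis by auto
  qed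
  ultimately have "\<exists>n. interior (G n) \<noteq> {}"
    using Baire_category_alt[of "euclidean :: 'a topology" "range G"]
    by (auto simp: completely_metrizable_space_euclidean)
  then obtain n x where "x \<in> interior (G n)" by blast
  then obtain r where r: "r > 0" "ball x r \<subseteq> G n" by (auto simp: mem_interior)
  have "norm (T i y) \<le> (4 * real n / r) * norm y" if i: "i \<in> I" for i y
  proof (cases "y = 0")
    case True
    then show ?thesis using bounded_linear.linear[OF lin[OF i]] linear_0 by fastforce
  next
    case False
    interpret bounded_linear "T i" by (rule lin[OF i])
    \<comment> \<open>This makes \<open>s *\<^sub>R y\<close> of norm \<open>r / 2\<close>, so the
      shifted centre stays in the ball. Two bounds by \<open>n\<close> give \<open>2 * n\<close>,
      and division by \<open>s\<close> gives the constant \<open>4 * n / r\<close>.\<close>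
    define s where "s = r / (2 * norm y)"
    have s: "s > 0" "s * norm y = r / 2" using False r(1) by (auto simp: s_def)
    have "x + s *\<^sub>R y \<in> ball x r" using s r(1) by (simp add: dist_norm)
    then have "norm (T i (x + s *\<^sub>R y)) \<le> real n" "norm (T i x) \<le> real n"
      using r i by (auto simp: G_def subset_iff)
    then have "norm (T i (x + s *\<^sub>R y) - T i x) \<le> 2 * real n"
      using norm_triangle_ineq4[of "T i (x + s *\<^sub>R y)" "T i x"] by linarith
    then have "s * norm (T i y) \<le> 2 * real n" using s(1) by (simp add: add scaleR)
    then show ?thesis using False r(1) by (simp add: s_def field_simps)
  qed
  moreover have "4 * real n / r \<ge> 0" using r(1) by simp
  ultimately show thesis using that by blast
qed

section \<open>Bounded functionals on the algebra\<close>

lemma normed_space_on_algebra: "normed_space_on UNIV (norm :: 'a::complex_banach_algebra \<Rightarrow> real)"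
  by (simp add: normed_space_on_def norm_scaleC norm_triangle_ineq)

lemmas subspace_alg_dual = subspace_dual[OF normed_space_on_algebra]
  and alg_dual_bound = dual_norm_bound[OF normed_space_on_algebra _ UNIV_I]
  and normed_space_on_alg_dual = normed_space_on_dual[OF normed_space_on_algebra]

lemma alg_dualI:
  assumes "\<And>x y. f (x + y) = f x + f y" "\<And>c x. f (c *\<^sub>C x) = c * f x" "\<And>x. cmod (f x) \<le> B * norm x"
  shows "f \<in> alg_dual"
  using assms by (intro dualI[where B = B]) auto

lemma alg_dualD:
  assumes "f \<in> alg_dual"
  shows "f (x + y) = f x + f y" "f (c *\<^sub>C x) = c * f x" "f (x - y) = f x - f y"
  using dualD[OF assms] clinear_on_diff[of UNIV f] by auto

lemma alg_dual_tendsto: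
  assumes f: "f \<in> alg_dual" and x: "(x \<longlongrightarrow> l) F"
  shows "((\<lambda>i. f (x i)) \<longlongrightarrow> f l) F"
proof (rule LIM_zero_cancel)
  show "((\<lambda>i. f (x i) - f l) \<longlongrightarrow> 0) F"
  proof (rule Lim_null_comparison)
    show "\<forall>\<^sub>F i in F. norm (f (x i) - f l) \<le> alg_dual_norm f * norm (x i - l)"
      using alg_dual_bound[OF f] by (simp add: alg_dualD(3)[OF f, symmetric])
    have "((\<lambda>i. norm (x i - l)) \<longlongrightarrow> 0) F" using x tendsto_norm_zero LIM_zero by blast
    then show "((\<lambda>i. alg_dual_norm f * norm (x i - l)) \<longlongrightarrow> 0) F" by (rule tendsto_mult_right_zero)
  qed
qed

lemma alg_dual_comp:
  assumes f: "f \<in> alg_dual" and "bounded_linear T" and "\<And>c x. T (c *\<^sub>C x) = c *\<^sub>C T x"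
  shows "f \<circ> T \<in> alg_dual"
proof (rule alg_dualI)
  interpret bounded_linear T by fact
  fix x y c
  show "(f \<circ> T) (x + y) = (f \<circ> T) x + (f \<circ> T) y" by (simp add: add alg_dualD[OF f])
  show "(f \<circ> T) (c *\<^sub>C x) = c * (f \<circ> T) x" by (simp add: assms(3) alg_dualD[OF f])
  have "cmod (f (T x)) \<le> alg_dual_norm f * norm (T x)" by (rule alg_dual_bound[OF f])
  also have "\<dots> \<le> alg_dual_norm f * (onorm T * norm x)"
    by (rule mult_left_mono[OF onorm dual_norm_nonneg[OF normed_space_on_algebra f]]) fact
  finally show "cmod ((f \<circ> T) x) \<le> (alg_dual_norm f * onorm T) * norm x" by simp
qed

lemma left_act_in_alg_dual: "\<mu> \<in> alg_dual \<Longrightarrow> left_act a \<mu> \<in> alg_dual"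
  using alg_dual_comp[of \<mu> "\<lambda>b. b * a"]
  by (simp add: left_act_def bounded_linear_mult_left mult_scaleC_left comp_def)

lemma evaluation_in_bidual: "restrict0 alg_dual (\<lambda>\<mu>. \<mu> a) \<in> dual alg_dual alg_dual_norm"
  by (rule restrict0_in_dual[OF normed_space_on_alg_dual, of _ "norm a"])
    (use alg_dual_bound in \<open>auto simp: clinear_on_def scaleC_fun_def mult.commute\<close>)

definition mult_one :: "('a \<Rightarrow> 'a) \<times> ('a \<Rightarrow> 'a)" where
  "mult_one = (\<lambda>x. x, \<lambda>x. x)"

text \<open>The map \<open>\<iota>\<close> of the overview.\<close>

definition mult_embed :: "'a::complex_banach_algebra \<Rightarrow> ('a \<Rightarrow> 'a) \<times> ('a \<Rightarrow> 'a)" where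
  "mult_embed a = (\<lambda>b. a * b, \<lambda>b. b * a)"

section \<open>Algebraic operations on multipliers\<close>

lemma multipliers_iff: "m \<in> multipliers \<longleftrightarrow> (\<forall>a b. a * fst m b = snd m a * b)"
  by (cases m) (simp add: multipliers_def)

lemma mult_prod_simps [simp]:
  "fst (mult_prod m n) = fst m \<circ> fst n" "snd (mult_prod m n) = snd n \<circ> snd m"
  by (cases m; cases n; simp add: mult_prod_def)+

lemma mult_one_multiplier: "mult_one \<in> multipliers"
  by (simp add: multipliers_iff mult_one_def)

lemma mult_embed_multiplier: "mult_embed a \<in> multipliers"
  by (simp add: multipliers_iff mult_embed_def mult.assoc)

lemma mult_prod_multiplier: "m \<in> multipliers \<Longrightarrow> n \<in> multipliers \<Longrightarrow> mult_prod m n \<in> multipliers"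
  by (simp add: multipliers_iff)

lemma mult_prod_one: "mult_prod m mult_one = m" "mult_prod mult_one m = m"
  by (simp_all add: mult_one_def prod_eq_iff comp_def)

lemma mult_embed_add: "mult_embed (a + b) = mult_embed a + mult_embed b"
  and mult_embed_scaleC: "mult_embed (c *\<^sub>C a) = c *\<^sub>C mult_embed a"
  by (simp_all add: mult_embed_def prod_eq_iff fun_eq_iff algebra_simps scaleC_prod_def scaleC_fun_def
      mult_scaleC_left mult_scaleC_right)

lemma subspace_multipliers: "complex_vector.subspace multipliers"
  unfolding complex_vector.subspace_def
  by (auto simp: multipliers_iff algebra_simps scaleC_prod_def scaleC_fun_def mult_scaleC_left mult_scaleC_right)

section \<open>Multipliers in the presence of an approximate identity\<close>

locale approximate_identity =
  fixes e :: "'i \<Rightarrow> 'a::complex_banach_algebra" and F :: "'i filter"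
  assumes cai: "contractive_approximate_identity e F"
begin

lemma F_nontrivial: "F \<noteq> bot"
  and norm_e: "norm (e i) \<le> 1"
  and e_left: "((\<lambda>i. e i * a) \<longlongrightarrow> a) F"
  and e_right: "((\<lambda>i. a * e i) \<longlongrightarrow> a) F"
  using cai by (auto simp: contractive_approximate_identity_def)

text \<open>An element is the limit of its products with \<open>e i\<close>, so it can be recovered
  from them; this allows cancellation.\<close>

lemma left_faithful:
  fixes x y :: 'a
  assumes "\<And>a. a * x = a * y" shows "x = y"
  using assms tendsto_unique[OF F_nontrivial e_left[of x]] e_left[of y] by simp

lemma right_faithful:
  fixes x y :: 'a
  assumes "\<And>a. x * a = y * a" shows "x = y"
  using assms tendsto_unique[OF F_nontrivial e_right[of x]] e_right[of y] by simp

text \<open>Contractivity enters here: the products with \<open>e i\<close> are among those bounded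
  by \<open>B\<close>, and they converge to \<open>x\<close>.\<close>

lemma norm_le_left:
  fixes x :: 'a
  assumes "\<And>a. norm a \<le> 1 \<Longrightarrow> norm (a * x) \<le> B" shows "norm x \<le> B"
proof (rule tendsto_upperbound[OF tendsto_norm[OF e_left] _ F_nontrivial])
  show "\<forall>\<^sub>F i in F. norm (e i * x) \<le> B"
    using assms[OF norm_e] by simp
qed

lemma norm_le_right:
  fixes x :: 'a
  assumes "\<And>a. norm a \<le> 1 \<Longrightarrow> norm (x * a) \<le> B" shows "norm x \<le> B"
proof (rule tendsto_upperbound[OF tendsto_norm[OF e_right] _ F_nontrivial])
  show "\<forall>\<^sub>F i in F. norm (x * e i) \<le> B"
    using assms[OF norm_e] by simp
qed

context
  fixes m :: "('a \<Rightarrow> 'a) \<times> ('a \<Rightarrow> 'a)"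
  assumes m: "m \<in> multipliers"
begin

lemma multiplier_eq: "a * fst m b = snd m a * b"
  using m by (simp add: multipliers_iff)

text \<open>Only the multiplier identity is assumed of the two maps. It moves one map onto the other
  factor, where the claim is trivial, and faithfulness cancels that factor; linearity is obtained in
  the same way.\<close>

lemma multiplier_mult: "fst m (a * b) = fst m a * b" "snd m (a * b) = a * snd m b"
proof -
  show "fst m (a * b) = fst m a * b"
    by (rule left_faithful) (metis multiplier_eq mult.assoc)
  show "snd m (a * b) = a * snd m b"
    by (rule right_faithful) (metis multiplier_eq mult.assoc)
qed

lemma multiplier_add: "fst m (a + b) = fst m a + fst m b" "snd m (a + b) = snd m a + snd m b"
proof -
  show "fst m (a + b) = fst m a + fst m b"
    by (rule left_faithful) (simp add: multiplier_eq distrib_left)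
  show "snd m (a + b) = snd m a + snd m b"
    by (rule right_faithful) (simp add: multiplier_eq[symmetric] distrib_right)
qed

lemma multiplier_scaleC: "fst m (c *\<^sub>C a) = c *\<^sub>C fst m a" "snd m (c *\<^sub>C a) = c *\<^sub>C snd m a"
proof -
  show "fst m (c *\<^sub>C a) = c *\<^sub>C fst m a"
    by (rule left_faithful) (simp add: multiplier_eq mult_scaleC_right)
  show "snd m (c *\<^sub>C a) = c *\<^sub>C snd m a"
    by (rule right_faithful) (simp add: multiplier_eq[symmetric] mult_scaleC_left)
qed

text \<open>
  Boundedness comes from uniform boundedness of the maps \<open>b \<mapsto> snd m a * b = a * fst m b\<close>
  with \<open>a\<close> in the unit ball.
\<close>

lemma bounded_linear_multiplier: "bounded_linear (fst m)" "bounded_linear (snd m)"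
proof -
  have "\<exists>B. \<forall>a\<in>{a. norm a \<le> 1}. norm (snd m a * b) \<le> B" for b
  proof (intro exI ballI)
    fix a :: 'a assume "a \<in> {a. norm a \<le> 1}"
    then show "norm (snd m a * b) \<le> norm (fst m b)"
      using norm_mult_ineq[of a "fst m b"] mult_right_mono[of "norm a" 1 "norm (fst m b)"]
      by (simp add: multiplier_eq)
  qed
  then obtain C where C: "\<And>a b. norm a \<le> 1 \<Longrightarrow> norm (snd m a * b) \<le> C * norm b"
    using uniform_boundedness[of "{a. norm a \<le> 1}" "\<lambda>a b. snd m a * b"]
    by (metis (no_types, lifting) bounded_linear_mult_right mem_Collect_eq)
  \<comment> \<open>The same family read as \<open>a * fst m b\<close>: taking the supremum over
    \<open>a\<close> recovers the norm of \<open>fst m b\<close>.\<close>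
  have L: "norm (fst m b) \<le> C * norm b" for b
    by (rule norm_le_left) (use C in \<open>simp add: multiplier_eq\<close>)
  show "bounded_linear (fst m)"
    by (rule bounded_linear_intro[where K = C])
      (use L in \<open>simp_all add: multiplier_add multiplier_scaleC scaleR_eq_scaleC mult.commute\<close>)
  have R: "norm (snd m a) \<le> \<bar>C\<bar> * norm a" for a
  proof (rule norm_le_right)
    fix b :: 'a assume b: "norm b \<le> 1"
    have "norm (snd m a * b) \<le> norm a * norm (fst m b)"
      by (metis multiplier_eq norm_mult_ineq)
    also have "\<dots> \<le> norm a * (\<bar>C\<bar> * 1)"
      using L[of b] mult_mono[OF abs_ge_self[of C] b] by (intro mult_left_mono) auto
    finally show "norm (snd m a * b) \<le> \<bar>C\<bar> * norm a" by (simp add: mult.commute)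
  qed
  show "bounded_linear (snd m)"
    by (rule bounded_linear_intro[where K = "\<bar>C\<bar>"])
      (use R in \<open>simp_all add: multiplier_add multiplier_scaleC scaleR_eq_scaleC mult.commute\<close>)
qed

text \<open>The identity \<open>snd m a * b = a * fst m b\<close> bounds each operator norm by the
  other, so later estimates need to be checked on one component only.\<close>

lemma mult_norm_eq: "mult_norm m = onorm (fst m)" "mult_norm m = onorm (snd m)"
proof -
  note L = bounded_linear_multiplier(1) and R = bounded_linear_multiplier(2)
  have "onorm (snd m) \<le> onorm (fst m)"
  proof (rule onorm_bound[OF onorm_pos_le[OF L]], rule norm_le_right)
    fix a b :: 'a assume b: "norm b \<le> 1"
    have "norm (snd m a * b) \<le> norm a * norm (fst m b)"
      by (metis multiplier_eq norm_mult_ineq)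
    also have "\<dots> \<le> norm a * onorm (fst m)"
      using onorm[OF L, of b] mult_left_mono[OF b onorm_pos_le[OF L]] by (intro mult_left_mono) auto
    finally show "norm (snd m a * b) \<le> onorm (fst m) * norm a" by (simp add: mult.commute)
  qed
  moreover have "onorm (fst m) \<le> onorm (snd m)"
  proof (rule onorm_bound[OF onorm_pos_le[OF R]], rule norm_le_left)
    fix a b :: 'a assume b: "norm b \<le> 1"
    have "norm (b * fst m a) \<le> norm (snd m b) * norm a"
      by (metis multiplier_eq norm_mult_ineq)
    also have "\<dots> \<le> onorm (snd m) * norm a"
      using onorm[OF R, of b] mult_left_mono[OF b onorm_pos_le[OF R]] by (intro mult_right_mono) auto
    finally show "norm (b * fst m a) \<le> onorm (snd m) * norm a" .
  qed
  ultimately show "mult_norm m = onorm (fst m)" "mult_norm m = onorm (snd m)"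
    by (simp_all add: mult_norm_def case_prod_beta)
qed

lemma mult_norm_nonneg: "0 \<le> mult_norm m"
  unfolding mult_norm_eq(1) by (rule onorm_pos_le[OF bounded_linear_multiplier(1)])

lemma mult_norm_bound: "norm (fst m a) \<le> mult_norm m * norm a" "norm (snd m a) \<le> mult_norm m * norm a"
  using onorm[OF bounded_linear_multiplier(1)] onorm[OF bounded_linear_multiplier(2)]
  by (simp_all flip: mult_norm_eq)

lemma mult_norm_le:
  assumes "\<And>a. norm (fst m a) \<le> B * norm a" "0 \<le> B"
  shows "mult_norm m \<le> B"
  unfolding mult_norm_eq(1) by (rule onorm_bound) (use assms in auto)

lemma multiplier_comp_in_alg_dual:
  assumes "\<mu> \<in> alg_dual"
  shows "\<mu> \<circ> fst m \<in> alg_dual" "\<mu> \<circ> snd m \<in> alg_dual"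
  using assms bounded_linear_multiplier multiplier_scaleC by (auto intro: alg_dual_comp)

text \<open>The embedded algebra is a two-sided ideal, so multiplying
  \<open>mult_embed (e i)\<close> by a multiplier leads back into the algebra.\<close>

lemma mult_prod_embed: "mult_prod m (mult_embed a) = mult_embed (fst m a)"
  "mult_prod (mult_embed a) m = mult_embed (snd m a)"
  by (simp_all add: mult_embed_def prod_eq_iff fun_eq_iff multiplier_mult multiplier_eq)

text \<open>Each component applied to the net recovers the other one: \<open>b * fst m (e i)\<close>
  equals \<open>snd m b * e i\<close>.\<close>

lemma multiplier_limits:
  shows "((\<lambda>i. b * fst m (e i)) \<longlongrightarrow> snd m b) F" "((\<lambda>i. snd m (e i) * b) \<longlongrightarrow> fst m b) F"
  using e_right[of "snd m b"] e_left[of "fst m b"] by (simp_all add: multiplier_eq)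

end

lemma mult_norm_embed: "mult_norm (mult_embed (a :: 'a)) \<le> norm a"
  by (rule mult_norm_le[OF mult_embed_multiplier]) (simp_all add: mult_embed_def norm_mult_ineq)

text \<open>Completeness is a hypothesis because at the point of use it is inherited from the dual
  of a submodule.\<close>

lemma banach_algebra_on_multipliers:
  assumes "banach_space_on (multipliers :: (('a \<Rightarrow> 'a) \<times> ('a \<Rightarrow> 'a)) set) mult_norm"
  shows "banach_algebra_on (multipliers :: (('a \<Rightarrow> 'a) \<times> ('a \<Rightarrow> 'a)) set) mult_prod mult_norm"
  unfolding banach_algebra_on_def
proof (intro conjI ballI)
  fix m n :: "('a \<Rightarrow> 'a) \<times> ('a \<Rightarrow> 'a)" assume m: "m \<in> multipliers" and n: "n \<in> multipliers"
  show "mult_prod m n \<in> multipliers" by (rule mult_prod_multiplier[OF m n])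
  show "mult_prod (mult_prod m n) k = mult_prod m (mult_prod n k)" for k
    by (simp add: prod_eq_iff comp_assoc)
  show "mult_norm (mult_prod m n) \<le> mult_norm m * mult_norm n"
  proof (rule mult_norm_le[OF mult_prod_multiplier[OF m n]])
    show "norm (fst (mult_prod m n) a) \<le> mult_norm m * mult_norm n * norm a" for a
      using mult_norm_bound(1)[OF m, of "fst n a"]
        mult_left_mono[OF mult_norm_bound(1)[OF n, of a] mult_norm_nonneg[OF m]]
      by (simp add: mult.assoc)
  qed (use mult_norm_nonneg[OF m] mult_norm_nonneg[OF n] in simp)
next
  fix m :: "('a \<Rightarrow> 'a) \<times> ('a \<Rightarrow> 'a)" assume m: "m \<in> multipliers"
  show "clinear_on multipliers (mult_prod m)" "clinear_on multipliers (\<lambda>n. mult_prod n m)"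
    by (auto simp: clinear_on_def prod_eq_iff fun_eq_iff scaleC_prod_def scaleC_fun_def
        multiplier_add[OF m] multiplier_scaleC[OF m])
qed (rule assms)

end

locale approximate_identity_accumulation = approximate_identity e F
  for e :: "'i \<Rightarrow> 'a::complex_banach_algebra" and F +
  fixes \<Phi>\<^sub>0 :: "('a \<Rightarrow> complex) \<Rightarrow> complex"
  assumes \<Phi>\<^sub>0: "accumulation_point (weak_star_topology alg_dual alg_dual_norm)
      (\<lambda>i. bidual_embedding (e i)) F \<Phi>\<^sub>0"
begin

lemma \<Phi>\<^sub>0_in_bidual: "\<Phi>\<^sub>0 \<in> dual alg_dual alg_dual_norm"
  using \<Phi>\<^sub>0 by (simp add: accumulation_point_def weak_star_topology_initial)

text \<open>Where the net of values converges, an accumulation point has no choice; all explicit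
  values of \<open>\<Phi>\<^sub>0\<close> are found this way.\<close>

lemma \<Phi>\<^sub>0_eqI:
  assumes \<mu>: "\<mu> \<in> alg_dual" and lim: "((\<lambda>i. \<mu> (e i)) \<longlongrightarrow> c) F"
  shows "\<Phi>\<^sub>0 \<mu> = c"
proof (rule accumulation_point_tendsto[OF \<Phi>\<^sub>0])
  show "continuous_map (weak_star_topology alg_dual alg_dual_norm) euclidean (\<lambda>\<Phi>. \<Phi> \<mu>)"
    unfolding weak_star_topology_initial using \<mu> by (rule continuous_map_initial_coordinate)
  show "((\<lambda>i. bidual_embedding (e i) \<mu>) \<longlongrightarrow> c) F"
    using lim \<mu> by (simp add: bidual_embedding_def restrict0_def)
qed

lemma theta_0_eq:
  assumes "Z \<subseteq> WAP" "\<mu> \<in> Z"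
  shows "theta_0 \<Phi>\<^sub>0 Z m \<mu> = \<Phi>\<^sub>0 (\<mu> \<circ> fst m)"
proof -
  have "\<mu> \<in> WAP" "\<mu> \<in> alg_dual" using assms by (auto simp: WAP_def)
  then show ?thesis
    using assms(2) by (cases m) (simp add: theta_0_def theta_w_def biadjoint_def restrict0_def)
qed

lemma theta_0_outside: "\<mu> \<notin> Z \<Longrightarrow> theta_0 \<Phi>\<^sub>0 Z m \<mu> = 0"
  by (simp add: theta_0_def restrict0_def)

end

section \<open>From a submodule to a predual\<close>

text \<open>Evaluations at points of the algebra separate functionals, so on a weakly compact set
  pointwise convergence already is weak convergence.\<close>

lemma weakly_compact_pointwise_limit:
  fixes T :: "'a::complex_banach_algebra \<Rightarrow> 'a \<Rightarrow> complex"
  assumes T: "weakly_compact_map UNIV norm alg_dual alg_dual_norm T"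
    and x: "\<And>i. norm (x i) \<le> B" and l: "l \<in> alg_dual" and lim: "\<And>b. ((\<lambda>i. T (x i) b) \<longlongrightarrow> l b) F"
    and \<Phi>: "\<Phi> \<in> dual alg_dual alg_dual_norm"
  shows "((\<lambda>i. \<Phi> (T (x i))) \<longlongrightarrow> \<Phi> l) F"
proof -
  \<comment> \<open>Scales the bounded net into the unit ball, whose image is the set known to be
    relatively compact; the summand 1 keeps \<open>c\<close> finite and nonzero when
    \<open>B\<close> is 0.\<close>
  define c :: complex where "c = complex_of_real (inverse (\<bar>B\<bar> + 1))"
  have pos: "inverse (\<bar>B\<bar> + 1) > 0" by simp
  have c: "c \<noteq> 0" "cmod c = inverse (\<bar>B\<bar> + 1)"
    unfolding c_def of_real_eq_0_iff norm_of_real using pos by auto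
  define I :: "(('a \<Rightarrow> complex) \<Rightarrow> complex) set" where "I = dual alg_dual alg_dual_norm"
  define g where "g = (\<lambda>(\<mu> :: 'a \<Rightarrow> complex) \<Psi> :: ('a \<Rightarrow> complex) \<Rightarrow> complex. \<Psi> \<mu>)"
  define W where "W = initial_topology alg_dual g I"
  define K where "K = W closure_of (T ` {x \<in> UNIV. norm x \<le> 1})"
  have W: "weak_topology alg_dual alg_dual_norm = W"
    by (simp add: W_def g_def I_def weak_topology_initial)
  have TD: "T a \<in> alg_dual" for a using T by (auto simp: weakly_compact_map_def)
  have cT: "T (c *\<^sub>C a) = c *\<^sub>C T a" for a using T by (auto simp: weakly_compact_map_def clinear_on_def)
  have cl: "c *\<^sub>C l \<in> alg_dual" by (rule complex_vector.subspace_scale[OF subspace_alg_dual l])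
  have K: "compactin W K" using T W by (simp add: weakly_compact_map_def K_def)
  have "((\<lambda>i. g (T (c *\<^sub>C x i)) \<Phi>) \<longlongrightarrow> g (c *\<^sub>C l) \<Phi>) F"
  proof (rule tendsto_initial_compact[where g = g and l = "c *\<^sub>C l"])
    show "compactin (initial_topology alg_dual g I) K" using K by (simp add: W_def)
    have "T (c *\<^sub>C x i) \<in> K" for i
    proof -
      have "norm (x i) \<le> \<bar>B\<bar> + 1" using x[of i] by simp
      then have "norm (c *\<^sub>C x i) \<le> 1" by (simp add: norm_scaleC c(2) field_simps)
      moreover have "T ` {x \<in> UNIV. norm x \<le> 1} \<subseteq> K"
        unfolding K_def by (rule closure_of_subset) (use TD in \<open>auto simp: W_def\<close>)
      ultimately show ?thesis by auto
    qed
    then show "\<forall>\<^sub>F i in F. T (c *\<^sub>C x i) \<in> K" by simp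
    show "range (\<lambda>a. restrict0 alg_dual (\<lambda>\<mu>. \<mu> a)) \<subseteq> I"
      using evaluation_in_bidual by (auto simp: I_def)
    show "((\<lambda>i. g (T (c *\<^sub>C x i)) s) \<longlongrightarrow> g (c *\<^sub>C l) s) F"
      if "s \<in> range (\<lambda>a. restrict0 alg_dual (\<lambda>\<mu>. \<mu> a))" for s
      using that tendsto_mult_left[OF lim, of c] cl complex_vector.subspace_scale[OF subspace_alg_dual TD]
      by (auto simp: g_def restrict0_def cT scaleC_fun_def scaleC_complex_def)
    show "p = c *\<^sub>C l" if p: "p \<in> K"
      "\<And>s. s \<in> range (\<lambda>a. restrict0 alg_dual (\<lambda>\<mu>. \<mu> a)) \<Longrightarrow> g p s = g (c *\<^sub>C l) s" for p
    proof
      fix a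
      have "p \<in> alg_dual" using p(1) closure_of_subset_topspace[of W] by (auto simp: K_def W_def)
      then show "p a = (c *\<^sub>C l) a" using p(2)[OF rangeI, of a] cl by (simp add: g_def restrict0_def)
    qed
    show "\<Phi> \<in> I" using \<Phi> by (simp add: I_def)
  qed
  then have "((\<lambda>i. c * \<Phi> (T (x i))) \<longlongrightarrow> c * \<Phi> l) F"
    by (simp add: g_def cT dualD(4)[OF \<Phi>] TD l)
  then have "((\<lambda>i. inverse c * (c * \<Phi> (T (x i)))) \<longlongrightarrow> inverse c * (c * \<Phi> l)) F"
    by (rule tendsto_mult_left)
  then show ?thesis using c(1) by (simp flip: mult.assoc)
qed

text \<open>A norm-closed subspace is weakly closed: a functional separating \<open>l\<close> from
  \<open>Z\<close> would vanish along the net but not at its weak limit.\<close>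

lemma closed_submodule_limit:
  fixes T :: "'a::complex_banach_algebra \<Rightarrow> 'a \<Rightarrow> complex"
  assumes Z: "closed_submodule_of_WAP Z" and F: "F \<noteq> bot"
    and T: "weakly_compact_map UNIV norm alg_dual alg_dual_norm T" and TZ: "\<And>i. T (x i) \<in> Z"
    and x: "\<And>i. norm (x i) \<le> B" and l: "l \<in> alg_dual" and lim: "\<And>b. ((\<lambda>i. T (x i) b) \<longlongrightarrow> l b) F"
  shows "l \<in> Z"
proof (rule ccontr)
  assume "l \<notin> Z"
  have "Z \<subseteq> alg_dual" using Z by (auto simp: closed_submodule_of_WAP_def WAP_def)
  then obtain \<Phi> where \<Phi>: "\<Phi> \<in> dual alg_dual alg_dual_norm" "\<And>z. z \<in> Z \<Longrightarrow> \<Phi> z = 0" "\<Phi> l \<noteq> 0"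
    using separating_functional[OF normed_space_on_alg_dual _ _ _ l \<open>l \<notin> Z\<close>] Z
    unfolding closed_submodule_of_WAP_def by metis
  have "((\<lambda>i. \<Phi> (T (x i))) \<longlongrightarrow> \<Phi> l) F"
    by (rule weakly_compact_pointwise_limit[OF T x l lim \<Phi>(1)])
  then have "((\<lambda>i. 0) \<longlongrightarrow> \<Phi> l) F" using \<Phi>(2)[OF TZ] by simp
  then show False using tendsto_unique[OF F _ tendsto_const] \<Phi>(3) by metis
qed

context approximate_identity
begin

text \<open>The components cross over: \<mu> acted on by \<open>snd m (e i)\<close> takes
  \<open>b\<close> to the value of \<mu> at \<open>snd m (e i) * b\<close>, which tends to its value
  at \<open>fst m b\<close>. Only the module actions of the algebra on \<open>Z\<close> are used for
  the approximants.\<close>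

lemma closed_submodule_multiplier:
  fixes m :: "('a \<Rightarrow> 'a) \<times> ('a \<Rightarrow> 'a)"
  assumes Z: "closed_submodule_of_WAP Z" and \<mu>: "\<mu> \<in> Z" and m: "m \<in> multipliers"
  shows "\<mu> \<circ> fst m \<in> Z" "\<mu> \<circ> snd m \<in> Z"
proof -
  have W: "\<mu> \<in> alg_dual" "weakly_compact_map UNIV norm alg_dual alg_dual_norm (\<lambda>a. left_act a \<mu>)"
    "weakly_compact_map UNIV norm alg_dual alg_dual_norm (\<lambda>a. right_act \<mu> a)"
    and act: "\<And>a. left_act a \<mu> \<in> Z" "\<And>a. right_act \<mu> a \<in> Z"
    using Z \<mu> by (auto simp: closed_submodule_of_WAP_def WAP_def)
  have bound: "norm (fst m (e i)) \<le> mult_norm m" "norm (snd m (e i)) \<le> mult_norm m" for i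
    using mult_norm_bound[OF m, of "e i"] mult_left_mono[OF norm_e[of i] mult_norm_nonneg[OF m]] by auto
  show "\<mu> \<circ> fst m \<in> Z"
    by (rule closed_submodule_limit[OF Z F_nontrivial W(3) act(2) bound(2)])
      (use multiplier_comp_in_alg_dual[OF m W(1)] alg_dual_tendsto[OF W(1) multiplier_limits(2)[OF m]] in
        \<open>auto simp: right_act_def\<close>)
  show "\<mu> \<circ> snd m \<in> Z"
    by (rule closed_submodule_limit[OF Z F_nontrivial W(2) act(1) bound(1)])
      (use multiplier_comp_in_alg_dual[OF m W(1)] alg_dual_tendsto[OF W(1) multiplier_limits(1)[OF m]] in
        \<open>auto simp: left_act_def\<close>)
qed

end

context approximate_identity_accumulation
begin

text \<open>
  Weak compactness permits interchanging the two limits along the approximate identity in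
  \<open>\<nu> (e j * fst m (e i)) = \<nu> (snd m (e j) * e i)\<close>.
\<close>

lemma \<Phi>\<^sub>0_multiplier_swap:
  assumes \<nu>: "\<nu> \<in> WAP" and m: "m \<in> multipliers"
  shows "\<Phi>\<^sub>0 (\<nu> \<circ> fst m) = \<Phi>\<^sub>0 (\<nu> \<circ> snd m)"
proof -
  have W: "\<nu> \<in> alg_dual" "weakly_compact_map UNIV norm alg_dual alg_dual_norm (\<lambda>a. left_act a \<nu>)"
    using \<nu> by (auto simp: WAP_def)
  have bound: "norm (fst m (e i)) \<le> mult_norm m" for i
    using mult_norm_bound[OF m, of "e i"] mult_left_mono[OF norm_e[of i] mult_norm_nonneg[OF m]] by auto
  \<comment> \<open>The inner limit: the translates converge pointwise to
    \<open>\<nu> \<circ> snd m\<close>, hence weakly, hence under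
    \<open>\<Phi>\<^sub>0\<close>.\<close>
  have "((\<lambda>i. \<Phi>\<^sub>0 (left_act (fst m (e i)) \<nu>)) \<longlongrightarrow> \<Phi>\<^sub>0 (\<nu> \<circ> snd m)) F"
    by (rule weakly_compact_pointwise_limit[OF W(2) bound _ _ \<Phi>\<^sub>0_in_bidual])
      (use multiplier_comp_in_alg_dual[OF m W(1)] alg_dual_tendsto[OF W(1) multiplier_limits(1)[OF m]] in
        \<open>auto simp: left_act_def\<close>)
  \<comment> \<open>As \<open>e i * a\<close> tends to \<open>a\<close>, the net just considered is
    \<open>\<nu> (fst m (e i))\<close>, whose limit is also the value of
    \<open>\<Phi>\<^sub>0\<close> at \<open>\<nu> \<circ> fst m\<close>.\<close>
  moreover have "\<Phi>\<^sub>0 (left_act a \<nu>) = \<nu> a" for a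
    by (rule \<Phi>\<^sub>0_eqI[OF left_act_in_alg_dual[OF W(1)]])
      (use alg_dual_tendsto[OF W(1) e_left] in \<open>simp add: left_act_def\<close>)
  ultimately show ?thesis
    using multiplier_comp_in_alg_dual[OF m W(1)] by (intro \<Phi>\<^sub>0_eqI) auto
qed

text \<open>Up to its type \<open>Z\<close> is the predual. Coordinates of the weak* topology are
  indexed by \<open>Z\<close>, and multiplication on either side permutes them among elements of
  \<open>Z\<close>.\<close>

theorem dual_banach_algebra_if_submodule:
  assumes Z: "closed_submodule_of_WAP Z"
    and iso: "isometric_isomorphism multipliers mult_norm (dual Z alg_dual_norm) (dual_norm Z alg_dual_norm)
      (theta_0 \<Phi>\<^sub>0 Z)"
  shows "\<exists>(E :: 'a predual_host set) NE J.
    dual_banach_algebra (multipliers :: (('a \<Rightarrow> 'a) \<times> ('a \<Rightarrow> 'a)) set) mult_prod mult_norm E NE J"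
proof -
  define \<theta> where "\<theta> = theta_0 \<Phi>\<^sub>0 Z"
  let ?M = "multipliers :: (('a \<Rightarrow> 'a) \<times> ('a \<Rightarrow> 'a)) set"
  have ZW: "Z \<subseteq> WAP" and ZD: "Z \<subseteq> alg_dual" and subZ: "complex_vector.subspace Z"
    and closed: "closedin (norm_topology alg_dual alg_dual_norm) Z"
    using Z by (auto simp: closed_submodule_of_WAP_def WAP_def)
  have nZ: "normed_space_on Z alg_dual_norm"
    by (rule normed_space_on_subset[OF normed_space_on_alg_dual ZD subZ])
  have bZ: "banach_space_on Z alg_dual_norm"
    by (rule banach_space_on_closed_subspace[OF banach_space_on_dual[OF normed_space_on_algebra] ZD subZ closed])
  note iso' = iso[folded \<theta>_def]
  have bM: "banach_space_on ?M mult_norm"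
    by (rule banach_space_on_isometric[OF isometric_isomorphism_inv[OF iso' subspace_multipliers]
          banach_space_on_dual[OF nZ]])
  \<comment> \<open>The copy of \<open>z\<close> in the host type is the functional that
    \<open>z\<close> induces on multipliers.\<close>
  define T where "T z = restrict0 ?M (\<lambda>m. \<theta> m z)" for z
  define E where "E = T ` Z"
  \<comment> \<open>The norm is carried over from \<open>Z\<close>, which makes \<open>T\<close>
    isometric by construction.\<close>
  define NE where "NE \<xi> = alg_dual_norm (inv_into Z T \<xi>)" for \<xi>
  define J where "J m = restrict0 E (\<lambda>\<xi>. \<xi> m)" for m
  have \<theta>D: "\<theta> m \<in> dual Z alg_dual_norm" if "m \<in> ?M" for m
    using isometric_isomorphismD(4)[OF iso' that] .
  have "clinear_on Z T"
    using dualD(3,4)[OF \<theta>D]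
    by (auto simp: clinear_on_def T_def restrict0_def fun_eq_iff scaleC_fun_def scaleC_complex_def)
  \<comment> \<open>By surjectivity of \<theta>, equality of the copies means that all functionals
    in the dual of \<open>Z\<close> agree at \<open>z\<close> and \<open>w\<close>; evaluations at
    points of the algebra are among them.\<close>
  moreover have "inj_on T Z"
  proof (rule inj_onI)
    fix z w assume z: "z \<in> Z" and w: "w \<in> Z" and eq: "T z = T w"
    have dual_eq: "f z = f w" if f: "f \<in> dual Z alg_dual_norm" for f
    proof -
      obtain m where m: "m \<in> ?M" "\<theta> m = f" using isometric_dualD(3)[OF iso' f] by blast
      then show ?thesis using fun_cong[OF eq, of m] by (simp add: T_def restrict0_def)
    qed
    show "z = w"
    proof
      fix a
      have "restrict0 Z (\<lambda>\<mu>. \<mu> a) \<in> dual Z alg_dual_norm"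
        by (rule restrict0_in_dual[OF nZ, of _ "norm a"])
          (use alg_dual_bound ZD in \<open>auto simp: clinear_on_def scaleC_fun_def mult.commute\<close>)
      from dual_eq[OF this] show "z a = w a" using z w by (simp add: restrict0_def)
    qed
  qed
  ultimately have T: "isometric_isomorphism Z alg_dual_norm E NE T"
    by (auto simp: isometric_isomorphism_def E_def NE_def bij_betw_def)
  have transport: "isometric_isomorphism ?M mult_norm (dual E NE) (dual_norm E NE) J"
    "predual_topology ?M Z alg_dual_norm \<theta> = predual_topology ?M E NE J"
    by (rule predual_transport[OF iso' nZ T _ _ subspace_multipliers];
        simp add: J_def T_def E_def restrict0_def)+
  have top: "predual_topology ?M E NE J = initial_topology ?M \<theta> Z"
    using transport(2) predual_topology_initial[OF isometric_dualD(6)[OF iso']] by simp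
  have \<theta>_eq: "\<theta> m \<mu> = \<Phi>\<^sub>0 (\<mu> \<circ> fst m)" if "\<mu> \<in> Z" for m \<mu>
    unfolding \<theta>_def by (rule theta_0_eq[OF ZW that])
  have left: "continuous_map (initial_topology ?M \<theta> Z) (initial_topology ?M \<theta> Z) (mult_prod n)" if n: "n \<in> ?M" for n
    unfolding continuous_map_initial
  proof (intro conjI ballI)
    fix \<mu> assume \<mu>: "\<mu> \<in> Z"
    have \<mu>n: "\<mu> \<circ> fst n \<in> Z" by (rule closed_submodule_multiplier(1)[OF Z \<mu> n])
    show "continuous_map (initial_topology ?M \<theta> Z) euclidean (\<lambda>m. \<theta> (mult_prod n m) \<mu>)"
      by (rule continuous_map_eq[OF continuous_map_initial_coordinate[OF \<mu>n]]) (simp add: \<theta>_eq \<mu> \<mu>n comp_assoc)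
  qed (rule Pi_I, use mult_prod_multiplier[OF n] in simp)
  have right: "continuous_map (initial_topology ?M \<theta> Z) (initial_topology ?M \<theta> Z) (\<lambda>m. mult_prod m n)"
    if n: "n \<in> ?M" for n
    unfolding continuous_map_initial
  proof (intro conjI ballI)
    fix \<mu> assume \<mu>: "\<mu> \<in> Z"
    have \<mu>n: "\<mu> \<circ> snd n \<in> Z" by (rule closed_submodule_multiplier(2)[OF Z \<mu> n])
    \<comment> \<open>In \<open>fst m \<circ> fst n\<close> the fixed factor sits on the wrong side
      of the variable one. Passing to second components reverses the order, and passing back for
      \<open>\<mu> \<circ> snd n\<close> restores the form of \<theta>.\<close>
    have "\<theta> m (\<mu> \<circ> snd n) = \<theta> (mult_prod m n) \<mu>" if m: "m \<in> ?M" for m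
    proof -
      have "\<theta> m (\<mu> \<circ> snd n) = \<Phi>\<^sub>0 (\<mu> \<circ> snd n \<circ> snd m)"
        unfolding \<theta>_eq[OF \<mu>n] by (rule \<Phi>\<^sub>0_multiplier_swap) (use \<mu>n ZW m in auto)
      also have "\<dots> = \<Phi>\<^sub>0 (\<mu> \<circ> snd (mult_prod m n))" by (simp add: comp_assoc)
      also have "\<dots> = \<Phi>\<^sub>0 (\<mu> \<circ> fst (mult_prod m n))"
        by (rule \<Phi>\<^sub>0_multiplier_swap[symmetric]) (use \<mu> ZW mult_prod_multiplier[OF m n] in auto)
      finally show ?thesis by (simp add: \<theta>_eq[OF \<mu>])
    qed
    then show "continuous_map (initial_topology ?M \<theta> Z) euclidean (\<lambda>m. \<theta> (mult_prod m n) \<mu>)"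
      by (intro continuous_map_eq[OF continuous_map_initial_coordinate[OF \<mu>n]]) simp
  qed (rule Pi_I, use mult_prod_multiplier[OF _ n] in simp)
  have "dual_banach_algebra ?M mult_prod mult_norm E NE J"
    unfolding dual_banach_algebra_def top
    using banach_algebra_on_multipliers[OF bM] banach_space_on_isometric[OF T bZ] transport(1) left right by blast
  then show ?thesis by blast
qed

end

section \<open>From a predual to a submodule\<close>

context approximate_identity_accumulation
begin

context
  fixes E :: "'e::complex_vector set" and NE and J :: "('a \<Rightarrow> 'a) \<times> ('a \<Rightarrow> 'a) \<Rightarrow> 'e \<Rightarrow> complex"
  assumes dba: "dual_banach_algebra multipliers mult_prod mult_norm E NE J"
begin

abbreviation "multiplier_set \<equiv> multipliers :: (('a \<Rightarrow> 'a) \<times> ('a \<Rightarrow> 'a)) set"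

lemma iso_J: "isometric_isomorphism multipliers mult_norm (dual E NE) (dual_norm E NE) J"
  and banach_E: "banach_space_on E NE" and normed_E: "normed_space_on E NE"
  using dba by (auto simp: dual_banach_algebra_def banach_space_on_def)

lemmas J_dual = isometric_isomorphismD(4)[OF iso_J]
  and J_bound = isometric_dualD(5)[OF iso_J normed_E]

lemma predual_topology_J: "predual_topology multipliers E NE J = initial_topology multipliers J E"
  by (rule predual_topology_initial[OF isometric_dualD(6)[OF iso_J]])

text \<open>The weak*-continuous functional on the left comes from the predual. Thus
  \<open>E\<close> is a module over the multipliers, and \<eta> is the result of letting
  \<open>n\<close> act on \<xi>.\<close>

lemma predual_left_action:
  assumes n: "n \<in> multiplier_set" and \<xi>: "\<xi> \<in> E"
  shows "\<exists>\<eta>\<in>E. \<forall>m\<in>multipliers. J (mult_prod n m) \<xi> = J m \<eta>"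
proof -
  let ?\<tau> = "predual_topology multipliers E NE J"
  have lin: "clinear_on multipliers (mult_prod n)" and cont: "continuous_map ?\<tau> ?\<tau> (mult_prod n)"
    using dba n by (auto simp: dual_banach_algebra_def banach_algebra_on_def)
  have "continuous_map ?\<tau> euclidean (\<lambda>m. J (mult_prod n m) \<xi>)"
    using continuous_map_compose[OF cont[unfolded predual_topology_J] continuous_map_initial_coordinate[OF \<xi>]]
    by (simp add: predual_topology_J comp_def)
  moreover have "clinear_on multipliers (\<lambda>m. J (mult_prod n m) \<xi>)"
    using lin isometric_dualD(1,2)[OF iso_J] mult_prod_multiplier[OF n]
    by (simp add: clinear_on_def scaleC_complex_def del: split_paired_All)
  ultimately show ?thesis
    using weak_star_continuous_functional[OF iso_J normed_E subspace_multipliers] by metis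
qed

lemma predual_right_action:
  assumes n: "n \<in> multiplier_set" and \<xi>: "\<xi> \<in> E"
  shows "\<exists>\<eta>\<in>E. \<forall>m\<in>multipliers. J (mult_prod m n) \<xi> = J m \<eta>"
proof -
  let ?\<tau> = "predual_topology multipliers E NE J"
  have lin: "clinear_on multipliers (\<lambda>m. mult_prod m n)" and cont: "continuous_map ?\<tau> ?\<tau> (\<lambda>m. mult_prod m n)"
    using dba n by (auto simp: dual_banach_algebra_def banach_algebra_on_def)
  have "continuous_map ?\<tau> euclidean (\<lambda>m. J (mult_prod m n) \<xi>)"
    using continuous_map_compose[OF cont[unfolded predual_topology_J] continuous_map_initial_coordinate[OF \<xi>]]
    by (simp add: predual_topology_J comp_def)
  moreover have "clinear_on multipliers (\<lambda>m. J (mult_prod m n) \<xi>)"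
    using lin isometric_dualD(1,2)[OF iso_J] mult_prod_multiplier[OF _ n]
    by (simp add: clinear_on_def scaleC_complex_def del: split_paired_All)
  ultimately show ?thesis
    using weak_star_continuous_functional[OF iso_J normed_E subspace_multipliers] by metis
qed

definition predual_functional :: "'e \<Rightarrow> 'a \<Rightarrow> complex" where
  "predual_functional \<xi> a = J (mult_embed a) \<xi>"

lemma predual_functional_le:
  assumes "\<xi> \<in> E"
  shows "cmod (predual_functional \<xi> a) \<le> NE \<xi> * norm a"
  using J_bound[OF mult_embed_multiplier assms, of a]
    mult_right_mono[OF mult_norm_embed[of a] normed_space_onD(2)[OF normed_E assms]]
  by (simp add: predual_functional_def mult.commute)

lemma predual_functional_in_alg_dual:
  assumes "\<xi> \<in> E"
  shows "predual_functional \<xi> \<in> alg_dual"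
  unfolding predual_functional_def
  by (rule alg_dualI[where B = "NE \<xi>"])
    (simp_all add: mult_embed_add mult_embed_scaleC isometric_dualD(1,2)[OF iso_J] mult_embed_multiplier
      predual_functional_le[OF assms, unfolded predual_functional_def])

section \<open>Weak* density of the algebra and the isometry onto functionals\<close>

lemma mult_embed_mult: "mult_prod (mult_embed a) (mult_embed b) = mult_embed (a * b)"
  by (simp add: mult_embed_def prod_eq_iff fun_eq_iff mult.assoc)

text \<open>The product in the hypothesis is \<open>mult_embed (snd p a)\<close>, and faithfulness
  makes the embedding injective; the first component follows through the multiplier
  identity.\<close>

lemma mult_one_eqI:
  assumes p: "p \<in> multiplier_set" and eq: "\<And>a. mult_prod (mult_embed a) p = mult_embed a"
  shows "p = mult_one"
proof -
  have "snd p a = a" for a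
  proof (rule right_faithful)
    fix b
    have "mult_embed (snd p a) = mult_embed a" using eq[of a] by (simp add: mult_prod_embed[OF p])
    from fun_cong[OF arg_cong[OF this, of fst], of b] show "snd p a * b = a * b"
      by (simp add: mult_embed_def)
  qed
  moreover have "fst p b = b" for b
    by (rule left_faithful) (simp add: multiplier_eq[OF p] calculation)
  ultimately show ?thesis by (simp add: mult_one_def prod_eq_iff fun_eq_iff)
qed

text \<open>The test family \<open>S\<close> consists of elements \<eta> obtained from some \<zeta>
  by an action of \<open>mult_embed a\<close>. On it the net becomes the functional of \<zeta> at
  \<open>a * e i\<close>, which converges in norm, and by \<open>mult_one_eqI\<close> it singles out
  the identity.\<close>

lemma approximate_identity_weak_star:
  assumes \<xi>: "\<xi> \<in> E"
  shows "((\<lambda>i. J (mult_embed (e i)) \<xi>) \<longlongrightarrow> J mult_one \<xi>) F"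
proof (rule tendsto_initial_compact[where g = J and X = multipliers and I = E and l = mult_one
      and K = "{m \<in> multipliers. mult_norm m \<le> 1}"
      and S = "{\<eta> \<in> E. \<exists>a. \<exists>\<xi>\<in>E. \<forall>m\<in>multipliers. J (mult_prod (mult_embed a) m) \<xi> = J m \<eta>}"])
  let ?S = "{\<eta> \<in> E. \<exists>a. \<exists>\<xi>\<in>E. \<forall>m\<in>multipliers. J (mult_prod (mult_embed a) m) \<xi> = J m \<eta>}"
  show "compactin (initial_topology multipliers J E) {m \<in> multipliers. mult_norm m \<le> 1}"
    using Banach_Alaoglu[OF iso_J normed_E] by (simp add: predual_topology_J)
  have "mult_norm (mult_embed (e i)) \<le> 1" for i
    using mult_norm_embed[of "e i"] norm_e[of i] by simp
  then show "\<forall>\<^sub>F i in F. mult_embed (e i) \<in> {m \<in> multipliers. mult_norm m \<le> 1}"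
    by (simp add: mult_embed_multiplier)
  show "((\<lambda>i. J (mult_embed (e i)) \<eta>) \<longlongrightarrow> J mult_one \<eta>) F" if \<eta>_S: "\<eta> \<in> ?S" for \<eta>
  proof -
    obtain a \<zeta> where \<zeta>: "\<zeta> \<in> E" and \<eta>: "\<And>m. m \<in> multipliers \<Longrightarrow> J (mult_prod (mult_embed a) m) \<zeta> = J m \<eta>"
      using \<eta>_S by blast
    have "((\<lambda>i. predual_functional \<zeta> (a * e i)) \<longlongrightarrow> predual_functional \<zeta> a) F"
      by (rule alg_dual_tendsto[OF predual_functional_in_alg_dual[OF \<zeta>] e_right])
    then show ?thesis
      by (simp add: predual_functional_def \<eta>[OF mult_embed_multiplier, symmetric]
          \<eta>[OF mult_one_multiplier, symmetric] mult_embed_mult mult_prod_one)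
  qed
  show "p = mult_one" if "p \<in> {m \<in> multipliers. mult_norm m \<le> 1}"
    and eq: "\<And>\<eta>. \<eta> \<in> ?S \<Longrightarrow> J p \<eta> = J mult_one \<eta>" for p
  proof (rule mult_one_eqI)
    show p: "p \<in> multipliers" using that by simp
    fix a
    show "mult_prod (mult_embed a) p = mult_embed a"
    proof (rule isometric_dualD(4)[OF iso_J mult_prod_multiplier[OF mult_embed_multiplier p] mult_embed_multiplier])
      fix \<zeta> assume \<zeta>: "\<zeta> \<in> E"
      obtain \<eta> where \<eta>: "\<eta> \<in> E" "\<forall>m\<in>multipliers. J (mult_prod (mult_embed a) m) \<zeta> = J m \<eta>"
        using predual_left_action[OF mult_embed_multiplier \<zeta>] by blast
      then have "J p \<eta> = J mult_one \<eta>" using \<zeta> by (intro eq) blast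
      moreover have "J (mult_prod (mult_embed a) p) \<zeta> = J p \<eta>" using \<eta>(2) p by blast
      moreover have "J (mult_prod (mult_embed a) mult_one) \<zeta> = J mult_one \<eta>" using \<eta>(2) mult_one_multiplier by blast
      ultimately show "J (mult_prod (mult_embed a) p) \<zeta> = J (mult_embed a) \<zeta>" by (simp add: mult_prod_one)
    qed
  qed
qed (use \<xi> in auto)

text \<open>The multiplier is absorbed into \<eta>, which reduces the claim to the limit at the
  identity.\<close>

lemma predual_functional_multiplier_limit:
  assumes m: "m \<in> multiplier_set" and \<xi>: "\<xi> \<in> E"
  shows "((\<lambda>i. predual_functional \<xi> (fst m (e i))) \<longlongrightarrow> J m \<xi>) F"
proof -
  obtain \<eta> where \<eta>: "\<eta> \<in> E" "\<forall>k\<in>multipliers. J (mult_prod m k) \<xi> = J k \<eta>"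
    using predual_left_action[OF m \<xi>] by blast
  have "J mult_one \<eta> = J m \<xi>" using \<eta>(2) mult_one_multiplier mult_prod_one(1)[of m] by metis
  moreover have "J (mult_embed (e i)) \<eta> = predual_functional \<xi> (fst m (e i))" for i
    using bspec[OF \<eta>(2) mult_embed_multiplier, of "e i"]
    by (simp add: predual_functional_def mult_prod_embed[OF m])
  ultimately show ?thesis using approximate_identity_weak_star[OF \<eta>(1)] by simp
qed

text \<open>For the lower bound, a norming functional on \<open>E\<close> is a multiplier in the
  unit ball. Its values are limits of values at \<open>fst m (e i)\<close>, which lie in the unit
  ball of the algebra.\<close>

lemma norm_predual_functional:
  assumes \<xi>: "\<xi> \<in> E"
  shows "alg_dual_norm (predual_functional \<xi>) = NE \<xi>"
proof (rule antisym)
  note D = predual_functional_in_alg_dual[OF \<xi>]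
  show "alg_dual_norm (predual_functional \<xi>) \<le> NE \<xi>"
  proof (rule dual_norm_le[OF normed_space_on_algebra])
    fix a :: 'a assume "norm a \<le> 1"
    then show "cmod (predual_functional \<xi> a) \<le> NE \<xi>"
      using predual_functional_le[OF \<xi>, of a] mult_left_mono[OF \<open>norm a \<le> 1\<close> normed_space_onD(2)[OF normed_E \<xi>]]
      by simp
  qed
  obtain f where f: "f \<in> dual E NE" "dual_norm E NE f \<le> 1" "f \<xi> = complex_of_real (NE \<xi>)"
    using norming_functional[OF normed_E \<xi>] by blast
  obtain m where m: "m \<in> multipliers" "J m = f" using isometric_dualD(3)[OF iso_J f(1)] by blast
  have norm_m: "mult_norm m \<le> 1" using isometric_isomorphismD(3)[OF iso_J m(1)] m(2) f(2) by simp
  have bound: "cmod (predual_functional \<xi> (fst m (e i))) \<le> alg_dual_norm (predual_functional \<xi>)" for i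
  proof -
    have "norm (fst m (e i)) \<le> 1"
      using mult_norm_bound(1)[OF m(1), of "e i"] mult_mono[OF norm_m norm_e[of i]] by simp
    then show ?thesis by (rule dual_norm_ge[OF normed_space_on_algebra D UNIV_I])
  qed
  have "cmod (J m \<xi>) \<le> alg_dual_norm (predual_functional \<xi>)"
    by (rule tendsto_upperbound[OF tendsto_norm[OF predual_functional_multiplier_limit[OF m(1) \<xi>]] _ F_nontrivial])
      (use bound in simp)
  then show "NE \<xi> \<le> alg_dual_norm (predual_functional \<xi>)"
    using normed_space_onD(2)[OF normed_E \<xi>] m(2) f(3) by simp
qed

lemma predual_functional_isometry:
  "isometric_isomorphism E NE (predual_functional ` E) alg_dual_norm predual_functional"
proof -
  note sub = normed_space_onD(1)[OF normed_E]
  have lin: "clinear_on E predual_functional"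
    using dualD(3,4)[OF J_dual[OF mult_embed_multiplier]]
    by (auto simp: clinear_on_def predual_functional_def fun_eq_iff scaleC_fun_def scaleC_complex_def)
  have "inj_on predual_functional E"
  proof (rule inj_onI)
    fix \<xi> \<eta> assume \<xi>: "\<xi> \<in> E" and \<eta>: "\<eta> \<in> E" and eq: "predual_functional \<xi> = predual_functional \<eta>"
    have d: "\<xi> - \<eta> \<in> E" by (rule complex_vector.subspace_diff[OF sub \<xi> \<eta>])
    have "predual_functional (\<xi> - \<eta>) = 0" using clinear_on_diff[OF lin sub \<xi> \<eta>] eq by simp
    then have "NE (\<xi> - \<eta>) = 0"
      using norm_predual_functional[OF d] by (simp add: normed_space_onD(6)[OF normed_space_on_alg_dual])
    then show "\<xi> = \<eta>" using normed_space_onD(3)[OF normed_E d] by simp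
  qed
  then show ?thesis
    using lin norm_predual_functional by (simp add: isometric_isomorphism_def bij_betw_def)
qed

text \<open>Here \<open>A n\<close> stands for the action of \<open>n\<close> on a fixed element of
  \<open>E\<close>, from either side. The orbit of the algebra's unit ball lies in the image of the
  weak*-compact unit ball of multipliers under a weak*-weakly continuous map.\<close>

lemma orbit_weakly_compact:
  assumes A: "\<And>n. n \<in> multiplier_set \<Longrightarrow> A n \<in> E"
    and cont: "\<And>k. k \<in> multiplier_set \<Longrightarrow> \<exists>\<eta>\<in>E. \<forall>n\<in>multipliers. J k (A n) = J n \<eta>"
    and T: "\<And>a. T a = predual_functional (A (mult_embed a))" and lin: "clinear_on UNIV T"
  shows "weakly_compact_map UNIV norm alg_dual alg_dual_norm T"
proof -
  let ?W = "weak_topology alg_dual alg_dual_norm :: ('a \<Rightarrow> complex) topology"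
  let ?B = "{m \<in> multiplier_set. mult_norm m \<le> 1}"
  define h where "h n = predual_functional (A n)" for n
  have "continuous_map (initial_topology multipliers J E) ?W h"
    unfolding weak_topology_initial continuous_map_initial
  proof (intro conjI ballI)
    show "h \<in> topspace (initial_topology multipliers J E) \<rightarrow> alg_dual"
      by (rule Pi_I, use A predual_functional_in_alg_dual in \<open>simp add: h_def\<close>)
    fix \<Phi> :: "('a \<Rightarrow> complex) \<Rightarrow> complex" assume \<Phi>: "\<Phi> \<in> dual alg_dual alg_dual_norm"
    note T = isometric_isomorphismD[OF predual_functional_isometry]
    \<comment> \<open>Composed with the embedding of \<open>E\<close>, a functional on the dual of
      the algebra becomes one on \<open>E\<close>, that is, a multiplier \<open>k\<close>; the
      hypothesis \<open>cont\<close> then makes the pairing a coordinate in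
      \<open>n\<close>.\<close>
    have "restrict0 E (\<lambda>\<xi>. \<Phi> (predual_functional \<xi>)) \<in> dual E NE"
    proof (rule restrict0_in_dual[OF normed_E])
      show "clinear_on E (\<lambda>\<xi>. \<Phi> (predual_functional \<xi>))"
        using clinear_onD[OF T(1)] dualD(3,4)[OF \<Phi>] predual_functional_in_alg_dual
        by (simp add: clinear_on_def scaleC_complex_def)
      show "cmod (\<Phi> (predual_functional \<xi>)) \<le> dual_norm alg_dual alg_dual_norm \<Phi> * NE \<xi>" if "\<xi> \<in> E" for \<xi>
        using dual_norm_bound[OF normed_space_on_alg_dual \<Phi> predual_functional_in_alg_dual[OF that]]
        by (simp add: norm_predual_functional[OF that])
    qed
    then obtain k where k: "k \<in> multipliers" "J k = restrict0 E (\<lambda>\<xi>. \<Phi> (predual_functional \<xi>))"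
      using isometric_dualD(3)[OF iso_J] by blast
    obtain \<eta> where \<eta>: "\<eta> \<in> E" "\<forall>n\<in>multipliers. J k (A n) = J n \<eta>" using cont[OF k(1)] by blast
    have "J n \<eta> = \<Phi> (h n)" if "n \<in> multipliers" for n
      using \<eta>(2) that A[OF that] fun_cong[OF k(2), of "A n"] by (simp add: restrict0_def h_def)
    then show "continuous_map (initial_topology multipliers J E) euclidean (\<lambda>n. \<Phi> (h n))"
      by (intro continuous_map_eq[OF continuous_map_initial_coordinate[OF \<eta>(1)]]) simp
  qed
  then have K: "compactin ?W (h ` ?B)"
    using Banach_Alaoglu[OF iso_J normed_E] by (intro image_compactin) (simp_all add: predual_topology_J)
  have "Hausdorff_space ?W"
    unfolding weak_topology_initial
  proof (rule Hausdorff_initial)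
    fix \<mu> \<nu> :: "'a \<Rightarrow> complex" assume D: "\<mu> \<in> alg_dual" "\<nu> \<in> alg_dual"
      and eq: "\<And>\<Phi>. \<Phi> \<in> dual alg_dual alg_dual_norm \<Longrightarrow> \<Phi> \<mu> = \<Phi> \<nu>"
    show "\<mu> = \<nu>"
    proof
      fix a show "\<mu> a = \<nu> a" using eq[OF evaluation_in_bidual[of a]] D by (simp add: restrict0_def)
    qed
  qed
  \<comment> \<open>Being closed, the compact image contains the weak closure of the orbit.\<close>
  then have "closedin ?W (h ` ?B)" using K by (rule compactin_imp_closedin)
  moreover have "T ` {a \<in> UNIV. norm a \<le> 1} \<subseteq> h ` ?B"
  proof
    fix \<mu> assume "\<mu> \<in> T ` {a \<in> UNIV. norm a \<le> 1}"
    then obtain a where "norm a \<le> 1" "\<mu> = h (mult_embed a)" by (auto simp: T h_def)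
    moreover from this have "mult_embed a \<in> ?B"
      using mult_embed_multiplier mult_norm_embed[of a] by simp
    ultimately show "\<mu> \<in> h ` ?B" by blast
  qed
  ultimately have "?W closure_of (T ` {a \<in> UNIV. norm a \<le> 1}) \<subseteq> h ` ?B" by (intro closure_of_minimal)
  then have "compactin ?W (?W closure_of (T ` {a \<in> UNIV. norm a \<le> 1}))"
    by (rule closed_compactin[OF K]) simp
  moreover have "T ` UNIV \<subseteq> alg_dual"
    using T A[OF mult_embed_multiplier] predual_functional_in_alg_dual by auto
  ultimately show ?thesis using lin by (simp add: weakly_compact_map_def)
qed

text \<open>Acting on the left by \<open>a\<close> means multiplying the variable multiplier by
  \<open>mult_embed a\<close> on the right. Producing \<open>A\<close> uses weak*-continuity on one
  side, and continuity of the orbit map uses it on the other.\<close>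

lemma predual_functional_left_act:
  assumes \<xi>: "\<xi> \<in> E"
  shows "left_act a (predual_functional \<xi>) \<in> predual_functional ` E"
    and "weakly_compact_map UNIV norm alg_dual alg_dual_norm (\<lambda>a. left_act a (predual_functional \<xi>))"
proof -
  have "\<forall>n\<in>multipliers. \<exists>\<eta>\<in>E. \<forall>m\<in>multipliers. J (mult_prod m n) \<xi> = J m \<eta>"
    using predual_right_action[OF _ \<xi>] by blast
  then obtain A where A: "\<And>n. n \<in> multipliers \<Longrightarrow> A n \<in> E"
    and J_A: "\<And>m n. m \<in> multipliers \<Longrightarrow> n \<in> multipliers \<Longrightarrow> J m (A n) = J (mult_prod m n) \<xi>"
    by metis
  have act: "left_act a (predual_functional \<xi>) = predual_functional (A (mult_embed a))" for a
    by (simp add: fun_eq_iff left_act_def predual_functional_def J_A mult_embed_multiplier mult_embed_mult)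
  then show "left_act a (predual_functional \<xi>) \<in> predual_functional ` E"
    using A[OF mult_embed_multiplier] by simp
  show "weakly_compact_map UNIV norm alg_dual alg_dual_norm (\<lambda>a. left_act a (predual_functional \<xi>))"
  proof (rule orbit_weakly_compact[where A = A])
    show "\<exists>\<eta>\<in>E. \<forall>n\<in>multipliers. J k (A n) = J n \<eta>" if "k \<in> multipliers" for k
      using predual_left_action[OF that \<xi>] J_A[OF that] by metis
    show "clinear_on UNIV (\<lambda>a. left_act a (predual_functional \<xi>))"
      using alg_dualD[OF predual_functional_in_alg_dual[OF \<xi>]]
      by (simp add: clinear_on_def left_act_def fun_eq_iff scaleC_fun_def scaleC_complex_def
          distrib_left mult_scaleC_right)
  qed (rule A act, assumption?)+
qed

text \<open>The mirror image, with the two actions on \<open>E\<close> exchanging their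
  roles.\<close>

lemma predual_functional_right_act:
  assumes \<xi>: "\<xi> \<in> E"
  shows "right_act (predual_functional \<xi>) a \<in> predual_functional ` E"
    and "weakly_compact_map UNIV norm alg_dual alg_dual_norm (\<lambda>a. right_act (predual_functional \<xi>) a)"
proof -
  have "\<forall>n\<in>multipliers. \<exists>\<eta>\<in>E. \<forall>m\<in>multipliers. J (mult_prod n m) \<xi> = J m \<eta>"
    using predual_left_action[OF _ \<xi>] by blast
  then obtain A where A: "\<And>n. n \<in> multipliers \<Longrightarrow> A n \<in> E"
    and J_A: "\<And>m n. m \<in> multipliers \<Longrightarrow> n \<in> multipliers \<Longrightarrow> J m (A n) = J (mult_prod n m) \<xi>"
    by metis
  have act: "right_act (predual_functional \<xi>) a = predual_functional (A (mult_embed a))" for a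
    by (simp add: fun_eq_iff right_act_def predual_functional_def J_A mult_embed_multiplier mult_embed_mult)
  then show "right_act (predual_functional \<xi>) a \<in> predual_functional ` E"
    using A[OF mult_embed_multiplier] by simp
  show "weakly_compact_map UNIV norm alg_dual alg_dual_norm (\<lambda>a. right_act (predual_functional \<xi>) a)"
  proof (rule orbit_weakly_compact[where A = A])
    show "\<exists>\<eta>\<in>E. \<forall>n\<in>multipliers. J k (A n) = J n \<eta>" if "k \<in> multipliers" for k
      using predual_right_action[OF that \<xi>] J_A[OF that] by metis
    show "clinear_on UNIV (\<lambda>a. right_act (predual_functional \<xi>) a)"
      using alg_dualD[OF predual_functional_in_alg_dual[OF \<xi>]]
      by (simp add: clinear_on_def right_act_def fun_eq_iff scaleC_fun_def scaleC_complex_def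
          distrib_right mult_scaleC_left)
  qed (rule A act, assumption?)+
qed

text \<open>Once \<open>theta_0\<close> is known to be \<open>J\<close> read through the isometry of
  \<open>E\<close> onto \<open>Z\<close>, \<open>predual_transport\<close> yields the isomorphism
  and the equality of topologies together.\<close>

theorem submodule_if_dual_banach_algebra:
  "\<exists>Z. closed_submodule_of_WAP Z \<and>
     isometric_isomorphism multiplier_set mult_norm (dual Z alg_dual_norm) (dual_norm Z alg_dual_norm) (theta_0 \<Phi>\<^sub>0 Z) \<and>
     continuous_map (predual_topology multipliers E NE J) (weak_star_topology Z alg_dual_norm) (theta_0 \<Phi>\<^sub>0 Z) \<and>
     predual_topology multipliers E NE J = predual_topology multipliers Z alg_dual_norm (theta_0 \<Phi>\<^sub>0 Z)"
proof -
  define Z where "Z = predual_functional ` E"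
  note T = predual_functional_isometry[folded Z_def]
  have ZD: "Z \<subseteq> alg_dual" using predual_functional_in_alg_dual by (auto simp: Z_def)
  have ZW: "Z \<subseteq> WAP"
    using predual_functional_in_alg_dual predual_functional_left_act(2) predual_functional_right_act(2)
    by (auto simp: Z_def WAP_def)
  have bZ: "banach_space_on Z alg_dual_norm" by (rule banach_space_on_isometric[OF T banach_E])
  have "closedin (norm_topology alg_dual alg_dual_norm) Z"
    by (rule closedin_banach_subspace[OF normed_space_on_alg_dual ZD bZ])
  moreover have "complex_vector.subspace Z"
    using bZ normed_space_onD(1) by (auto simp: banach_space_on_def)
  moreover have "left_act a \<mu> \<in> Z" "right_act \<mu> a \<in> Z" if "\<mu> \<in> Z" for a \<mu>
    using that predual_functional_left_act(1) predual_functional_right_act(1) by (auto simp: Z_def)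
  ultimately have sub: "closed_submodule_of_WAP Z" using ZW by (simp add: closed_submodule_of_WAP_def)
  \<comment> \<open>The net \<open>fst m (e i)\<close> has a genuine limit under these functionals,
    so every accumulation point \<open>\<Phi>\<^sub>0\<close> gives the same value.\<close>
  have \<theta>: "theta_0 \<Phi>\<^sub>0 Z m (predual_functional \<xi>) = J m \<xi>" if m: "m \<in> multipliers" and \<xi>: "\<xi> \<in> E" for m \<xi>
  proof -
    have "theta_0 \<Phi>\<^sub>0 Z m (predual_functional \<xi>) = \<Phi>\<^sub>0 (predual_functional \<xi> \<circ> fst m)"
      by (rule theta_0_eq[OF ZW]) (use \<xi> in \<open>simp add: Z_def\<close>)
    also have "\<dots> = J m \<xi>"
      by (rule \<Phi>\<^sub>0_eqI[OF multiplier_comp_in_alg_dual(1)[OF m predual_functional_in_alg_dual[OF \<xi>]]])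
        (use predual_functional_multiplier_limit[OF m \<xi>] in simp)
    finally show ?thesis .
  qed
  have transport: "isometric_isomorphism multiplier_set mult_norm (dual Z alg_dual_norm)
      (dual_norm Z alg_dual_norm) (theta_0 \<Phi>\<^sub>0 Z)"
    "predual_topology multipliers E NE J = predual_topology multipliers Z alg_dual_norm (theta_0 \<Phi>\<^sub>0 Z)"
    by (rule predual_transport[OF iso_J normed_E T _ _ subspace_multipliers]; use \<theta> theta_0_outside in blast)+
  have "continuous_map (predual_topology multipliers E NE J) (weak_star_topology Z alg_dual_norm) (theta_0 \<Phi>\<^sub>0 Z)"
    unfolding transport(2) predual_topology_initial[OF isometric_dualD(6)[OF transport(1)]]
      weak_star_topology_initial continuous_map_initial
    using isometric_isomorphismD(4)[OF transport(1)] continuous_map_initial_coordinate by (auto intro!: Pi_I)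
  then show ?thesis using sub transport by blast
qed

end

end

theorem theorem7p9:
  fixes e :: "'i \<Rightarrow> 'a::complex_banach_algebra"
    and F :: "'i filter"
    and \<Phi>\<^sub>0 :: "('a \<Rightarrow> complex) \<Rightarrow> complex"
  assumes "contractive_approximate_identity e F"
    and "accumulation_point (weak_star_topology alg_dual alg_dual_norm)
           (\<lambda>i. bidual_embedding (e i)) F \<Phi>\<^sub>0"
  shows
    "((\<exists>(E :: 'a predual_host set) NE J.
         dual_banach_algebra (multipliers :: (('a \<Rightarrow> 'a) \<times> ('a \<Rightarrow> 'a)) set)
           mult_prod mult_norm E NE J)
      \<longleftrightarrow>
      (\<exists>Z. closed_submodule_of_WAP Z \<and>
         isometric_isomorphism multipliers mult_norm
           (dual Z alg_dual_norm) (dual_norm Z alg_dual_norm) (theta_0 \<Phi>\<^sub>0 Z)))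
     \<and>
     (\<forall>(E :: 'e::complex_vector set) NE J.
        dual_banach_algebra (multipliers :: (('a \<Rightarrow> 'a) \<times> ('a \<Rightarrow> 'a)) set)
          mult_prod mult_norm E NE J
        \<longrightarrow>
        (\<exists>Z. closed_submodule_of_WAP Z \<and>
           isometric_isomorphism multipliers mult_norm
             (dual Z alg_dual_norm) (dual_norm Z alg_dual_norm) (theta_0 \<Phi>\<^sub>0 Z) \<and>
           continuous_map (predual_topology multipliers E NE J)
             (weak_star_topology Z alg_dual_norm) (theta_0 \<Phi>\<^sub>0 Z) \<and>
           predual_topology multipliers E NE J =
             predual_topology multipliers Z alg_dual_norm (theta_0 \<Phi>\<^sub>0 Z)))"
proof -
  interpret approximate_identity_accumulation e F \<Phi>\<^sub>0
    using assms by unfold_locales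
  show ?thesis
  proof (intro conjI iffI allI impI)
    assume "\<exists>(E :: 'a predual_host set) NE J.
      dual_banach_algebra (multipliers :: (('a \<Rightarrow> 'a) \<times> ('a \<Rightarrow> 'a)) set) mult_prod mult_norm E NE J"
    then show "\<exists>Z. closed_submodule_of_WAP Z \<and>
        isometric_isomorphism multipliers mult_norm
          (dual Z alg_dual_norm) (dual_norm Z alg_dual_norm) (theta_0 \<Phi>\<^sub>0 Z)"
      using submodule_if_dual_banach_algebra by metis
  next
    assume "\<exists>Z. closed_submodule_of_WAP Z \<and>
      isometric_isomorphism multipliers mult_norm
        (dual Z alg_dual_norm) (dual_norm Z alg_dual_norm) (theta_0 \<Phi>\<^sub>0 Z)"
    then show "\<exists>(E :: 'a predual_host set) NE J.
      dual_banach_algebra (multipliers :: (('a \<Rightarrow> 'a) \<times> ('a \<Rightarrow> 'a)) set) mult_prod mult_norm E NE J"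
      using dual_banach_algebra_if_submodule by metis
  \<comment> \<open>That theorem holds for a predual in any type: it was applied at the host type
    above, and here at the arbitrary type of \<open>E\<close>.\<close>
  qed (rule submodule_if_dual_banach_algebra)
qed

end
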